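(* For any $\sigma\in(5/3,2)$ there exists a unique self-similar profile $F\in\mathcal M_+([0,\infty])$ that satisfies $$\mu\int_{[0,\infty]}\partial_\xi\varphi(\xi)\,\xi\,F(\xi)\,d\xi=\int_{[0,\infty]}\int_{[0,\infty]}F(\xi)\,\eta^{-\sigma}(\xi^{1/3}+\eta^{1/3})^2\big[\varphi(\xi+\eta)-\varphi(\xi)\big]\,d\eta\,d\xi$$ for any test function $\varphi\in C^\infty([0,\infty])\cap\mathcal X$, where $\mu=(\sigma-\frac53)^{-1}$. Moreover, $F\in C^\infty(0,\infty)$ and it satisfies, for any $\gamma>0$ and for any $\beta\in(0,\sigma-\frac53)$, $$\int_0^\infty(\xi^\beta+\xi^{-\gamma})F(\xi)\,d\xi<\infty,\qquad \int_{[0,\infty]}F(\xi)\,d\xi=1 .$$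
   Context: $[0,\infty]$ is the compactified half-line and $\mathcal M_+([0,\infty])$ is the space of nonnegative Radon measures on $[0,\infty]$; $\int\psi(\xi)F(\xi)\,d\xi$ denotes integration of $\psi$ against the measure $F$. For $M>0$ let $X_M=\{\varphi\in C([0,\infty]):\varphi(x)=\text{const. for }x\ge M\}$ and $\mathcal X=\bigcup_{M>0}X_M$. $C^\infty([0,\infty])$ is the set of $\psi\in C^\infty([0,\infty))$ such that $\lim_{v\to\infty}\partial_v^k\psi(v)$ exists for every $k\in\mathbb N_0$. The term "self-similar profile" refers to the ansatz $f(V,t)=t^{-\mu}F(V/t^\mu)$ for the linear coagulation equation $$\partial_tf(V,t)=\int_0^V v^{-\sigma}\big((V-v)^{1/3}+v^{1/3}\big)^2f(V-v,t)\,dv-\int_0^\infty v^{-\sigma}(V^{1/3}+v^{1/3})^2\,dv\,f(V,t)$$ with initial datum $f(V,0)=\delta(V)$ (the Dirac mass at $V=0$); the displayed equation in the claim is the weak form of the equation which $F$ then formally satisfies. *)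

theory Defs
  imports "HOL-Analysis.Analysis"
begin

text \<open>
  The compactified half-line \<open>[0,\<infinity>]\<close> is the type \<^typ>\<open>ennreal\<close> with its order topology.
  As it is a compact metrizable space, its nonnegative Radon measures are exactly its finite
  Borel measures.
\<close>

definition radon_measures :: "ennreal measure set" where
  "radon_measures = {F. sets F = sets borel \<and> finite_measure F}"

text \<open>
  \<open>deriv_within S f\<close> is the derivative relative to \<open>S\<close>; it is used for \<open>S = {0..}\<close>, where it is
  the one-sided derivative at \<open>0\<close>, and for \<open>S = {0<..}\<close>, where it is the ordinary derivative.
  Values outside \<open>S\<close> are irrelevant.
\<close>

definition deriv_within :: "real set \<Rightarrow> (real \<Rightarrow> real) \<Rightarrow> real \<Rightarrow> real" where
  "deriv_within S f x = vector_derivative f (at x within S)"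

definition smooth_within :: "real set \<Rightarrow> (real \<Rightarrow> real) \<Rightarrow> bool" where
  "smooth_within S f \<longleftrightarrow> (\<forall>k. (deriv_within S ^^ k) f differentiable_on S)"

text \<open>
  Functions on \<open>[0,\<infinity>]\<close> are taken as \<^typ>\<open>ennreal \<Rightarrow> real\<close>; \<open>finite_part \<phi>\<close> is the restriction to
  \<open>[0,\<infinity>)\<close>. A function of \<open>C\<^sup>\<infinity>([0,\<infinity>])\<close> is identified with its continuous extension to \<open>\<infinity>\<close>.
\<close>

definition finite_part :: "(ennreal \<Rightarrow> real) \<Rightarrow> real \<Rightarrow> real" where
  "finite_part \<phi> x = \<phi> (ennreal x)"

definition C_inf_closed :: "(ennreal \<Rightarrow> real) set" where
  "C_inf_closed = {\<psi>. continuous_on UNIV \<psi> \<and> smooth_within {0..} (finite_part \<psi>) \<and>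
     (\<forall>k. \<exists>L. (((deriv_within {0..} ^^ k) (finite_part \<psi>)) \<longlongrightarrow> L) at_top)}"

definition X_const_from :: "real \<Rightarrow> (ennreal \<Rightarrow> real) set" where
  "X_const_from M = {\<phi>. continuous_on UNIV \<phi> \<and> (\<exists>c. \<forall>x\<ge>ennreal M. \<phi> x = c)}"

definition X_space :: "(ennreal \<Rightarrow> real) set" where
  "X_space = (\<Union>M\<in>{0<..}. X_const_from M)"

definition sim_exponent :: "real \<Rightarrow> real" where
  "sim_exponent \<sigma> = inverse (\<sigma> - 5/3)"

text \<open>
  Weak form of the profile equation. For \<open>\<phi>\<close> in \<open>X_space\<close> both outer integrands, as functions of
  \<open>\<xi>\<close>, vanish near \<open>\<xi> = \<infinity>\<close>. In the formulas below they are \<open>0\<close> at \<open>\<xi> = \<infinity>\<close> too, since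
  \<open>enn2real \<infinity> = 0\<close> and \<open>\<phi> (\<infinity> + \<eta>) - \<phi> \<infinity> = 0\<close>. The inner integral is with respect to Lebesgue
  measure, so the points \<open>\<eta> = 0\<close> and \<open>\<eta> = \<infinity>\<close> are negligible.
\<close>

definition weak_profile_equation :: "real \<Rightarrow> ennreal measure \<Rightarrow> bool" where
  "weak_profile_equation \<sigma> F \<longleftrightarrow> (\<forall>\<phi> \<in> C_inf_closed \<inter> X_space.
     sim_exponent \<sigma> *
       (LINT \<xi>|F. deriv_within {0..} (finite_part \<phi>) (enn2real \<xi>) * enn2real \<xi>) =
     (LINT \<xi>|F. (LINT \<eta>:{0<..}|lborel.
        \<eta> powr (-\<sigma>) * (enn2real \<xi> powr (1/3) + \<eta> powr (1/3))\<^sup>2 *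
          (\<phi> (\<xi> + ennreal \<eta>) - \<phi> \<xi>))))"

text \<open>
  The ansatz \<open>f(V,t) = t\<^sup>-\<^sup>\<mu> F(V/t\<^sup>\<mu>)\<close>, for measures: \<open>f(\<cdot>,t)\<close> is the image of \<open>F\<close> under
  \<open>\<xi> \<mapsto> t\<^sup>\<mu> \<xi>\<close>.
\<close>

definition self_similar_ansatz :: "real \<Rightarrow> ennreal measure \<Rightarrow> real \<Rightarrow> ennreal measure" where
  "self_similar_ansatz \<sigma> F t = distr F borel (\<lambda>\<xi>. ennreal (t powr sim_exponent \<sigma>) * \<xi>)"

text \<open>
  Initial datum \<open>f(\<cdot>,0) = \<delta>\<close>, attained in the weak-* sense of measures on \<open>[0,\<infinity>]\<close>. The weak
  equation alone does not determine \<open>F\<close>: it is linear, and it is solved by the Dirac mass at \<open>\<infinity>\<close>.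
\<close>

definition starts_from_dirac :: "real \<Rightarrow> ennreal measure \<Rightarrow> bool" where
  "starts_from_dirac \<sigma> F \<longleftrightarrow> (\<forall>\<psi> :: ennreal \<Rightarrow> real. continuous_on UNIV \<psi> \<longrightarrow>
     ((\<lambda>t. LINT V|self_similar_ansatz \<sigma> F t. \<psi> V) \<longlongrightarrow> \<psi> 0) (at_right 0))"

definition self_similar_profile :: "real \<Rightarrow> ennreal measure \<Rightarrow> bool" where
  "self_similar_profile \<sigma> F \<longleftrightarrow>
     F \<in> radon_measures \<and> starts_from_dirac \<sigma> F \<and> weak_profile_equation \<sigma> F"

text \<open>
  \<open>F \<in> C\<^sup>\<infinity>(0,\<infinity>)\<close> for a measure \<open>F\<close>: it has a smooth Lebesgue density on \<open>(0,\<infinity>)\<close>, and no mass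
  at \<open>0\<close> and \<open>\<infinity>\<close>.
\<close>

definition has_smooth_density :: "ennreal measure \<Rightarrow> bool" where
  "has_smooth_density F \<longleftrightarrow> (\<exists>g :: real \<Rightarrow> real.
     smooth_within {0<..} g \<and> (\<forall>x>0. 0 \<le> g x) \<and>
     F = distr (density lborel (\<lambda>x. indicator {0<..} x * ennreal (g x))) borel ennreal)"

end

theory Submission
  imports Defs "HOL-Probability.Probability"
begin

text \<open>
  Write \<open>\<alpha> = \<sigma> - 5/3 = 1/\<mu>\<close> and \<open>k(x,\<eta>) = \<eta>\<^sup>-\<^sup>\<sigma> (x\<^sup>1\<^sup>/\<^sup>3 + \<eta>\<^sup>1\<^sup>/\<^sup>3)\<^sup>2\<close>. Since \<open>\<phi>(\<xi> + \<eta>) - \<phi>(\<xi>)\<close> is the integral of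
  \<open>\<phi>'\<close>, the weak equation says that \<open>\<mu> \<integral> h(x) x dF\<close> equals
  \<open>\<integral> dF(x) \<integral> k(x,\<eta>) \<integral>\<^sub>0\<^sup>\<eta> h(x + w) dw d\<eta>\<close> for \<open>h = \<phi>'\<close>, hence for all Borel \<open>h \<ge> 0\<close>. By homogeneity of
  \<open>k\<close> this becomes, for the law \<open>\<nu>\<close> of \<open>Y = X\<^sup>-\<^sup>\<alpha>\<close> with \<open>X\<close> distributed as \<open>F\<close>, the fixed-point equation
  \<open>\<integral> f d\<nu> = \<integral>\<integral> f(y r) y \<nu>(dy) \<Lambda>(dr)\<close> with an explicit finite measure \<open>\<Lambda>\<close> on \<open>(0,1)\<close>.

  With \<open>T(n) = \<integral> r\<^sup>n d\<Lambda>\<close>, a fixed point has moments \<open>\<Prod>\<^bsub>k<n\<^esub> 1/T(k)\<close>. As \<open>n T(n) \<rightarrow> \<infinity>\<close>, they grow more slowly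
  than any \<open>n! c\<^sup>n\<close> with \<open>c > 0\<close>, so they determine the law; this gives uniqueness. For existence, normalised
  iterates of the smearing operator started at point masses have moments converging to these, and a weak limit
  point has exactly these moments, hence is a fixed point.

  The complex moments \<open>E(Y\<^sup>k\<^sup>+\<^sup>i\<^sup>s)\<close> satisfy the same recursion, with factors \<open>\<integral> r\<^sup>k\<^sup>+\<^sup>i\<^sup>s d\<Lambda>\<close> decaying like a
  negative power of \<open>s\<close>. Iterating it, the characteristic function of \<open>log X\<close> decays faster than any power, and
  Fourier inversion yields the smooth density.
\<close>

section \<open>Distributions on the half-line and their moments\<close>

text \<open>The profile has a heavy tail: its positive moments are controlled only below order
  \<alpha>, so they cannot identify it. Its negative moments are all finite, and the power -\<alpha>
  is the one for which the recursion closes: rescaling the jumps by x produces the factor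
  \<open>x powr (1 - \<alpha>)\<close>, which is x times y, so each step shifts the moment index by
  exactly one. Because of this weight y, smearing does not preserve mass in general; on moments,
  however, it acts as multiplication by T(n) after a shift, which explains the detour through
  moments. That n T(n) diverges is due to small jumps: \<open>\<eta> powr (-\<sigma>)\<close> with
  \<sigma> > 1 is not integrable at 0, so \<Lambda> accumulates near r = 1 and T(n) is at least a
  multiple of \<open>n powr (\<sigma> - 2)\<close>. The bound \<sigma> < 2 makes the flux of small
  jumps finite, and \<sigma> > 5/3 that of large jumps. The initial datum fixes the mass 1 and
  removes the Dirac mass at infinity, while an atom at 0 is excluded by the equation itself.\<close>

lemma integrable_power_of_moment:
  fixes M :: "real measure"
  assumes "real_distribution M" "AE y in M. 0 \<le> y"
    "(\<integral>\<^sup>+y. ennreal (y ^ n) \<partial>M) = ennreal a" "0 \<le> a"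
  shows "has_bochner_integral M (\<lambda>y. y ^ n) a"
proof -
  interpret real_distribution M by fact
  show ?thesis
    using assms by (intro has_bochner_integral_nn_integral) (auto elim!: eventually_mono)
qed

text \<open>For Y \<ge> 0 the absolute moments are the \<open>m n\<close>, so summability for every
  t allows the exponential series to be integrated term by term. The moments thus give the
  characteristic function on the whole line at once, without continuation from a neighbourhood of
  0.\<close>

lemma char_eq_moment_series:
  fixes M :: "real measure" and m :: "nat \<Rightarrow> real"
  assumes "real_distribution M" and nonneg: "AE y in M. 0 \<le> y"
    and moments: "\<And>n. (\<integral>\<^sup>+y. ennreal (y ^ n) \<partial>M) = ennreal (m n)" and m_nonneg: "\<And>n. 0 \<le> m n"
    and summable: "\<And>t. 0 \<le> t \<Longrightarrow> summable (\<lambda>n. m n * t ^ n / fact n)"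
  shows "char M t = (\<Sum>n. (\<i> * of_real t) ^ n / fact n * of_real (m n))"
proof -
  interpret real_distribution M by fact
  let ?f = "\<lambda>n x. (\<i> * of_real (t * x)) ^ n /\<^sub>R fact n :: complex"
  have "has_bochner_integral M (\<lambda>y. y ^ n) (m n)" for n
    by (rule integrable_power_of_moment[OF assms(1) nonneg moments m_nonneg])
  then have int: "integrable M (\<lambda>y. y ^ n)" "(LINT y|M. y ^ n) = m n" for n
    by (auto simp: has_bochner_integral_iff)
  have f_eq: "?f n x = ((\<i> * of_real t) ^ n / fact n) * of_real (x ^ n)" for n x
    by (simp add: scaleR_conv_of_real power_mult_distrib field_simps)
  have norm_f: "norm (?f n x) = \<bar>t\<bar> ^ n / fact n * \<bar>x ^ n\<bar>" for n x
    by (simp add: norm_mult norm_power power_abs abs_mult power_mult_distrib field_simps)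
  have intf: "integrable M (?f n)" for n
    unfolding f_eq by (intro integrable_mult_right integrable_of_real int)
  have "(\<integral>x. norm (?f n x) \<partial>M) = \<bar>t\<bar> ^ n / fact n * m n" for n
  proof -
    have "(\<integral>x. norm (?f n x) \<partial>M) = (\<integral>x. \<bar>t\<bar> ^ n / fact n * x ^ n \<partial>M)"
      unfolding norm_f
    proof (rule integral_cong_AE)
      show "AE x in M. \<bar>t\<bar> ^ n / fact n * \<bar>x ^ n\<bar> = \<bar>t\<bar> ^ n / fact n * x ^ n"
        using nonneg by eventually_elim simp
    qed auto
    then show ?thesis using int by simp
  qed
  then have summ: "summable (\<lambda>n. \<integral>x. norm (?f n x) \<partial>M)"
    using summable[of "\<bar>t\<bar>"] by (simp add: field_simps)
  have "char M t = (\<integral>x. (\<Sum>n. ?f n x) \<partial>M)"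
    by (simp add: char_def exp_def)
  also have "\<dots> = (\<Sum>n. \<integral>x. ?f n x \<partial>M)"
  proof (rule integral_suminf)
    show "AE x in M. summable (\<lambda>n. norm (?f n x))"
      by (intro AE_I2 summable_norm_exp)
  qed (use intf summ in auto)
  also have "(\<lambda>n. \<integral>x. ?f n x \<partial>M) = (\<lambda>n. (\<i> * of_real t) ^ n / fact n * of_real (m n))"
  proof
    fix n
    have "(\<integral>x. ?f n x \<partial>M) = (\<i> * of_real t) ^ n / fact n * (\<integral>x. of_real (x ^ n) \<partial>M)"
      unfolding f_eq by simp
    also have "(\<integral>x. of_real (x ^ n) \<partial>M) = (of_real (m n) :: complex)"
      unfolding integral_complex_of_real using int by simp
    finally show "(\<integral>x. ?f n x \<partial>M) = (\<i> * of_real t) ^ n / fact n * of_real (m n)" .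
  qed
  finally show ?thesis .
qed

lemma moments_determine:
  fixes M N :: "real measure" and m :: "nat \<Rightarrow> real"
  assumes "real_distribution M" "AE y in M. 0 \<le> y"
    and "\<And>n. (\<integral>\<^sup>+y. ennreal (y ^ n) \<partial>M) = ennreal (m n)"
    and "real_distribution N" "AE y in N. 0 \<le> y"
    and "\<And>n. (\<integral>\<^sup>+y. ennreal (y ^ n) \<partial>N) = ennreal (m n)"
    and "\<And>n. 0 \<le> m n"
    and "\<And>t. 0 \<le> t \<Longrightarrow> summable (\<lambda>n. m n * t ^ n / fact n)"
  shows "M = N"
  using assms by (intro Levy_uniqueness ext) (simp_all add: char_eq_moment_series)

text \<open>Markov's inequality in the form that \<open>tight\<close> demands, with a half-open
  interval bounded on both sides. The left end -1 lies below the support, so that a possible atom at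
  0 is kept inside.\<close>

lemma real_distribution_markov:
  fixes M :: "real measure"
  assumes "real_distribution M" "AE y in M. 0 \<le> y" "(\<integral>\<^sup>+y. ennreal y \<partial>M) \<le> ennreal B" "0 < b" "0 \<le> B"
  shows "1 - B / b \<le> measure M {-1<..b}"
proof -
  interpret real_distribution M by fact
  have "emeasure M {b<..} \<le> emeasure M {y \<in> space M. 1 \<le> ennreal (1 / b) * ennreal y}"
    using \<open>0 < b\<close> by (intro emeasure_mono) (auto simp flip: ennreal_mult' ennreal_1 simp: field_simps)
  also have "\<dots> \<le> ennreal (1 / b) * (\<integral>\<^sup>+y. ennreal y * indicator (space M) y \<partial>M)"
    by (intro order_trans[OF nn_integral_Markov_inequality]) auto
  also have "\<dots> \<le> ennreal (1 / b) * ennreal B"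
    using assms(3) by (intro mult_left_mono) auto
  also have "\<dots> = ennreal (B / b)" using assms by (simp flip: ennreal_mult')
  finally have 1: "measure M {b<..} \<le> B / b"
    using assms by (simp add: emeasure_eq_measure)
  have "measure M {..-1} = 0"
    using assms(2) by (intro prob_eq_0[THEN iffD2]) (auto elim!: eventually_mono)
  moreover have "measure M UNIV \<le> measure M {..-1} + measure M {-1<..b} + measure M {b<..}"
  proof -
    have "UNIV = {..-1::real} \<union> {-1<..b} \<union> {b<..}" by auto
    then have "measure M UNIV \<le> measure M ({..-1::real} \<union> {-1<..b}) + measure M {b<..}"
      by (subst \<open>UNIV = _\<close>, intro measure_Un_le) auto
    also have "measure M ({..-1::real} \<union> {-1<..b}) \<le> measure M {..-1} + measure M {-1<..b}"
      by (intro measure_Un_le) auto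
    finally show ?thesis by simp
  qed
  ultimately show ?thesis using 1 prob_space by simp
qed

text \<open>A bounded first moment gives tightness, hence a weakly convergent subsequence. Weak
  convergence says nothing about the unbounded function \<open>y ^ n\<close>, so it is truncated at
  R; the convergent moments of order 2n control the truncation error by a multiple of 1 / R along
  the sequence.\<close>

lemma limit_of_moments_is_moment_sequence:
  fixes \<nu> :: "nat \<Rightarrow> real measure" and mm :: "nat \<Rightarrow> nat \<Rightarrow> real"
  assumes dist: "\<And>N. real_distribution (\<nu> N)" and nonneg: "\<And>N. AE y in \<nu> N. 0 \<le> y"
    and moments: "\<And>N n. (\<integral>\<^sup>+y. ennreal (y ^ n) \<partial>\<nu> N) = ennreal (mm N n)"
    and mm_nonneg: "\<And>N n. 0 \<le> mm N n"
    and lim: "\<And>n. (\<lambda>N. mm N n) \<longlonglongrightarrow> m n"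
  obtains \<nu>' where "real_distribution \<nu>'" "AE y in \<nu>'. 0 \<le> y"
    "\<And>n. (\<integral>\<^sup>+y. ennreal (y ^ n) \<partial>\<nu>') = ennreal (m n)"
proof -
  have m_nonneg: "0 \<le> m n" for n
    using lim[of n] mm_nonneg by (intro LIMSEQ_le_const[OF lim]) auto
  obtain B where B: "\<And>N. mm N 1 \<le> B" "0 < B"
  proof -
    have "Bseq (\<lambda>N. mm N 1)" using lim[of 1] convergent_def convergent_imp_Bseq by blast
    then obtain K where "0 < K" "\<And>N. norm (mm N 1) \<le> K" by (auto simp: Bseq_def)
    then have "\<And>N. mm N 1 \<le> K" by (metis abs_le_D1 real_norm_def)
    then show ?thesis using that[of K] \<open>0 < K\<close> by blast
  qed
  have "tight \<nu>"
    unfolding tight_def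
  proof (intro conjI allI impI dist)
    fix \<epsilon> :: real assume "0 < \<epsilon>"
    \<comment> \<open>The factor 2 yields the strict inequality that tightness asks for.\<close>
    let ?b = "2 * B / \<epsilon>"
    have "1 - \<epsilon> < measure (\<nu> n) {-1<..?b}" for n
    proof -
      have "1 - B / ?b \<le> measure (\<nu> n) {-1<..?b}"
      proof (rule real_distribution_markov)
        show "(\<integral>\<^sup>+y. ennreal y \<partial>\<nu> n) \<le> ennreal B"
          using moments[where N=n and n=1] B(1)[of n] by (auto intro: ennreal_leI)
      qed (use dist nonneg B \<open>0 < \<epsilon>\<close> in auto)
      moreover have "B / ?b < \<epsilon>" using B \<open>0 < \<epsilon>\<close> by (simp add: field_simps)
      ultimately show ?thesis by linarith
    qed
    moreover have "-1 < ?b" using B \<open>0 < \<epsilon>\<close> by (smt (verit) divide_pos_pos)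
    ultimately show "\<exists>a b. a < b \<and> (\<forall>n. 1 - \<epsilon> < measure (\<nu> n) {a<..b})" by blast
  qed
  from tight_imp_convergent_subsubsequence[OF this, of id]
  obtain r M where r: "strict_mono r" and M: "real_distribution M" and wc: "weak_conv_m (\<nu> \<circ> r) M"
    by (auto simp: strict_mono_def)
  interpret real_distribution M by fact
  interpret N: real_distribution "\<nu> N" for N by (rule dist)
  have conv: "(\<lambda>N. integral\<^sup>L (\<nu> (r N)) f) \<longlonglongrightarrow> integral\<^sup>L M f"
    if "\<And>x. isCont f x" "\<And>x. norm (f x) \<le> B" for f :: "real \<Rightarrow> real" and B
    using weak_conv_imp_integral_bdd_continuous_conv[of "\<nu> \<circ> r" M f B] dist M wc that by simp
  have AE_nonneg: "AE y in M. 0 \<le> y"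
  proof -
    \<comment> \<open>A bounded continuous function that is positive exactly on the negative
      half-line: its integral is 0 along the sequence and therefore in the limit.\<close>
    let ?f = "\<lambda>y::real. min (max (- y) 0) 1"
    have "integral\<^sup>L (\<nu> (r N)) ?f = integral\<^sup>L (\<nu> (r N)) (\<lambda>_. 0)" for N
      using nonneg[of "r N"] by (intro integral_cong_AE) (auto elim!: eventually_mono)
    then have "(\<lambda>N. 0) \<longlonglongrightarrow> integral\<^sup>L M ?f"
      using conv[of ?f 1] by (simp add: continuous_intros)
    then have "integral\<^sup>L M ?f = 0" by (simp add: LIMSEQ_const_iff)
    then have "AE y in M. ?f y = 0"
      by (subst (asm) integral_nonneg_eq_0_iff_AE) (auto intro!: integrable_const_bound[where B=1])
    then show ?thesis by (rule eventually_mono) (auto simp: min_def max_def split: if_splits)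
  qed
  have "(\<integral>\<^sup>+y. ennreal (y ^ n) \<partial>M) = ennreal (m n)" for n
  proof -
    let ?f = "\<lambda>R y::real. min (max y 0 ^ n) R"
    have "\<And>R x. isCont (?f R) x" by (intro continuous_intros)
    have intf: "integrable M (?f R)" "\<And>N. integrable (\<nu> N) (?f R)" if "0 \<le> R" for R
      using that by (auto intro!: integrable_const_bound[where B=R] N.integrable_const_bound[where B=R])
    have bounds: "integral\<^sup>L M (?f R) \<le> m n" "m n - m (2 * n) / R \<le> integral\<^sup>L M (?f R)" if R: "0 < R" for R
    proof -
      have *: "integral\<^sup>L (\<nu> N) (?f R) \<le> mm N n \<and> mm N n - mm N (2 * n) / R \<le> integral\<^sup>L (\<nu> N) (?f R)" for N
      proof -
        have 1: "has_bochner_integral (\<nu> N) (\<lambda>y. y ^ k) (mm N k)" for k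
          using integrable_power_of_moment[OF dist nonneg moments mm_nonneg] .
        note i1 = 1[of n, THEN integrable.intros] 1[of "2*n", THEN integrable.intros]
        \<comment> \<open>Used with x = \<open>y ^ n\<close>, this compares the truncation with the
          moments of order n and 2n.\<close>
        have ineq: "x - x\<^sup>2 / R \<le> min x R" if "0 \<le> x" for x
        proof (cases "x \<le> R")
          case True then show ?thesis using R by simp
        next
          case False
          then have "x \<le> x\<^sup>2 / R" using R that by (simp add: field_simps power2_eq_square mult_left_mono)
          then show ?thesis using R that False by (simp add: min_def)
        qed
        have "integral\<^sup>L (\<nu> N) (?f R) \<le> integral\<^sup>L (\<nu> N) (\<lambda>y. y ^ n)"
          using R nonneg[of N] by (intro integral_mono_AE intf i1) (auto elim!: eventually_mono)
        moreover have "integral\<^sup>L (\<nu> N) (\<lambda>y. y ^ n - y ^ (2 * n) / R) \<le> integral\<^sup>L (\<nu> N) (?f R)"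
          using R nonneg[of N] ineq
          by (intro integral_mono_AE intf i1 Bochner_Integration.integrable_diff integrable_divide)
            (auto elim!: eventually_mono simp: power_mult mult.commute[of 2] power_even_eq)
        moreover have "integral\<^sup>L (\<nu> N) (\<lambda>y. y ^ n - y ^ (2 * n) / R) = mm N n - mm N (2 * n) / R"
          using 1[of n, THEN has_bochner_integral_integral_eq] 1[of "2*n", THEN has_bochner_integral_integral_eq] i1
          by simp
        ultimately show ?thesis
          using 1[of n, THEN has_bochner_integral_integral_eq] by simp
      qed
      have c: "(\<lambda>N. integral\<^sup>L (\<nu> (r N)) (?f R)) \<longlonglongrightarrow> integral\<^sup>L M (?f R)"
        using R by (intro conv[of _ R]) (auto intro!: continuous_intros)
      have l: "(\<lambda>N. mm (r N) k) \<longlonglongrightarrow> m k" for k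
        using LIMSEQ_subseq_LIMSEQ[OF lim r] by (simp add: o_def)
      show "integral\<^sup>L M (?f R) \<le> m n"
        by (rule LIMSEQ_le[OF c l]) (use * in auto)
      have "(\<lambda>N. mm (r N) n - mm (r N) (2 * n) / R) \<longlonglongrightarrow> m n - m (2 * n) / R"
        using R by (intro tendsto_intros l) auto
      from LIMSEQ_le[OF this c] show "m n - m (2 * n) / R \<le> integral\<^sup>L M (?f R)" using * by auto
    qed
    have "(\<lambda>i. integral\<^sup>L M (?f (real (Suc i)))) \<longlonglongrightarrow> m n"
    proof (rule tendsto_sandwich[where h="\<lambda>_. m n"])
      have "(\<lambda>i. m n - m (2 * n) * inverse (real (Suc i))) \<longlonglongrightarrow> m n - m (2 * n) * 0"
        by (intro tendsto_intros LIMSEQ_inverse_real_of_nat)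
      then show "(\<lambda>i. m n - m (2 * n) / real (Suc i)) \<longlonglongrightarrow> m n" by (simp add: divide_inverse)
      show "\<forall>\<^sub>F i in sequentially. m n - m (2 * n) / real (Suc i) \<le> integral\<^sup>L M (?f (real (Suc i)))"
        "\<forall>\<^sub>F i in sequentially. integral\<^sup>L M (?f (real (Suc i))) \<le> m n"
        by (intro always_eventually allI bounds; simp)+
    qed simp
    then have "(\<lambda>i. ennreal (integral\<^sup>L M (?f (real (Suc i))))) \<longlonglongrightarrow> ennreal (m n)"
      by (rule tendsto_ennrealI)
    also have "(\<lambda>i. ennreal (integral\<^sup>L M (?f (real (Suc i))))) = (\<lambda>i. \<integral>\<^sup>+y. ennreal (?f (real (Suc i)) y) \<partial>M)"
      by (intro ext nn_integral_eq_integral[symmetric] intf) auto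
    finally have 1: "(\<lambda>i. \<integral>\<^sup>+y. ennreal (?f (real (Suc i)) y) \<partial>M) \<longlonglongrightarrow> ennreal (m n)" .
    have "(\<lambda>i. \<integral>\<^sup>+y. ennreal (?f (real (Suc i)) y) \<partial>M) \<longlonglongrightarrow> (\<integral>\<^sup>+y. ennreal (max y 0 ^ n) \<partial>M)"
    proof (rule nn_integral_LIMSEQ)
      show "incseq (\<lambda>i y. ennreal (?f (real (Suc i)) y))"
        by (auto simp: incseq_def le_fun_def intro!: ennreal_leI)
      fix y :: real
      obtain k where "max y 0 ^ n \<le> real k" using real_arch_simple by blast
      then have "eventually (\<lambda>i. ?f (real (Suc i)) y = max y 0 ^ n) sequentially"
        by (intro eventually_sequentiallyI[of k]) (auto simp: min_def)
      then show "(\<lambda>i. ennreal (?f (real (Suc i)) y)) \<longlonglongrightarrow> ennreal (max y 0 ^ n)"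
        by (intro tendsto_ennrealI tendsto_eventually)
    qed auto
    from LIMSEQ_unique[OF 1 this] show ?thesis
      using AE_nonneg by (subst nn_integral_cong_AE[where v="\<lambda>y. ennreal (max y 0 ^ n)"])
        (auto elim!: eventually_mono simp: max_def)
  qed
  then show ?thesis using that M AE_nonneg by blast
qed

section \<open>Fixed points of multiplicative smearing\<close>

text \<open>The multiplicative convolution of \<Lambda> with the size-biased measure y \<nu>(dy).
  The weight \<open>ennreal y\<close> is 0 for negative y, so only the positive half-line
  contributes.\<close>

definition mult_smear :: "real measure \<Rightarrow> real measure \<Rightarrow> real measure" where
  "mult_smear \<Lambda> \<nu> = distr (density (\<nu> \<Otimes>\<^sub>M \<Lambda>) (\<lambda>(y, r). ennreal y)) borel (\<lambda>(y, r). y * r)"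

text \<open>\<open>kernel_moments_slow\<close> carries the analysis: it forces every moment of
  \<Lambda> to be positive, the ratios of consecutive moments to tend to 1, and the moments of a
  fixed point to grow slowly enough to determine it.\<close>

locale mult_kernel =
  fixes \<Lambda> :: "real measure"
  assumes sets_kernel[measurable_cong]: "sets \<Lambda> = sets borel"
    and finite_kernel: "finite_measure \<Lambda>"
    and kernel_range: "AE r in \<Lambda>. 0 < r \<and> r < 1"
    and kernel_moments_slow: "filterlim (\<lambda>n. real n * (LINT r|\<Lambda>. r ^ n)) at_top sequentially"
begin

sublocale finite_measure \<Lambda> by (rule finite_kernel)

lemma nn_integral_mult_smear:
  assumes [measurable_cong]: "sets \<nu> = sets borel" and [measurable]: "f \<in> borel_measurable borel"
  shows "(\<integral>\<^sup>+y. f y \<partial>mult_smear \<Lambda> \<nu>) = (\<integral>\<^sup>+y. ennreal y * (\<integral>\<^sup>+r. f (y * r) \<partial>\<Lambda>) \<partial>\<nu>)"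
proof -
  have "(\<integral>\<^sup>+y. f y \<partial>mult_smear \<Lambda> \<nu>) = (\<integral>\<^sup>+z. ennreal (fst z) * f (fst z * snd z) \<partial>(\<nu> \<Otimes>\<^sub>M \<Lambda>))"
    unfolding mult_smear_def by (simp add: nn_integral_distr nn_integral_density split_beta)
  also have "\<dots> = (\<integral>\<^sup>+y. \<integral>\<^sup>+r. ennreal y * f (y * r) \<partial>\<Lambda> \<partial>\<nu>)"
    by (subst nn_integral_fst[symmetric]) auto
  also have "\<dots> = (\<integral>\<^sup>+y. ennreal y * (\<integral>\<^sup>+r. f (y * r) \<partial>\<Lambda>) \<partial>\<nu>)"
    by (intro nn_integral_cong nn_integral_cmult) measurable
  finally show ?thesis .
qed

lemma sets_mult_smear[simp, measurable_cong]: "sets (mult_smear \<Lambda> \<nu>) = sets borel"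
  by (simp add: mult_smear_def)

lemma space_mult_smear[simp]: "space (mult_smear \<Lambda> \<nu>) = UNIV"
  by (simp add: mult_smear_def)

text \<open>The weight vanishes for y \<le> 0 and \<Lambda> lives on r > 0, so every fixed point is
  strictly positive. A weak limit of measures on the half-line would by itself allow an atom at
  0.\<close>

lemma AE_mult_smear_pos:
  assumes sets_nu: "sets \<nu> = sets borel"
  shows "AE y in mult_smear \<Lambda> \<nu>. 0 < y"
proof (rule AE_I[where N="{..0}"])
  have "emeasure (mult_smear \<Lambda> \<nu>) {..0} = (\<integral>\<^sup>+y. indicator {..0} y \<partial>mult_smear \<Lambda> \<nu>)"
    by simp
  also have "\<dots> = (\<integral>\<^sup>+y. ennreal y * (\<integral>\<^sup>+r. indicator {..0} (y * r) \<partial>\<Lambda>) \<partial>\<nu>)"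
    by (rule nn_integral_mult_smear[OF sets_nu]) simp
  also have "\<dots> = (\<integral>\<^sup>+y. 0 \<partial>\<nu>)"
  proof (intro nn_integral_cong)
    fix y :: real
    show "ennreal y * (\<integral>\<^sup>+r. indicator {..0} (y * r) \<partial>\<Lambda>) = 0"
    proof (cases "0 < y")
      case True
      have "AE r in \<Lambda>. indicator {..0} (y * r) = (0 :: ennreal)"
        using kernel_range by eventually_elim (use True in \<open>auto simp: not_le indicator_def\<close>)
      then have "(\<integral>\<^sup>+r. indicator {..0} (y * r) \<partial>\<Lambda>) = (\<integral>\<^sup>+r. 0 \<partial>\<Lambda>)"
        by (rule nn_integral_cong_AE)
      then show ?thesis by simp
    qed (simp add: ennreal_neg)
  qed
  finally show "emeasure (mult_smear \<Lambda> \<nu>) {..0} = 0" by simp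
qed auto

section \<open>Moments of the kernel and of its fixed points\<close>

definition kernel_moment :: "nat \<Rightarrow> real" where
  "kernel_moment n = (LINT r|\<Lambda>. r ^ n)"

lemma integrable_kernel_power: "integrable \<Lambda> (\<lambda>r. r ^ n)"
proof (rule integrable_const_bound[where B=1])
  show "AE r in \<Lambda>. norm (r ^ n) \<le> 1"
    using kernel_range by eventually_elim (auto intro!: power_le_one)
qed measurable

lemma nn_integral_kernel_power: "(\<integral>\<^sup>+r. ennreal (r ^ n) \<partial>\<Lambda>) = ennreal (kernel_moment n)"
  unfolding kernel_moment_def
proof (rule nn_integral_eq_integral[OF integrable_kernel_power])
  show "AE r in \<Lambda>. 0 \<le> r ^ n" using kernel_range by eventually_elim simp
qed

lemma kernel_moment_decreasing: "i \<le> j \<Longrightarrow> kernel_moment j \<le> kernel_moment i"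
  unfolding kernel_moment_def
proof (rule integral_mono_AE[OF integrable_kernel_power integrable_kernel_power])
  assume "i \<le> j"
  show "AE r in \<Lambda>. r ^ j \<le> r ^ i"
    using kernel_range by eventually_elim (use \<open>i \<le> j\<close> in \<open>auto intro!: power_decreasing\<close>)
qed

lemma kernel_moment_pos: "0 < kernel_moment n"
proof -
  have "eventually (\<lambda>k. 1 \<le> real k * kernel_moment k) sequentially"
    using kernel_moments_slow by (auto simp: filterlim_at_top kernel_moment_def)
  then have "eventually (\<lambda>k. 1 \<le> real k * kernel_moment k \<and> n \<le> k) sequentially"
    using eventually_ge_at_top by (rule eventually_conj)
  then obtain k where k: "1 \<le> real k * kernel_moment k" "n \<le> k"
    by (auto dest: eventually_happens)
  then have "0 < kernel_moment k" by (smt (verit) mult_nonneg_nonpos of_nat_0_le_iff)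
  with kernel_moment_decreasing[OF k(2)] show ?thesis by simp
qed

lemma kernel_moment_nonneg[simp]: "0 \<le> kernel_moment n"
  using kernel_moment_pos[of n] by simp

text \<open>Cauchy-Schwarz, read off from the nonnegative integral of
  \<open>r ^ n * (r - c)\<^sup>2\<close>, where c is the mean of r under \<open>r ^ n\<close>
  d\<Lambda>, the minimiser of this quadratic.\<close>

lemma kernel_moment_log_convex:
  "(kernel_moment (Suc n))\<^sup>2 \<le> kernel_moment n * kernel_moment (Suc (Suc n))"
proof -
  let ?c = "kernel_moment (Suc n) / kernel_moment n"
  have "0 \<le> (LINT r|\<Lambda>. r ^ n * (r - ?c)\<^sup>2)"
  proof (rule integral_nonneg_AE)
    show "AE r in \<Lambda>. 0 \<le> r ^ n * (r - ?c)\<^sup>2" using kernel_range by eventually_elim simp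
  qed
  also have "\<dots> = (LINT r|\<Lambda>. r ^ Suc (Suc n) - 2 * ?c * r ^ Suc n + ?c\<^sup>2 * r ^ n)"
    by (intro Bochner_Integration.integral_cong) (auto simp: power2_eq_square algebra_simps)
  also have "\<dots> = kernel_moment (Suc (Suc n)) - 2 * ?c * kernel_moment (Suc n) + ?c\<^sup>2 * kernel_moment n"
    unfolding kernel_moment_def
    by (subst Bochner_Integration.integral_add Bochner_Integration.integral_diff
        | intro Bochner_Integration.integrable_diff integrable_mult_right integrable_kernel_power)+ simp
  also have "\<dots> = kernel_moment (Suc (Suc n)) - (kernel_moment (Suc n))\<^sup>2 / kernel_moment n"
    using kernel_moment_pos[of n] by (simp add: field_simps power2_eq_square)
  finally show ?thesis using kernel_moment_pos[of n] by (simp add: field_simps)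
qed

text \<open>The ratio increases by log-convexity; a limit below 1 would make the moments decay
  geometrically.\<close>
lemma kernel_moment_ratio: "(\<lambda>n. kernel_moment (Suc n) / kernel_moment n) \<longlonglongrightarrow> 1"
proof -
  let ?q = "\<lambda>n. kernel_moment (Suc n) / kernel_moment n"
  note pos = kernel_moment_pos
  have le1: "?q n \<le> 1" for n
    using kernel_moment_decreasing[of n "Suc n"] pos by simp
  have "incseq ?q"
  proof (rule incseq_SucI)
    fix n show "?q n \<le> ?q (Suc n)"
      using kernel_moment_log_convex[of n] pos[of n] pos[of "Suc n"]
      by (simp add: field_simps power2_eq_square)
  qed
  then obtain L where L: "?q \<longlonglongrightarrow> L" "\<And>n. ?q n \<le> L"
    using incseq_convergent[of ?q 1] le1 by metis
  have "L \<le> 1" using L(1) le1 by (intro LIMSEQ_le_const2) auto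
  have "0 < L" using L(2)[of 0] pos by (smt (verit) divide_pos_pos)
  have geom: "kernel_moment n \<le> kernel_moment 0 * L ^ n" for n
  proof (induction n)
    case (Suc n)
    have "kernel_moment (Suc n) \<le> L * kernel_moment n"
      using L(2)[of n] pos[of n] by (simp add: field_simps)
    also have "\<dots> \<le> L * (kernel_moment 0 * L ^ n)"
      using Suc \<open>0 < L\<close> by (intro mult_left_mono) auto
    finally show ?case by (simp add: ac_simps)
  qed simp
  have "L = 1"
  proof (rule ccontr)
    assume "L \<noteq> 1"
    with \<open>L \<le> 1\<close> \<open>0 < L\<close> have "(\<lambda>n. kernel_moment 0 * (real n * L ^ n)) \<longlonglongrightarrow> kernel_moment 0 * 0"
      by (intro tendsto_intros powser_times_n_limit_0) auto
    then have "eventually (\<lambda>n. kernel_moment 0 * (real n * L ^ n) < 1) sequentially"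
      by (auto dest: order_tendstoD(2)[where a=1])
    moreover have "eventually (\<lambda>n. 1 \<le> real n * kernel_moment n) sequentially"
      using kernel_moments_slow by (auto simp: filterlim_at_top kernel_moment_def)
    ultimately have "eventually (\<lambda>n::nat. False) sequentially"
    proof eventually_elim
      case (elim n)
      have "real n * kernel_moment n \<le> real n * (kernel_moment 0 * L ^ n)"
        by (intro mult_left_mono geom) auto
      with elim show ?case by (simp add: ac_simps)
    qed
    then show False by simp
  qed
  with L show ?thesis by simp
qed

definition fixed_moment :: "nat \<Rightarrow> real" where
  "fixed_moment n = (\<Prod>k<n. 1 / kernel_moment k)"

lemma fixed_moment_0[simp]: "fixed_moment 0 = 1"
  and fixed_moment_Suc: "fixed_moment (Suc n) = fixed_moment n / kernel_moment n"
  by (simp_all add: fixed_moment_def)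

lemma fixed_moment_pos: "0 < fixed_moment n"
  unfolding fixed_moment_def by (intro prod_pos) (simp add: kernel_moment_pos)

lemma summable_fixed_moment:
  assumes "0 \<le> t"
  shows "summable (\<lambda>n. fixed_moment n * t ^ n / fact n)"
proof -
  \<comment> \<open>Consecutive terms have ratio \<open>t / (Suc n * kernel_moment n)\<close>. The
    bound keeps it below 1/2, and the \<open>+ 1\<close> keeps the denominator positive when t =
    0.\<close>
  have "eventually (\<lambda>n. 4 * t + 1 \<le> real n * kernel_moment n) sequentially"
    using kernel_moments_slow by (auto simp: filterlim_at_top kernel_moment_def)
  then obtain N where N: "\<And>n. N \<le> n \<Longrightarrow> 4 * t + 1 \<le> real n * kernel_moment n"
    by (auto simp: eventually_sequentially)
  show ?thesis
  proof (rule summable_ratio_test[where c="1/2" and N=N])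
    fix n assume "N \<le> n"
    have T: "4 * t + 1 \<le> real (Suc n) * kernel_moment n"
      using N[OF \<open>N \<le> n\<close>] kernel_moment_nonneg[of n] by (simp add: algebra_simps del: kernel_moment_nonneg)
    then have "t / (real (Suc n) * kernel_moment n) \<le> 1 / 2"
      using assms by (subst divide_le_eq) auto
    moreover have "0 \<le> fixed_moment n * t ^ n / fact n"
      using fixed_moment_pos[of n] assms by simp
    ultimately have "t / (real (Suc n) * kernel_moment n) * (fixed_moment n * t ^ n / fact n)
        \<le> 1 / 2 * (fixed_moment n * t ^ n / fact n)"
      by (rule mult_right_mono)
    moreover have "fixed_moment (Suc n) * t ^ Suc n / fact (Suc n)
        = t / (real (Suc n) * kernel_moment n) * (fixed_moment n * t ^ n / fact n)"
      by (simp add: fixed_moment_Suc field_simps)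
    ultimately show "norm (fixed_moment (Suc n) * t ^ Suc n / fact (Suc n))
        \<le> 1 / 2 * norm (fixed_moment n * t ^ n / fact n)"
      using assms fixed_moment_pos by (simp add: less_imp_le)
  qed simp
qed

text \<open>Powers are multiplicative, so y and r separate, and the weight y raises the power on the
  side of \<nu> by one. In extended values the identity holds before any moment is known to be
  finite.\<close>

lemma nn_moment_mult_smear:
  assumes sets_nu[measurable_cong]: "sets \<nu> = sets borel" and "AE y in \<nu>. 0 \<le> y"
  shows "(\<integral>\<^sup>+y. ennreal (y ^ n) \<partial>mult_smear \<Lambda> \<nu>) = ennreal (kernel_moment n) * (\<integral>\<^sup>+y. ennreal (y ^ Suc n) \<partial>\<nu>)"
proof -
  have "(\<integral>\<^sup>+y. ennreal (y ^ n) \<partial>mult_smear \<Lambda> \<nu>) = (\<integral>\<^sup>+y. ennreal y * (\<integral>\<^sup>+r. ennreal ((y * r) ^ n) \<partial>\<Lambda>) \<partial>\<nu>)"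
    by (rule nn_integral_mult_smear[OF sets_nu]) simp
  also have "\<dots> = (\<integral>\<^sup>+y. ennreal (kernel_moment n) * ennreal (y ^ Suc n) \<partial>\<nu>)"
  proof (rule nn_integral_cong_AE)
    show "AE y in \<nu>. ennreal y * (\<integral>\<^sup>+r. ennreal ((y * r) ^ n) \<partial>\<Lambda>) = ennreal (kernel_moment n) * ennreal (y ^ Suc n)"
      using assms(2)
    proof eventually_elim
      case (elim y)
      have "(\<integral>\<^sup>+r. ennreal ((y * r) ^ n) \<partial>\<Lambda>) = (\<integral>\<^sup>+r. ennreal (y ^ n) * ennreal (r ^ n) \<partial>\<Lambda>)"
        using elim by (intro nn_integral_cong) (simp add: power_mult_distrib flip: ennreal_mult')
      also have "\<dots> = ennreal (y ^ n) * ennreal (kernel_moment n)"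
        by (subst nn_integral_cmult) (auto simp: nn_integral_kernel_power)
      finally show ?case using elim by (simp add: ac_simps flip: ennreal_mult')
    qed
  qed
  also have "\<dots> = ennreal (kernel_moment n) * (\<integral>\<^sup>+y. ennreal (y ^ Suc n) \<partial>\<nu>)"
    by (rule nn_integral_cmult) measurable
  finally show ?thesis .
qed

text \<open>Finiteness is a conclusion here: starting from total mass 1, each moment is the previous
  one divided by the positive number \<open>kernel_moment n\<close>.\<close>

lemma fixed_point_moments:
  assumes "real_distribution \<nu>" "AE y in \<nu>. 0 \<le> y" "mult_smear \<Lambda> \<nu> = \<nu>"
  shows "(\<integral>\<^sup>+y. ennreal (y ^ n) \<partial>\<nu>) = ennreal (fixed_moment n)"
proof (induction n)
  case 0
  interpret nu: real_distribution \<nu> by fact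
  show ?case using nu.emeasure_space_1 by simp
next
  case (Suc n)
  interpret nu: real_distribution \<nu> by fact
  have "ennreal (kernel_moment n) * (\<integral>\<^sup>+y. ennreal (y ^ Suc n) \<partial>\<nu>) = ennreal (fixed_moment n)"
    using nn_moment_mult_smear[OF nu.events_eq_borel assms(2), of n] Suc by (simp add: assms(3))
  then have "ennreal (1 / kernel_moment n) * (ennreal (kernel_moment n) * (\<integral>\<^sup>+y. ennreal (y ^ Suc n) \<partial>\<nu>))
      = ennreal (1 / kernel_moment n) * ennreal (fixed_moment n)" by simp
  also have "ennreal (1 / kernel_moment n) * (ennreal (kernel_moment n) * (\<integral>\<^sup>+y. ennreal (y ^ Suc n) \<partial>\<nu>)) = (\<integral>\<^sup>+y. ennreal (y ^ Suc n) \<partial>\<nu>)"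
    using kernel_moment_pos[of n] by (simp add: mult.assoc[symmetric] flip: ennreal_mult')
  finally show ?case using fixed_moment_pos[of n] kernel_moment_pos[of n]
    by (simp add: fixed_moment_Suc flip: ennreal_mult')
qed

lemma fixed_point_unique:
  assumes "real_distribution \<nu>" "AE y in \<nu>. 0 \<le> y" "mult_smear \<Lambda> \<nu> = \<nu>"
    and "real_distribution \<nu>'" "AE y in \<nu>'. 0 \<le> y" "mult_smear \<Lambda> \<nu>' = \<nu>'"
  shows "\<nu> = \<nu>'"
  using moments_determine[OF assms(1,2) fixed_point_moments[OF assms(1-3)] assms(4,5) fixed_point_moments[OF assms(4-6)]]
    fixed_moment_pos summable_fixed_moment by (simp add: less_imp_le)

section \<open>Existence of a fixed point by normalised iteration\<close>

primrec smear_iterate :: "real \<Rightarrow> nat \<Rightarrow> real measure" where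
  "smear_iterate c 0 = return borel c"
| "smear_iterate c (Suc N) = mult_smear \<Lambda> (smear_iterate c N)"

lemma sets_smear_iterate[simp, measurable_cong]: "sets (smear_iterate c N) = sets borel"
  by (cases N) auto

lemma smear_iterate_nonneg:
  assumes "0 < c"
  shows "AE y in smear_iterate c N. 0 \<le> y"
proof (cases N)
  case 0
  have "(AE y in return borel c. 0 \<le> y) \<longleftrightarrow> 0 \<le> c" by (rule AE_return) auto
  then show ?thesis using assms unfolding 0 smear_iterate.simps by (metis less_imp_le)
next
  case (Suc N')
  show ?thesis
    unfolding Suc smear_iterate.simps
    using AE_mult_smear_pos[OF sets_smear_iterate] by (rule eventually_mono) simp
qed

text \<open>Each smearing contributes one kernel moment and shifts the order by one, so N of them
  lead to the moment of order n + N of the point mass.\<close>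

lemma smear_iterate_moments:
  assumes "0 < c"
  shows "(\<integral>\<^sup>+y. ennreal (y ^ n) \<partial>smear_iterate c N) = ennreal ((\<Prod>k<N. kernel_moment (n + k)) * c ^ (n + N))"
proof (induction N arbitrary: n)
  case 0
  then show ?case by (simp add: nn_integral_return)
next
  case (Suc N)
  have "(\<integral>\<^sup>+y. ennreal (y ^ n) \<partial>smear_iterate c (Suc N))
      = ennreal (kernel_moment n) * ennreal ((\<Prod>k<N. kernel_moment (Suc n + k)) * c ^ (Suc n + N))"
    using nn_moment_mult_smear[OF sets_smear_iterate[of c N] smear_iterate_nonneg[OF assms], of n] Suc[of "Suc n"]
    by (simp del: power_Suc)
  also have "\<dots> = ennreal (kernel_moment n * ((\<Prod>k<N. kernel_moment (Suc n + k)) * c ^ (Suc n + N)))"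
    by (simp flip: ennreal_mult')
  also have "kernel_moment n * ((\<Prod>k<N. kernel_moment (Suc n + k)) * c ^ (Suc n + N))
      = (\<Prod>k<Suc N. kernel_moment (n + k)) * c ^ (n + Suc N)"
    by (simp add: prod.lessThan_Suc_shift ac_simps del: prod.lessThan_Suc)
  finally show ?case .
qed

text \<open>The iterates are normalised to probability measures; starting at \<open>1 / kernel_moment N\<close> makes
  the moments of the \<open>N\<close>-th one converge.\<close>
lemma fixed_point_exists:
  obtains \<nu> where "real_distribution \<nu>" "AE y in \<nu>. 0 < y" "mult_smear \<Lambda> \<nu> = \<nu>"
proof -
  let ?T = kernel_moment
  \<comment> \<open>The moments of the normalised iterates, arranged as the target moment times
    quotients that tend to 1; there are n of these, a number that does not grow with N.\<close>
  define mm where "mm N n = (\<Prod>k<n. ?T (N + k) / ?T N) * fixed_moment n" for N n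
  define c where "c N = 1 / ?T N" for N
  define C where "C N = (\<Prod>k<N. ?T k) * c N ^ N" for N
  define \<mu> where "\<mu> N = density (smear_iterate (c N) N) (\<lambda>_. ennreal (1 / C N))" for N
  have c_pos: "0 < c N" for N by (simp add: c_def kernel_moment_pos)
  have C_pos: "0 < C N" for N unfolding C_def by (intro mult_pos_pos prod_pos zero_less_power c_pos) (simp add: kernel_moment_pos)
  have mm_nonneg: "0 \<le> mm N n" for N n
    unfolding mm_def using fixed_moment_pos[of n] by (intro mult_nonneg_nonneg prod_nonneg) auto
  have moments: "(\<integral>\<^sup>+y. ennreal (y ^ n) \<partial>\<mu> N) = ennreal (mm N n)" for N n
  proof -
    \<comment> \<open>Both sides are the product over \<open>k < n + N\<close>. This trades a
      quotient of products of N factors for one of n factors.\<close>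
    have p1: "(\<Prod>k<n. ?T k) * (\<Prod>k<N. ?T (n + k)) = (\<Prod>k<N. ?T k) * (\<Prod>k<n. ?T (N + k))"
    proof -
      have *: "(\<Prod>k<a. ?T k) * (\<Prod>k<b. ?T (a + k)) = (\<Prod>k<a+b. ?T k)" for a b
        by (induction b) (auto simp: ac_simps)
      show ?thesis using *[of n N] *[of N n] by (simp add: add.commute)
    qed
    have pos: "0 < (\<Prod>k<a. ?T k)" for a by (intro prod_pos) (simp add: kernel_moment_pos)
    have "(\<integral>\<^sup>+y. ennreal (y ^ n) \<partial>\<mu> N) = ennreal (1 / C N) * (\<integral>\<^sup>+y. ennreal (y ^ n) \<partial>smear_iterate (c N) N)"
      unfolding \<mu>_def by (subst nn_integral_density) (auto simp: nn_integral_cmult)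
    also have "\<dots> = ennreal (1 / C N * ((\<Prod>k<N. ?T (n + k)) * c N ^ (n + N)))"
      unfolding smear_iterate_moments[OF c_pos] using C_pos[of N] by (simp flip: ennreal_mult')
    also have "1 / C N * ((\<Prod>k<N. ?T (n + k)) * c N ^ (n + N)) = (\<Prod>k<N. ?T (n + k)) / (\<Prod>k<N. ?T k) * c N ^ n"
      using c_pos[of N] by (simp add: C_def power_add)
    also have "(\<Prod>k<N. ?T (n + k)) / (\<Prod>k<N. ?T k) = (\<Prod>k<n. ?T (N + k)) / (\<Prod>k<n. ?T k)"
    proof (subst frac_eq_eq)
      show "(\<Prod>k<N. ?T k) \<noteq> 0" "(\<Prod>k<n. ?T k) \<noteq> 0" using pos by (metis less_irrefl)+
    qed (use p1 in \<open>simp only: ac_simps\<close>)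
    also have "\<dots> * c N ^ n = mm N n"
      by (simp add: mm_def fixed_moment_def c_def prod_dividef prod_constant power_divide)
    finally show ?thesis .
  qed
  have sets_mu: "sets (\<mu> N) = sets borel" for N by (simp add: \<mu>_def)
  have dist: "real_distribution (\<mu> N)" for N
  proof -
    have "emeasure (\<mu> N) UNIV = ennreal (mm N 0)"
      using moments[where n=0 and N=N] sets_eq_imp_space_eq[OF sets_mu[of N]] by simp
    then have "prob_space (\<mu> N)"
      using sets_eq_imp_space_eq[OF sets_mu[of N]] by (intro prob_spaceI) (simp add: mm_def)
    then show ?thesis
      using sets_mu sets_eq_imp_space_eq[OF sets_mu[of N]] by (simp add: real_distribution_def real_distribution_axioms_def)
  qed
  have nonneg: "AE y in \<mu> N. 0 \<le> y" for N
    unfolding \<mu>_def by (subst AE_density) (auto intro: eventually_mono[OF smear_iterate_nonneg[OF c_pos]])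
  have lim: "(\<lambda>N. mm N n) \<longlonglongrightarrow> fixed_moment n" for n
  proof -
    have 1: "(\<lambda>N. ?T (N + k) / ?T N) \<longlonglongrightarrow> 1" for k
    proof (induction k)
      case 0
      then show ?case using kernel_moment_pos by (simp add: less_imp_neq[symmetric])
    next
      case (Suc k)
      have "(\<lambda>N. ?T (Suc (N + k)) / ?T (N + k) * (?T (N + k) / ?T N)) \<longlonglongrightarrow> 1 * 1"
        by (intro tendsto_mult Suc LIMSEQ_ignore_initial_segment[OF kernel_moment_ratio])
      then show ?case using kernel_moment_pos by (simp add: less_imp_neq[symmetric])
    qed
    have "(\<lambda>N. mm N n) \<longlonglongrightarrow> (\<Prod>k<n. 1) * fixed_moment n"
      unfolding mm_def by (intro tendsto_intros 1)
    then show ?thesis by simp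
  qed
  obtain \<nu> where nu: "real_distribution \<nu>" "AE y in \<nu>. 0 \<le> y"
    and nu_moments: "\<And>n. (\<integral>\<^sup>+y. ennreal (y ^ n) \<partial>\<nu>) = ennreal (fixed_moment n)"
    using limit_of_moments_is_moment_sequence[OF dist nonneg moments mm_nonneg lim] by blast
  interpret nu: real_distribution \<nu> by fact
  \<comment> \<open>The fixed-point property is obtained without weak continuity of the smearing:
    \<nu> and its image have the same moments, and these determine the law.\<close>
  have smear_moments: "(\<integral>\<^sup>+y. ennreal (y ^ n) \<partial>mult_smear \<Lambda> \<nu>) = ennreal (fixed_moment n)" for n
    unfolding nn_moment_mult_smear[OF nu.events_eq_borel nu(2)] nu_moments
    using kernel_moment_pos[of n] by (simp add: fixed_moment_Suc flip: ennreal_mult')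
  have "real_distribution (mult_smear \<Lambda> \<nu>)"
  proof -
    have "emeasure (mult_smear \<Lambda> \<nu>) UNIV = 1"
      using smear_moments[of 0] nn_integral_const[of "mult_smear \<Lambda> \<nu>" 1] by simp
    then have "prob_space (mult_smear \<Lambda> \<nu>)" by (intro prob_spaceI) simp
    then show ?thesis by (simp add: real_distribution_def real_distribution_axioms_def)
  qed
  moreover have pos: "AE y in mult_smear \<Lambda> \<nu>. 0 < y"
    by (intro AE_mult_smear_pos) simp
  ultimately have "mult_smear \<Lambda> \<nu> = \<nu>"
    using nu smear_moments nu_moments fixed_moment_pos summable_fixed_moment
    by (intro moments_determine[where m=fixed_moment]) (auto simp: less_imp_le elim!: eventually_mono)
  with pos nu show ?thesis using that by metis
qed

end

section \<open>Rapidly decaying characteristic functions\<close>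

text \<open>A class \<F> closed under differentiation on S replaces explicit formulas for the k-th
  derivative. Agreement is claimed on S only, since the values of \<open>deriv_within\<close>
  elsewhere carry no meaning.\<close>

lemma iterated_deriv_within_mem:
  assumes S: "\<And>x. x \<in> S \<Longrightarrow> at x within S \<noteq> bot"
    and closed: "\<And>f. f \<in> \<F> \<Longrightarrow> \<exists>f'\<in>\<F>. \<forall>x\<in>S. (f has_real_derivative f' x) (at x within S)"
    and "f \<in> \<F>"
  shows "\<exists>h\<in>\<F>. \<forall>x\<in>S. (deriv_within S ^^ k) f x = h x"
proof (induction k)
  case 0
  then show ?case using assms by auto
next
  case (Suc k)
  then obtain h where h: "h \<in> \<F>" "\<forall>x\<in>S. (deriv_within S ^^ k) f x = h x" by blast
  from closed[OF h(1)] obtain h' where h': "h' \<in> \<F>" "\<And>x. x \<in> S \<Longrightarrow> (h has_real_derivative h' x) (at x within S)"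
    by blast
  have "deriv_within S ((deriv_within S ^^ k) f) x = h' x" if "x \<in> S" for x
  proof -
    have "((deriv_within S ^^ k) f has_vector_derivative h' x) (at x within S)"
      using h'(2)[OF that] h(2) that unfolding has_real_derivative_iff_has_vector_derivative has_vector_derivative_def
      by (auto intro: has_derivative_transform[of x S _ h])
    then show ?thesis unfolding deriv_within_def using S[OF that] by (intro vector_derivative_within)
  qed
  with h'(1) show ?case by auto
qed

lemma smooth_within_closed_family:
  assumes S: "\<And>x. x \<in> S \<Longrightarrow> at x within S \<noteq> bot"
    and closed: "\<And>f. f \<in> \<F> \<Longrightarrow> \<exists>f'\<in>\<F>. \<forall>x\<in>S. (f has_real_derivative f' x) (at x within S)"
    and "f \<in> \<F>"
  shows "smooth_within S f"
  unfolding smooth_within_def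
proof
  fix k
  from iterated_deriv_within_mem[OF assms] obtain h
    where h: "h \<in> \<F>" "\<forall>x\<in>S. (deriv_within S ^^ k) f x = h x" by blast
  from closed[OF h(1)] obtain h' where h': "\<And>x. x \<in> S \<Longrightarrow> (h has_real_derivative h' x) (at x within S)"
    by blast
  show "(deriv_within S ^^ k) f differentiable_on S"
    unfolding differentiable_on_def
  proof
    fix x assume "x \<in> S"
    from h'[OF this] have "h differentiable at x within S"
      by (auto simp: real_differentiable_def)
    then show "(deriv_within S ^^ k) f differentiable at x within S"
      using h(2) \<open>x \<in> S\<close> unfolding differentiable_def
      by (auto intro: has_derivative_transform[of x S _ h])
  qed
qed

text \<open>The mean value theorem bounds every difference quotient by the same w, so dominated
  convergence applies along any sequence tending to 0.\<close>

lemma has_real_derivative_dominated_integral: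
  fixes u u' :: "real \<Rightarrow> 'a \<Rightarrow> real"
  assumes int: "\<And>x. integrable M (u x)"
    and deriv: "\<And>x t. ((\<lambda>x. u x t) has_real_derivative u' x t) (at x)"
    and bound: "\<And>x t. \<bar>u' x t\<bar> \<le> w t" and w: "integrable M w"
    and [measurable]: "\<And>x. u' x \<in> borel_measurable M"
  shows "((\<lambda>x. LINT t|M. u x t) has_real_derivative (LINT t|M. u' x t)) (at x)"
proof -
  note [measurable] = borel_measurable_integrable[OF int]
  have "(\<lambda>n. ((LINT t|M. u (x + h n) t) - (LINT t|M. u x t)) / h n) \<longlonglongrightarrow> (LINT t|M. u' x t)"
    if h: "\<And>n. h n \<noteq> 0" "h \<longlonglongrightarrow> 0" for h
  proof -
    have "(\<lambda>n. LINT t|M. (u (x + h n) t - u x t) / h n) \<longlonglongrightarrow> (LINT t|M. u' x t)"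
    proof (rule integral_dominated_convergence[where w=w])
      show "AE t in M. (\<lambda>n. (u (x + h n) t - u x t) / h n) \<longlonglongrightarrow> u' x t"
      proof (intro AE_I2)
        fix t
        have "((\<lambda>k. (u (x + k) t - u x t) / k) \<longlongrightarrow> u' x t) (at 0)"
          using deriv[of t x] by (simp add: DERIV_def)
        then show "(\<lambda>n. (u (x + h n) t - u x t) / h n) \<longlonglongrightarrow> u' x t"
          using h by (auto simp: tendsto_at_iff_sequentially o_def)
      qed
      show "AE t in M. norm ((u (x + h n) t - u x t) / h n) \<le> w t" for n
      proof (intro AE_I2)
        fix t
        have "norm (u (x + h n) t - u x t) \<le> w t * norm (x + h n - x)"
          using deriv bound by (intro field_differentiable_bound[where S=UNIV and f'="\<lambda>x. u' x t"])
            (auto)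
        then show "norm ((u (x + h n) t - u x t) / h n) \<le> w t"
          using h(1)[of n] by (simp add: field_simps)
      qed
    qed (use w in auto)
    also have "(\<lambda>n. LINT t|M. (u (x + h n) t - u x t) / h n) = (\<lambda>n. ((LINT t|M. u (x + h n) t) - (LINT t|M. u x t)) / h n)"
      using int by (simp add: Bochner_Integration.integral_diff)
    finally show ?thesis .
  qed
  then show ?thesis
    unfolding DERIV_def tendsto_at_iff_sequentially o_def by auto
qed

section \<open>Fourier inversion with an integrable characteristic function\<close>

lemma integrable_inverse_1_plus_sq: "integrable lborel (\<lambda>t::real. 1 / (1 + t\<^sup>2))"
  using integrable_inverse_1_plus_square by (simp add: set_integrable_def inverse_eq_divide)

lemma cmod_mult_iexp: "cmod (z * iexp s) = cmod z"
  unfolding norm_mult norm_exp_i_times by simp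

lemma has_real_derivative_Re:
  "(f has_vector_derivative f') F \<Longrightarrow> ((\<lambda>x. Re (f x)) has_real_derivative Re f') F"
  unfolding has_real_derivative_iff_has_vector_derivative
  by (rule bounded_linear.has_vector_derivative[OF bounded_linear_Re])

lemma iexp_deriv: "((\<lambda>x. iexp (- (t * x))) has_vector_derivative (- \<i> * of_real t * iexp (- (t * x)))) (at x)"
  by (rule vector_diff_chain_at[of "\<lambda>x. - (t * x)" "- t" _ iexp, unfolded o_def, THEN has_vector_derivative_eq_rhs])
    (auto intro!: derivative_eq_intros simp: scaleR_conv_of_real)

text \<open>For t \<noteq> 0 this is the integral of \<open>iexp (- (t * x))\<close> over x from a
  to b, as in Levy's inversion formula. At t = 0 division by zero yields 0 instead of b - a, which
  affects only a null set.\<close>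

definition inversion_kernel :: "real \<Rightarrow> real \<Rightarrow> real \<Rightarrow> complex" where
  "inversion_kernel a b t = (iexp (- (t * a)) - iexp (- (t * b))) / (\<i> * t)"

lemma inversion_kernel_bound: "a \<le> b \<Longrightarrow> cmod (inversion_kernel a b t) \<le> b - a"
proof (cases "t = 0")
  case False
  assume "a \<le> b"
  from Levy_Inversion_aux2[of "-b" "-a" t] this False show ?thesis
    by (simp add: inversion_kernel_def)
qed (simp add: inversion_kernel_def)

lemma inversion_kernel_flip: "inversion_kernel a b t = - inversion_kernel b a t"
  unfolding inversion_kernel_def by (metis minus_diff_eq minus_divide_left)

lemma inversion_kernel_bound': "cmod (inversion_kernel a b t) \<le> \<bar>b - a\<bar>"
  using inversion_kernel_bound[of a b t] inversion_kernel_bound[of b a t] inversion_kernel_flip[of a b t]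
  by (cases "a \<le> b") auto

lemma inversion_kernel_measurable[measurable]: "inversion_kernel a b \<in> borel_measurable borel"
  unfolding inversion_kernel_def[abs_def] by measurable

locale rapid_char = real_distribution M for M +
  assumes rapid: "\<exists>C. \<forall>t. \<bar>t\<bar> ^ n * cmod (char M t) \<le> C"
begin

lemma poly_times_char_bounded: "\<exists>C. \<forall>t. \<bar>t\<bar> ^ n * cmod (poly P (of_real t) * char M t) \<le> C"
proof (induction P arbitrary: n)
  case 0
  show ?case by (rule exI[of _ 0]) simp
next
  case (pCons a P)
  obtain C where C: "\<And>t. \<bar>t\<bar> ^ Suc n * cmod (poly P (of_real t) * char M t) \<le> C"
    using pCons.IH by blast
  obtain D where D: "\<And>t. \<bar>t\<bar> ^ n * cmod (char M t) \<le> D" using rapid by blast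
  have "\<bar>t\<bar> ^ n * cmod (poly (pCons a P) (of_real t) * char M t) \<le> cmod a * D + C" for t
  proof -
    have "cmod (poly (pCons a P) (of_real t) * char M t) \<le> cmod a * cmod (char M t) + \<bar>t\<bar> * cmod (poly P (of_real t) * char M t)"
      using norm_triangle_ineq[of "a * char M t" "of_real t * poly P (of_real t) * char M t"]
      by (simp add: norm_mult algebra_simps)
    then have "\<bar>t\<bar> ^ n * cmod (poly (pCons a P) (of_real t) * char M t)
        \<le> \<bar>t\<bar> ^ n * (cmod a * cmod (char M t) + \<bar>t\<bar> * cmod (poly P (of_real t) * char M t))"
      by (rule mult_left_mono) simp
    also have "\<dots> = cmod a * (\<bar>t\<bar> ^ n * cmod (char M t)) + \<bar>t\<bar> ^ Suc n * cmod (poly P (of_real t) * char M t)"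
      by (simp add: algebra_simps)
    also have "\<dots> \<le> cmod a * D + C" by (intro add_mono mult_left_mono C D) simp
    finally show ?thesis .
  qed
  then show ?case by blast
qed

lemma integrable_poly_times_char: "integrable lborel (\<lambda>t. poly P (of_real t) * char M t)"
proof -
  \<comment> \<open>Boundedness is applied to P times the polynomial \<open>1 + t\<^sup>2\<close>,
    which leaves the integrable majorant \<open>C / (1 + t\<^sup>2)\<close>.\<close>
  obtain C where C: "\<And>t. \<bar>t\<bar> ^ 0 * cmod (poly (P * [:1, 0, 1:]) (of_real t) * char M t) \<le> C"
    using poly_times_char_bounded by blast
  have [measurable]: "(\<lambda>t::real. poly P (of_real t :: complex)) \<in> borel_measurable borel"
    by (intro borel_measurable_continuous_onI continuous_intros)
  show ?thesis
  proof (rule Bochner_Integration.integrable_bound)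
    show "integrable lborel (\<lambda>t. C * (1 / (1 + t\<^sup>2)))"
      by (intro integrable_mult_right integrable_inverse_1_plus_sq)
    show "AE t in lborel. norm (poly P (of_real t) * char M t) \<le> norm (C * (1 / (1 + t\<^sup>2)))"
    proof (intro AE_I2)
      fix t :: real
      have pos: "0 < 1 + t\<^sup>2" by (simp add: add_pos_nonneg)
      have "poly [:1, 0, 1:] (of_real t) = (of_real (1 + t\<^sup>2) :: complex)"
        by (simp add: power2_eq_square)
      then have "cmod (poly [:1, 0, 1:] (of_real t)) = 1 + t\<^sup>2"
        using pos by (simp only: norm_of_real abs_of_pos)
      then have "cmod (poly P (of_real t) * char M t) * (1 + t\<^sup>2) \<le> C"
        using C[of t] by (simp only: poly_mult norm_mult power_0 mult_1_left ac_simps)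
      then have "cmod (poly P (of_real t) * char M t) \<le> C / (1 + t\<^sup>2)"
        using pos by (simp add: field_simps)
      also have "\<dots> \<le> norm (C * (1 / (1 + t\<^sup>2)))" by (simp add: divide_inverse)
      finally show "norm (poly P (of_real t) * char M t) \<le> norm (C * (1 / (1 + t\<^sup>2)))" .
    qed
  qed measurable
qed

text \<open>The polynomial factor makes the family stable under differentiation: d/dx multiplies the
  integrand by -\<i> t, that is, P by \<open>[:0, - \<i>:]\<close>.\<close>

definition fourier_re :: "complex poly \<Rightarrow> real \<Rightarrow> real" where
  "fourier_re P x = (LBINT t. Re (poly P (of_real t) * char M t * iexp (- (t * x))))"

lemma integrable_poly_char_iexp: "integrable lborel (\<lambda>t. poly P (of_real t) * char M t * iexp (- (t * x)))"
proof (rule Bochner_Integration.integrable_bound[OF integrable_poly_times_char[of P]])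
  have [measurable]: "(\<lambda>t::real. poly P (of_real t :: complex)) \<in> borel_measurable borel"
    by (intro borel_measurable_continuous_onI continuous_intros)
  show "(\<lambda>t. poly P (of_real t) * char M t * iexp (- (t * x))) \<in> borel_measurable lborel"
    by measurable
  show "AE t in lborel. norm (poly P (of_real t) * char M t * iexp (- (t * x))) \<le> norm (poly P (of_real t) * char M t)"
    by (intro AE_I2) (simp only: cmod_mult_iexp order_refl)
qed

lemma fourier_re_deriv: "(fourier_re P has_real_derivative fourier_re (P * [:0, - \<i>:]) x) (at x)"
  unfolding fourier_re_def[abs_def]
proof (rule has_real_derivative_dominated_integral)
  show "integrable lborel (\<lambda>t. Re (poly P (of_real t) * char M t * iexp (- (t * x))))" for x
    by (intro integrable_Re integrable_poly_char_iexp)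
  show "integrable lborel (\<lambda>t. cmod (poly (P * [:0, - \<i>:]) (of_real t) * char M t))"
    by (intro integrable_norm integrable_poly_times_char)
  show "\<bar>Re (poly (P * [:0, - \<i>:]) (of_real t) * char M t * iexp (- (t * x)))\<bar>
      \<le> cmod (poly (P * [:0, - \<i>:]) (of_real t) * char M t)" for t x
    by (rule order_trans[OF abs_Re_le_cmod]) (simp only: cmod_mult_iexp order_refl)
  show "(\<lambda>t. Re (poly (P * [:0, - \<i>:]) (of_real t) * char M t * iexp (- (t * x)))) \<in> borel_measurable lborel" for x
    by (intro borel_measurable_integrable integrable_Re integrable_poly_char_iexp)
  show "((\<lambda>x. Re (poly P (of_real t) * char M t * iexp (- (t * x)))) has_real_derivative
      Re (poly (P * [:0, - \<i>:]) (of_real t) * char M t * iexp (- (t * x)))) (at x)" for t x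
    by (rule has_real_derivative_Re, rule has_vector_derivative_eq_rhs,
        rule has_vector_derivative_mult_right[OF iexp_deriv]) simp
qed

text \<open>Lets a sum of two members, as produced by the product rule, be recognised as a single
  member of the family.\<close>

lemma fourier_re_linear: "fourier_re P x + c * fourier_re Q x = fourier_re (P + smult (of_real c) Q) x"
proof -
  define u where "u P t = Re (poly P (of_real t) * char M t * iexp (- (t * x)))" for P t
  have int: "integrable lborel (u P)" for P
    unfolding u_def by (intro integrable_Re integrable_poly_char_iexp)
  have "u (P + smult (of_real c) Q) t = u P t + c * u Q t" for t
    unfolding u_def by (simp add: ring_distribs mult.assoc)
  then show ?thesis
    using int unfolding fourier_re_def u_def[symmetric] by simp
qed

lemma integrable_inversion: "integrable lborel (\<lambda>t. inversion_kernel a b t * char M t)"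
proof (rule Bochner_Integration.integrable_bound)
  show "integrable lborel (\<lambda>t. of_real (b - a) * char M t)"
    using integrable_poly_times_char[of 1] by simp
  show "AE t in lborel. norm (inversion_kernel a b t * char M t) \<le> norm (of_real (b - a) * char M t)"
    by (intro AE_I2) (simp add: norm_mult mult_right_mono inversion_kernel_bound' flip: of_real_diff)
qed measurable

definition inversion_integral :: "real \<Rightarrow> real \<Rightarrow> real" where
  "inversion_integral a b = (LBINT t. Re (inversion_kernel a b t * char M t))"

lemma inversion_integral_deriv:
  "(inversion_integral a has_real_derivative fourier_re 1 b) (at b)"
proof -
  \<comment> \<open>The point t = 0 is split off because the kernel is constantly 0 there. The
    formula for the derivative then holds at every t, as differentiation under the integral asks,
    and the exception disappears almost everywhere.\<close>
  have "((\<lambda>b. LBINT t. Re (inversion_kernel a b t * char M t)) has_real_derivative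
      (LBINT t. Re (if t = 0 then 0 else char M t * iexp (- (t * b))))) (at b)"
  proof (rule has_real_derivative_dominated_integral)
    show "integrable lborel (\<lambda>t. Re (inversion_kernel a b t * char M t))" for b
      by (intro integrable_Re integrable_inversion)
    show "integrable lborel (\<lambda>t. cmod (char M t))"
      using integrable_norm[OF integrable_poly_times_char[of 1]] by simp
    show "\<bar>Re (if t = 0 then 0 else char M t * iexp (- (t * b)))\<bar> \<le> cmod (char M t)" for t b
      by (rule order_trans[OF abs_Re_le_cmod]) (simp only: cmod_mult_iexp order_refl norm_zero norm_ge_zero split: if_split, simp)
    show "((\<lambda>b. Re (inversion_kernel a b t * char M t)) has_real_derivative
      Re (if t = 0 then 0 else char M t * iexp (- (t * b)))) (at b)" for t b
    proof (cases "t = 0")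
      case False
      have "((\<lambda>b. (iexp (- (t * a)) - iexp (- (t * b))) * (char M t / (\<i> * t))) has_vector_derivative
        (0 - (- \<i> * of_real t * iexp (- (t * b)))) * (char M t / (\<i> * t))) (at b)"
        by (intro has_vector_derivative_mult_left has_vector_derivative_diff has_vector_derivative_const iexp_deriv)
      then have "((\<lambda>b. inversion_kernel a b t * char M t) has_vector_derivative char M t * iexp (- (t * b))) (at b)"
        using False by (simp add: inversion_kernel_def field_simps)
      from has_real_derivative_Re[OF this] False show ?thesis by simp
    qed (simp add: inversion_kernel_def)
  qed measurable
  also have "(LBINT t. Re (if t = 0 then 0 else char M t * iexp (- (t * b)))) = fourier_re 1 b"
    unfolding fourier_re_def
  proof (rule integral_cong_AE)
    have "AE t::real in lborel. t \<noteq> 0" by (rule AE_lborel_singleton)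
    then show "AE t in lborel. Re (if t = 0 then 0 else char M t * iexp (- (t * b))) = Re (poly 1 (of_real t) * char M t * iexp (- (t * b)))"
      by eventually_elim simp
  qed auto
  finally show ?thesis by (simp add: inversion_integral_def[abs_def])
qed

text \<open>\<open>Levy_Inversion\<close> gives a limit over symmetric intervals; since the
  integrand is integrable, this limit is an ordinary integral. The condition on the end points comes
  from that theorem and is later met at every point by \<open>no_atoms\<close>.\<close>

lemma measure_Ioc_eq_inversion_no_atoms:
  assumes "a \<le> b" "measure M {a} = 0" "measure M {b} = 0"
  shows "2 * pi * measure M {a<..b} = inversion_integral a b"
proof -
  have "(\<lambda>T::nat. CLBINT t:{-real T..real T}. inversion_kernel a b t * char M t) \<longlonglongrightarrow> (CLBINT t. inversion_kernel a b t * char M t)"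
    unfolding set_lebesgue_integral_def
  proof (rule integral_dominated_convergence[where w="\<lambda>t. cmod (inversion_kernel a b t * char M t)"])
    show "integrable lborel (\<lambda>t. cmod (inversion_kernel a b t * char M t))"
      by (intro integrable_norm integrable_inversion)
    show "AE t in lborel. (\<lambda>T::nat. indicator {-real T..real T} t *\<^sub>R (inversion_kernel a b t * char M t)) \<longlonglongrightarrow> inversion_kernel a b t * char M t"
    proof (intro AE_I2 tendsto_eventually)
      fix t :: real
      obtain k :: nat where "\<bar>t\<bar> \<le> real k" using real_arch_simple by blast
      then show "eventually (\<lambda>T::nat. indicator {-real T..real T} t *\<^sub>R (inversion_kernel a b t * char M t) = inversion_kernel a b t * char M t) sequentially"
        by (intro eventually_sequentiallyI[of k]) (auto simp: indicator_def)
    qed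
    show "AE t in lborel. norm (indicator {-real T..real T} t *\<^sub>R (inversion_kernel a b t * char M t)) \<le> cmod (inversion_kernel a b t * char M t)" for T :: nat
      by (intro AE_I2) (auto simp: indicator_def)
  qed measurable
  also have "(\<lambda>T::nat. CLBINT t:{-real T..real T}. inversion_kernel a b t * char M t) =
      (\<lambda>T::nat. CLBINT t=-real T..real T. inversion_kernel a b t * char M t)"
    by (simp add: interval_integral_Icc)
  finally have "(\<lambda>T::nat. 1 / (2 * pi) * (CLBINT t=-real T..real T. inversion_kernel a b t * char M t)) \<longlonglongrightarrow>
      1 / (2 * pi) * (CLBINT t. inversion_kernel a b t * char M t)"
    by (intro tendsto_intros)
  moreover have "(\<lambda>T::nat. 1 / (2 * pi) * (CLBINT t=-real T..real T. inversion_kernel a b t * char M t)) \<longlonglongrightarrow> of_real (measure M {a<..b})"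
    using Levy_Inversion[OF assms] unfolding inversion_kernel_def by simp
  ultimately
  have "of_real (measure M {a<..b}) = 1 / (2 * pi) * (CLBINT t. inversion_kernel a b t * char M t)"
    by (intro LIMSEQ_unique)
  then have "(CLBINT t. inversion_kernel a b t * char M t) = of_real (2 * pi * measure M {a<..b})"
    by (simp add: field_simps)
  moreover have "inversion_integral a b = Re (CLBINT t. inversion_kernel a b t * char M t)"
    unfolding inversion_integral_def by (intro integral_Re integrable_inversion)
  ultimately show ?thesis by simp
qed

lemma inversion_integral_bound:
  obtains B where "0 \<le> B" "\<And>a b. \<bar>inversion_integral a b\<bar> \<le> B * \<bar>b - a\<bar>"
proof (rule that)
  let ?B = "LBINT t. cmod (char M t)"
  have int: "integrable lborel (\<lambda>t. cmod (char M t))"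
    using integrable_norm[OF integrable_poly_times_char[of 1]] by simp
  show "0 \<le> ?B" by simp
  fix a b
  have "\<bar>inversion_integral a b\<bar> \<le> (LBINT t. \<bar>b - a\<bar> * cmod (char M t))"
    unfolding inversion_integral_def
  proof (rule order_trans[OF integral_abs_bound], rule integral_mono)
    show "\<bar>Re (inversion_kernel a b t * char M t)\<bar> \<le> \<bar>b - a\<bar> * cmod (char M t)" for t
      by (rule order_trans[OF abs_Re_le_cmod]) (simp add: norm_mult mult_right_mono inversion_kernel_bound')
    show "integrable lborel (\<lambda>t. \<bar>Re (inversion_kernel a b t * char M t)\<bar>)"
      by (intro integrable_abs integrable_Re integrable_inversion)
  qed (use int in simp)
  then show "\<bar>inversion_integral a b\<bar> \<le> ?B * \<bar>b - a\<bar>" by (simp add: mult.commute)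
qed

text \<open>Atoms are countable, so x has atom-free points arbitrarily close on both sides, and the
  measure of an interval between such points is at most a multiple of its length.\<close>

lemma no_atoms: "measure M {x} = 0"
proof -
  obtain B where B: "0 \<le> B" "\<And>a b. \<bar>inversion_integral a b\<bar> \<le> B * \<bar>b - a\<bar>"
    using inversion_integral_bound by blast
  have "measure M {x} \<le> B * \<epsilon> / pi" if "0 < \<epsilon>" for \<epsilon>
  proof -
    have "\<exists>y\<in>U. measure M {y} = 0" if "open U" "U \<noteq> {}" for U
      using open_minus_countable[OF countable_support that(2,1)] by auto
    from this[of "{x - \<epsilon><..<x}"] this[of "{x<..<x + \<epsilon>}"] that obtain a b
      where a: "a \<in> {x - \<epsilon><..<x}" "measure M {a} = 0" and b: "b \<in> {x<..<x + \<epsilon>}" "measure M {b} = 0"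
      by auto
    have "measure M {x} \<le> measure M {a<..b}" using a b by (intro finite_measure_mono) auto
    also have "\<dots> = inversion_integral a b / (2 * pi)"
      using measure_Ioc_eq_inversion_no_atoms[of a b] a b by (simp add: field_simps)
    also have "\<dots> \<le> (B * (2 * \<epsilon>)) / (2 * pi)"
    proof (rule divide_right_mono)
      have "inversion_integral a b \<le> B * \<bar>b - a\<bar>" using B(2)[of a b] by simp
      also have "\<dots> \<le> B * (2 * \<epsilon>)" using a b B by (intro mult_left_mono) auto
      finally show "inversion_integral a b \<le> B * (2 * \<epsilon>)" .
    qed simp
    finally show ?thesis by simp
  qed
  then have "measure M {x} \<le> 0 + \<epsilon>" if "0 < \<epsilon>" for \<epsilon>
  proof -
    \<comment> \<open>The previous estimate is used with \<open>\<epsilon> * pi / (B + 1)\<close>,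
      where the \<open>+ 1\<close> covers the case B = 0.\<close>
    have "measure M {x} \<le> B * (\<epsilon> * pi / (B + 1)) / pi"
      using B that by (intro \<open>\<And>\<epsilon>. 0 < \<epsilon> \<Longrightarrow> measure M {x} \<le> B * \<epsilon> / pi\<close>) auto
    also have "\<dots> = \<epsilon> * (B / (B + 1))" by simp
    also have "\<dots> \<le> \<epsilon> * 1" using B that by (intro mult_left_mono) auto
    finally show ?thesis by simp
  qed
  then have "measure M {x} \<le> 0" by (rule field_le_epsilon)
  then show ?thesis by (simp add: measure_le_0_iff)
qed

definition fourier_density :: "real \<Rightarrow> real" where
  "fourier_density x = fourier_re 1 x / (2 * pi)"

text \<open>Near x the distribution function is a constant plus the inversion integral over 2 pi
  with base point x - 1; the base point only has to lie to the left of x.\<close>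

lemma cdf_deriv: "(cdf M has_real_derivative fourier_density x) (at x)"
proof -
  have "((\<lambda>b. cdf M (x - 1) + inversion_integral (x - 1) b / (2 * pi)) has_real_derivative fourier_density x) (at x)"
    unfolding fourier_density_def
    by (auto intro!: derivative_eq_intros inversion_integral_deriv)
  moreover have "eventually (\<lambda>b. cdf M (x - 1) + inversion_integral (x - 1) b / (2 * pi) = cdf M b) (nhds x)"
  proof -
    have "eventually (\<lambda>b. b \<in> {x - 1<..}) (nhds x)" by (rule eventually_nhds_in_open) auto
    then show ?thesis
    proof eventually_elim
      case (elim b)
      then show ?case
        using measure_Ioc_eq_inversion_no_atoms[of "x - 1" b] no_atoms cdf_diff_eq[of "x - 1" b]
        by (simp add: field_simps)
    qed
  qed
  ultimately show ?thesis by (rule DERIV_cong_ev[THEN iffD1, OF refl _ refl, rotated])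
qed

text \<open>Not visible in the Fourier integral: the sign comes from monotonicity of the
  distribution function.\<close>

lemma fourier_density_nonneg: "0 \<le> fourier_density x"
  by (rule mono_on_imp_deriv_nonneg[of UNIV "cdf M", OF _ cdf_deriv])
    (auto intro!: mono_onI cdf_nondecreasing)

text \<open>The density of exp(Z) for Z with law M. The factor 1 / x is written as an integer power
  so that all derivatives have the form \<open>x powi p * fourier_re P (ln x)\<close>.\<close>

definition exp_density :: "real \<Rightarrow> real" where
  "exp_density x = x powi (-1) * fourier_density (ln x)"

lemma exp_density_smooth: "smooth_within {0<..} exp_density"
proof (rule smooth_within_closed_family)
  let ?\<F> = "{\<lambda>x::real. x powi p * fourier_re P (ln x) | p P. True}"
  show "at x within {0<..} \<noteq> bot" if "x \<in> {0<..}" for x :: real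
    using that by (simp add: at_within_open[OF that])
  show "\<exists>f'\<in>?\<F>. \<forall>x\<in>{0<..}. (f has_real_derivative f' x) (at x within {0<..})" if f: "f \<in> ?\<F>" for f
  proof -
    obtain p P where f: "f = (\<lambda>x. x powi p * fourier_re P (ln x))" using f by blast
    \<comment> \<open>The derivative of \<open>x powi p * G (ln x)\<close> is
      \<open>x powi (p - 1)\<close> times (G' + p G), and passing to G' multiplies the polynomial by
      -\<i> t.\<close>
    let ?Q = "P * [:0, - \<i>:] + smult (of_real (of_int p)) P"
    have "(f has_real_derivative x powi (p - 1) * fourier_re ?Q (ln x)) (at x within {0<..})" if "x \<in> {0<..}" for x
    proof -
      have x: "0 < x" using that by simp
      have "((\<lambda>x. fourier_re P (ln x)) has_real_derivative fourier_re (P * [:0, - \<i>:]) (ln x) * (1 / x)) (at x)"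
        using x by (intro DERIV_chain2[OF fourier_re_deriv]) (auto intro!: derivative_eq_intros)
      then have "(f has_real_derivative of_int p * x powi (p - 1) * fourier_re P (ln x)
          + x powi p * (fourier_re (P * [:0, - \<i>:]) (ln x) * (1 / x))) (at x)"
        using x unfolding f by (auto intro!: derivative_eq_intros)
      also have "of_int p * x powi (p - 1) * fourier_re P (ln x)
          + x powi p * (fourier_re (P * [:0, - \<i>:]) (ln x) * (1 / x)) = x powi (p - 1) * fourier_re ?Q (ln x)"
      proof -
        have "of_int p * x powi (p - 1) * A + x powi p * (B * (1 / x)) = x powi (p - 1) * (B + of_int p * A)" for A B
          using x by (simp add: power_int_diff field_simps)
        then show ?thesis by (simp only: fourier_re_linear[symmetric])
      qed
      finally show ?thesis by (rule has_field_derivative_at_within)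
    qed
    moreover have "(\<lambda>x. x powi (p - 1) * fourier_re ?Q (ln x)) \<in> ?\<F>"
      by (intro CollectI exI conjI TrueI) (rule refl)
    ultimately show ?thesis by (intro bexI) auto
  qed
  \<comment> \<open>The zero polynomial contributes nothing; it lets
    \<open>fourier_re_linear\<close> absorb the constant 1 / (2 pi) into the polynomial.\<close>
  have "exp_density = (\<lambda>x. x powi (-1) * fourier_re (0 + smult (of_real (1 / (2 * pi))) 1) (ln x))"
    by (simp only: fourier_re_linear[symmetric])
      (simp add: exp_density_def[abs_def] fourier_density_def fourier_re_def[of 0])
  then show "exp_density \<in> ?\<F>"
    by (intro CollectI exI conjI TrueI)
qed

lemma exp_density_nonneg: "0 < x \<Longrightarrow> 0 \<le> exp_density x"
  by (simp add: exp_density_def fourier_density_nonneg)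

lemma fourier_density_measurable[measurable]: "fourier_density \<in> borel_measurable borel"
proof -
  have "continuous_on UNIV (fourier_re 1)"
    by (rule DERIV_continuous_on[OF has_field_derivative_at_within[OF fourier_re_deriv]])
  then have [measurable]: "fourier_re 1 \<in> borel_measurable borel"
    by (rule borel_measurable_continuous_onI)
  show ?thesis unfolding fourier_density_def[abs_def] by measurable
qed

lemma exp_density_measurable[measurable]: "exp_density \<in> borel_measurable borel"
  unfolding exp_density_def[abs_def] power_int_minus power_int_1_right by measurable

text \<open>Finite measures on the line agree once they agree on all rays (x, oo). For x > 0 both
  values are 1 minus the distribution function at ln x; the case x \<le> 0 follows because both
  measures live on (0, oo), which is exhausted by the rays from 1 / (n + 1).\<close>

lemma distr_exp_eq_density:
  "distr M borel exp = density lborel (\<lambda>x. indicator {0<..} x * ennreal (exp_density x))" (is "?L = ?R")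
proof (rule measure_eqI_lessThan)
  have pos: "emeasure ?L {x<..} = emeasure ?R {x<..} \<and> emeasure ?R {x<..} = ennreal (1 - cdf M (ln x))" if x: "0 < x" for x
  proof -
    have "emeasure ?R {x<..} = (\<integral>\<^sup>+y. ennreal (if x \<le> y then exp_density y else 0) * indicator {x..} y \<partial>lborel)"
    proof (subst emeasure_density)
      show "(\<integral>\<^sup>+y. indicator {0<..} y * ennreal (exp_density y) * indicator {x<..} y \<partial>lborel) = (\<integral>\<^sup>+y. ennreal (if x \<le> y then exp_density y else 0) * indicator {x..} y \<partial>lborel)"
      proof (rule nn_integral_cong_AE)
        have "AE y in lborel. y \<noteq> x" by (rule AE_lborel_singleton)
        then show "AE y in lborel. indicator {0<..} y * ennreal (exp_density y) * indicator {x<..} y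
            = ennreal (if x \<le> y then exp_density y else 0) * indicator {x..} y"
        proof eventually_elim
          case (elim y)
          consider "y < x" | "x < y" using elim by linarith
          then show ?case using x by cases auto
        qed
      qed
    qed auto
    also have "\<dots> = (\<integral>\<^sup>+y. ennreal (exp_density y) * indicator {x..} y \<partial>lborel)"
      by (intro nn_integral_cong) (auto simp: indicator_def)
    also have "\<dots> = ennreal (1 - cdf M (ln x))"
    proof (rule nn_integral_FTC_atLeast)
      show "((\<lambda>x. cdf M (ln x)) \<longlongrightarrow> 1) at_top"
        by (rule filterlim_compose[OF cdf_lim_at_top_prob ln_at_top])
      show "((\<lambda>x. cdf M (ln x)) has_real_derivative exp_density y) (at y)" if "x \<le> y" for y
      proof -
        have "((\<lambda>x. cdf M (ln x)) has_real_derivative fourier_density (ln y) * inverse y) (at y)"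
          using that x by (intro DERIV_chain2[OF cdf_deriv DERIV_ln]) auto
        then show ?thesis by (simp add: exp_density_def power_int_minus mult.commute)
      qed
    qed (use x in \<open>auto intro!: exp_density_nonneg\<close>)
    finally have R: "emeasure ?R {x<..} = ennreal (1 - cdf M (ln x))" .
    have "emeasure ?L {x<..} = emeasure M {ln x<..}"
    proof (subst emeasure_distr)
      have "x < exp z \<longleftrightarrow> ln x < z" for z using x ln_less_cancel_iff[of x "exp z"] by simp
      then have "exp -` {x<..} \<inter> space M = {ln x<..}" by auto
      then show "emeasure M (exp -` {x<..} \<inter> space M) = emeasure M {ln x<..}" by simp
    qed auto
    also have "\<dots> = ennreal (1 - cdf M (ln x))"
    proof -
      have "{ln x<..} = UNIV - {..ln x}" by auto
      then have "measure M {ln x<..} = 1 - cdf M (ln x)"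
        using prob_compl[of "{..ln x}"] by (simp add: cdf_def)
      then show ?thesis by (simp add: emeasure_eq_measure)
    qed
    finally show ?thesis using R by simp
  qed
  show "emeasure ?L {x<..} = emeasure ?R {x<..}" for x
  proof (cases "0 < x")
    case False
    have sup: "emeasure N {x<..} = emeasure N {0<..}" if "AE y in N. 0 < y" "sets N = sets borel" for N :: "real measure"
      using that False by (intro emeasure_eq_AE) (auto elim: eventually_mono)
    have lim: "(\<lambda>n. emeasure N {1 / real (Suc n)<..}) \<longlonglongrightarrow> emeasure N {0<..}" if "sets N = sets borel" for N :: "real measure"
    proof -
      have "(\<lambda>n. emeasure N {1 / real (Suc n)<..}) \<longlonglongrightarrow> emeasure N (\<Union>n. {1 / real (Suc n)<..})"
      proof (rule Lim_emeasure_incseq)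
        show "incseq (\<lambda>n. {1 / real (Suc n)<..})"
        proof (rule incseq_SucI, rule subsetI)
          fix n and y :: real assume "y \<in> {1 / real (Suc n)<..}"
          moreover have "1 / real (Suc (Suc n)) \<le> 1 / real (Suc n)" by (rule frac_le) auto
          ultimately show "y \<in> {1 / real (Suc (Suc n))<..}" by simp
        qed
        show "range (\<lambda>n. {1 / real (Suc n)<..}) \<subseteq> sets N"
          unfolding that by (intro image_subsetI) (rule borel_open, simp)
      qed
      moreover have "(\<Union>n. {1 / real (Suc n)<..}) = {0::real<..}"
      proof safe
        fix n and y :: real assume "1 / real (Suc n) < y"
        then show "0 < y" by (rule less_trans[rotated]) simp
      next
        fix y :: real assume "0 < y"
        then obtain n where "1 / real (Suc n) < y" using nat_approx_posE by blast
        then show "y \<in> (\<Union>n. {1 / real (Suc n)<..})" by blast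
      qed
      ultimately show ?thesis by simp
    qed
    have "emeasure ?L {x<..} = emeasure ?L {0<..}" by (rule sup) (auto simp: AE_distr_iff)
    moreover have "emeasure ?R {x<..} = emeasure ?R {0<..}"
      by (rule sup) (auto simp: AE_density indicator_def)
    moreover have "emeasure ?L {0<..} = emeasure ?R {0<..}"
    proof (rule LIMSEQ_unique[OF lim])
      show "(\<lambda>n. emeasure ?L {1 / real (Suc n)<..}) \<longlonglongrightarrow> emeasure ?R {0<..}"
        using lim[of ?R] pos by simp
    qed simp
    ultimately show ?thesis by simp
  qed (use pos in simp)
  interpret L: prob_space ?L by (rule prob_space_distr) auto
  show "emeasure ?L {x<..} < \<infinity>" for x by (simp add: less_top[symmetric])
qed auto

end

section \<open>Decay of the Mellin transform of a fixed point\<close>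

text \<open>The rate \<delta> is the same for every k, while the constant may depend on k: repeated
  use of the moment recursion raises k, and each use has to gain the same power of s.\<close>

locale oscillating_kernel = mult_kernel +
  fixes \<delta> :: real
  assumes \<delta>_pos: "0 < \<delta>"
    and kernel_oscillation: "\<exists>C. \<forall>s. 1 \<le> \<bar>s\<bar> \<longrightarrow>
      cmod (CLINT r|\<Lambda>. of_real (r ^ k) * iexp (s * ln r)) \<le> C * \<bar>s\<bar> powr (- \<delta>)"
begin

context
  fixes \<nu> :: "real measure"
  assumes nu: "real_distribution \<nu>" and nu_pos: "AE y in \<nu>. 0 < y"
    and nu_fixed: "mult_smear \<Lambda> \<nu> = \<nu>"
begin

lemma nu_nonneg: "AE y in \<nu>. 0 \<le> y"
  using nu_pos by (rule eventually_mono) simp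

definition mellin :: "nat \<Rightarrow> real \<Rightarrow> complex" where
  "mellin k s = (CLINT y|\<nu>. of_real (y ^ k) * iexp (s * ln y))"

lemma mellin_bound: "cmod (mellin k s) \<le> fixed_moment k"
proof -
  have "has_bochner_integral \<nu> (\<lambda>y. y ^ k) (fixed_moment k)"
    using fixed_moment_pos[of k]
    by (intro integrable_power_of_moment[OF nu nu_nonneg fixed_point_moments[OF nu nu_nonneg nu_fixed]]) simp
  then have 1: "integrable \<nu> (\<lambda>y. y ^ k)" "(LINT y|\<nu>. y ^ k) = fixed_moment k"
    by (auto simp: has_bochner_integral_iff)
  have "cmod (mellin k s) \<le> (LINT y|\<nu>. cmod (of_real (y ^ k) * iexp (s * ln y)))"
    unfolding mellin_def by (rule integral_norm_bound)
  also have "\<dots> = (LINT y|\<nu>. y ^ k)"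
  proof (rule integral_cong_AE)
    interpret real_distribution \<nu> by (rule nu)
    show "(\<lambda>y. cmod (of_real (y ^ k) * iexp (s * ln y))) \<in> borel_measurable \<nu>" by measurable
    show "AE y in \<nu>. cmod (of_real (y ^ k) * iexp (s * ln y)) = y ^ k"
      using nu_nonneg by eventually_elim (simp only: cmod_mult_iexp norm_of_real, simp)
  qed (use 1 in auto)
  finally show ?thesis using 1 by simp
qed

text \<open>Fubini together with the multiplicativity of the power k + \<i> s; the size-biasing
  factor y turns k into k + 1.\<close>

lemma mellin_recursion:
  "mellin k s = (CLINT r|\<Lambda>. of_real (r ^ k) * iexp (s * ln r)) * mellin (Suc k) s"
proof -
  interpret nu: real_distribution \<nu> by (rule nu)
  interpret P: pair_sigma_finite \<nu> \<Lambda> ..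
  let ?g = "\<lambda>y. of_real (y ^ k) * iexp (s * ln y) :: complex"
  \<comment> \<open>\<open>ennreal y\<close> cuts off negative y, so the real-valued weight has to
    be \<open>max 0 y\<close> for the two densities to coincide.\<close>
  let ?f = "\<lambda>(y, r). max 0 y *\<^sub>R ?g (y * r)"
  have [measurable]: "?g \<in> borel_measurable borel" by measurable
  have f_meas[measurable]: "?f \<in> borel_measurable (\<nu> \<Otimes>\<^sub>M \<Lambda>)" by measurable
  have norm_f: "norm (?f (y, r)) = max 0 y * \<bar>y\<bar> ^ k * \<bar>r\<bar> ^ k" for y r
    by (simp only: prod.case norm_scaleR cmod_mult_iexp norm_of_real)
      (simp add: abs_mult power_mult_distrib power_abs)
  have int_f: "integrable (\<nu> \<Otimes>\<^sub>M \<Lambda>) ?f"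
  proof (rule integrableI_bounded[OF f_meas])
    have "(\<integral>\<^sup>+z. ennreal (norm (?f z)) \<partial>(\<nu> \<Otimes>\<^sub>M \<Lambda>)) = (\<integral>\<^sup>+y. \<integral>\<^sup>+r. ennreal (norm (?f (y, r))) \<partial>\<Lambda> \<partial>\<nu>)"
      by (rule nn_integral_fst[symmetric]) measurable
    also have "\<dots> = (\<integral>\<^sup>+y. \<integral>\<^sup>+r. ennreal (max 0 y * \<bar>y\<bar> ^ k) * ennreal (\<bar>r\<bar> ^ k) \<partial>\<Lambda> \<partial>\<nu>)"
      unfolding norm_f by (intro nn_integral_cong) (simp add: ennreal_mult')
    also have "\<dots> = (\<integral>\<^sup>+y. ennreal (max 0 y * \<bar>y\<bar> ^ k) \<partial>\<nu>) * (\<integral>\<^sup>+r. ennreal (\<bar>r\<bar> ^ k) \<partial>\<Lambda>)"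
      by (subst nn_integral_cmult) (auto simp: nn_integral_multc)
    also have "(\<integral>\<^sup>+y. ennreal (max 0 y * \<bar>y\<bar> ^ k) \<partial>\<nu>) = ennreal (fixed_moment (Suc k))"
      unfolding fixed_point_moments[OF nu nu_nonneg nu_fixed, symmetric]
    proof (rule nn_integral_cong_AE)
      show "AE y in \<nu>. ennreal (max 0 y * \<bar>y\<bar> ^ k) = ennreal (y ^ Suc k)"
        using nu_pos by eventually_elim simp
    qed
    also have "(\<integral>\<^sup>+r. ennreal (\<bar>r\<bar> ^ k) \<partial>\<Lambda>) = ennreal (kernel_moment k)"
      unfolding nn_integral_kernel_power[symmetric]
    proof (rule nn_integral_cong_AE)
      show "AE r in \<Lambda>. ennreal (\<bar>r\<bar> ^ k) = ennreal (r ^ k)"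
        using kernel_range by eventually_elim simp
    qed
    finally show "(\<integral>\<^sup>+z. ennreal (norm (?f z)) \<partial>(\<nu> \<Otimes>\<^sub>M \<Lambda>)) < \<infinity>"
      by (simp add: ennreal_mult_less_top)
  qed
  have "mellin k s = (CLINT y|mult_smear \<Lambda> \<nu>. ?g y)"
    by (simp add: mellin_def nu_fixed)
  also have "\<dots> = (CLINT z|density (\<nu> \<Otimes>\<^sub>M \<Lambda>) (\<lambda>(y, r). ennreal (max 0 y)). ?g (fst z * snd z))"
    unfolding mult_smear_def by (subst integral_distr) (auto simp: split_beta)
  also have "\<dots> = (CLINT z|\<nu> \<Otimes>\<^sub>M \<Lambda>. ?f z)"
    unfolding split_beta by (subst integral_density) (auto simp: split_beta)
  also have "\<dots> = (CLINT y|\<nu>. CLINT r|\<Lambda>. ?f (y, r))"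
    by (rule P.integral_fst'[symmetric, OF int_f])
  also have "\<dots> = (CLINT y|\<nu>. (CLINT r|\<Lambda>. ?g r) * (of_real (y ^ Suc k) * iexp (s * ln y)))"
  proof (rule integral_cong_AE)
    show "AE y in \<nu>. (CLINT r|\<Lambda>. ?f (y, r)) = (CLINT r|\<Lambda>. ?g r) * (of_real (y ^ Suc k) * iexp (s * ln y))"
      using nu_pos
    proof eventually_elim
      case (elim y)
      have "(CLINT r|\<Lambda>. ?f (y, r)) = (CLINT r|\<Lambda>. ?g r * (of_real (y ^ Suc k) * iexp (s * ln y)))"
      proof (rule integral_cong_AE)
        show "AE r in \<Lambda>. ?f (y, r) = ?g r * (of_real (y ^ Suc k) * iexp (s * ln y))"
          using kernel_range
        proof eventually_elim
          case (elim r)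
          then have "iexp (s * ln (y * r)) = iexp (s * ln y) * iexp (s * ln r)"
            using \<open>0 < y\<close> by (simp add: ln_mult ring_distribs exp_add)
          then show ?case using \<open>0 < y\<close>
            by (simp add: power_mult_distrib scaleR_conv_of_real)
        qed
      qed measurable
      then show ?case by simp
    qed
    show "(\<lambda>y. CLINT r|\<Lambda>. ?f (y, r)) \<in> borel_measurable \<nu>" by measurable
  qed measurable
  also have "\<dots> = (CLINT r|\<Lambda>. ?g r) * mellin (Suc k) s"
    unfolding mellin_def by simp
  finally show ?thesis .
qed

text \<open>One factor of decay per application of the recursion. The induction keeps k arbitrary
  because the recursion refers to k + 1; it starts from the bound by the k-th moment, which is
  uniform in s.\<close>

lemma mellin_decay:
  "\<exists>C. \<forall>s. 1 \<le> \<bar>s\<bar> \<longrightarrow> cmod (mellin k s) \<le> C * \<bar>s\<bar> powr (- (real n * \<delta>))"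
proof (induction n arbitrary: k)
  case 0
  have "1 \<le> \<bar>s\<bar> \<longrightarrow> cmod (mellin k s) \<le> fixed_moment k * \<bar>s\<bar> powr (- (real 0 * \<delta>))" for s
    using mellin_bound[of k s] by auto
  then show ?case by blast
next
  case (Suc n)
  obtain C where C: "\<And>s. 1 \<le> \<bar>s\<bar> \<Longrightarrow> cmod (mellin (Suc k) s) \<le> C * \<bar>s\<bar> powr (- (real n * \<delta>))"
    using Suc.IH by blast
  obtain D where D: "\<And>s. 1 \<le> \<bar>s\<bar> \<Longrightarrow> cmod (CLINT r|\<Lambda>. of_real (r ^ k) * iexp (s * ln r)) \<le> D * \<bar>s\<bar> powr (- \<delta>)"
    using kernel_oscillation by blast
  have "cmod (mellin k s) \<le> (D * C) * \<bar>s\<bar> powr (- (real (Suc n) * \<delta>))" if "1 \<le> \<bar>s\<bar>" for s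
  proof -
    have "cmod (mellin k s) = cmod (CLINT r|\<Lambda>. of_real (r ^ k) * iexp (s * ln r)) * cmod (mellin (Suc k) s)"
      by (subst mellin_recursion) (simp only: norm_mult)
    also have "\<dots> \<le> (D * \<bar>s\<bar> powr (- \<delta>)) * (C * \<bar>s\<bar> powr (- (real n * \<delta>)))"
    proof (rule mult_mono[OF D[OF that] C[OF that]])
      show "0 \<le> D * \<bar>s\<bar> powr (- \<delta>)" using D[OF that] norm_ge_zero order_trans by blast
    qed simp
    also have "\<dots> = (D * C) * (\<bar>s\<bar> powr (- \<delta>) * \<bar>s\<bar> powr (- (real n * \<delta>)))" by simp
    also have "\<bar>s\<bar> powr (- \<delta>) * \<bar>s\<bar> powr (- (real n * \<delta>)) = \<bar>s\<bar> powr (- (real (Suc n) * \<delta>))"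
      by (simp add: algebra_simps flip: powr_add)
    finally show ?thesis .
  qed
  then show ?case by blast
qed

text \<open>The characteristic function of \<open>c * ln Y\<close> at t is
  \<open>mellin 0 (t * c)\<close>. Decay of order N \<delta> \<ge> n beats the n-th power, and for
  small arguments the total mass 1 suffices.\<close>

lemma rapid_char_log:
  assumes "c \<noteq> 0"
  shows "rapid_char (distr \<nu> borel (\<lambda>y. c * ln y))"
proof -
  interpret nu: real_distribution \<nu> by (rule nu)
  let ?M = "distr \<nu> borel (\<lambda>y. c * ln y)"
  interpret M: real_distribution ?M by (rule nu.real_distribution_distr, rule nu.measurable_finite_borel) measurable
  show ?thesis
  proof (intro rapid_char.intro rapid_char_axioms.intro)
    show "real_distribution ?M" by (rule M.real_distribution_axioms)
    fix n
    have char_eq: "char ?M t = mellin 0 (t * c)" for t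
      unfolding char_def mellin_def by (subst integral_distr) (auto simp: mult.assoc)
    obtain N :: nat where N: "real n \<le> real N * \<delta>"
      using reals_Archimedean3[OF \<delta>_pos] less_imp_le by blast
    obtain C where C: "\<And>s. 1 \<le> \<bar>s\<bar> \<Longrightarrow> cmod (mellin 0 s) \<le> C * \<bar>s\<bar> powr (- (real N * \<delta>))"
      using mellin_decay by blast
    have "\<bar>t\<bar> ^ n * cmod (char ?M t) \<le> max 1 C / \<bar>c\<bar> ^ n" for t
    proof -
      have 1: "\<bar>t\<bar> ^ n = \<bar>t * c\<bar> ^ n / \<bar>c\<bar> ^ n" using assms by (simp add: abs_mult power_mult_distrib)
      have "\<bar>s\<bar> ^ n * cmod (mellin 0 s) \<le> max 1 C" for s
      proof (cases "1 \<le> \<bar>s\<bar>")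
        case True
        have "0 \<le> C"
        proof -
          have "0 \<le> C * \<bar>s\<bar> powr (- (real N * \<delta>))" using C[OF True] norm_ge_zero order_trans by blast
          then show ?thesis using True by (auto simp: zero_le_mult_iff)
        qed
        have "\<bar>s\<bar> ^ n * cmod (mellin 0 s) \<le> \<bar>s\<bar> powr (real N * \<delta>) * (C * \<bar>s\<bar> powr (- (real N * \<delta>)))"
        proof (rule mult_mono[OF _ C[OF True]])
          show "\<bar>s\<bar> ^ n \<le> \<bar>s\<bar> powr (real N * \<delta>)"
            using True N by (simp add: powr_mono flip: powr_realpow)
        qed auto
        also have "\<dots> = C" using True by (simp add: powr_minus field_simps)
        finally show ?thesis by simp
      next
        case False
        have "\<bar>s\<bar> ^ n * cmod (mellin 0 s) \<le> 1 * 1"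
          using False mellin_bound[of 0 s] by (intro mult_mono power_le_one) auto
        then show ?thesis by simp
      qed
      from this[of "t * c"] show ?thesis
        unfolding 1 char_eq using assms by (simp add: divide_right_mono)
    qed
    then show "\<exists>C. \<forall>t. \<bar>t\<bar> ^ n * cmod (char ?M t) \<le> C" by blast
  qed
qed

end

end

section \<open>The coagulation kernel\<close>

definition coag_rate :: "real \<Rightarrow> real \<Rightarrow> real \<Rightarrow> real" where
  "coag_rate \<sigma> z e = e powr (- \<sigma>) * (z powr (1/3) + e powr (1/3))\<^sup>2"

lemma coag_rate_nonneg[simp]: "0 \<le> coag_rate \<sigma> z e"
  by (simp add: coag_rate_def)

lemma coag_rate_measurable[measurable]:
  assumes [measurable]: "f \<in> borel_measurable M" "g \<in> borel_measurable M"
  shows "(\<lambda>x. coag_rate \<sigma> (f x) (g x)) \<in> borel_measurable M"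
  unfolding coag_rate_def by measurable

lemma coag_rate_le: "coag_rate \<sigma> z e \<le> (1 + z powr (1/3))\<^sup>2 * coag_rate \<sigma> 1 e"
proof -
  have "(z powr (1/3) + e powr (1/3))\<^sup>2 \<le> ((1 + z powr (1/3)) * (1 + e powr (1/3)))\<^sup>2"
    by (intro power_mono) (auto simp: algebra_simps)
  then have "e powr (- \<sigma>) * (z powr (1/3) + e powr (1/3))\<^sup>2 \<le> e powr (- \<sigma>) * ((1 + z powr (1/3)) * (1 + e powr (1/3)))\<^sup>2"
    by (rule mult_left_mono) simp
  then show ?thesis by (simp add: coag_rate_def power_mult_distrib ac_simps)
qed

lemma coag_rate_scale:
  assumes "0 < x" "0 < e"
  shows "coag_rate \<sigma> x (x * e) = x powr (2/3 - \<sigma>) * coag_rate \<sigma> 1 e"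
proof -
  have "(x powr (1/3) + (x * e) powr (1/3))\<^sup>2 = (x powr (1/3))\<^sup>2 * (1 + e powr (1/3))\<^sup>2"
    using assms by (simp add: powr_mult power2_eq_square algebra_simps)
  moreover have "(x powr (1/3))\<^sup>2 = x powr (2/3)"
    using assms by (simp add: power2_eq_square flip: powr_add)
  moreover have "(x * e) powr (- \<sigma>) * x powr (2/3) = x powr (2/3 - \<sigma>) * e powr (- \<sigma>)"
    using assms by (simp add: powr_mult diff_conv_add_uminus powr_add del: add_uminus_conv_diff)
  ultimately show ?thesis by (simp add: coag_rate_def algebra_simps)
qed

text \<open>A majorant with separate exponents for small and large jumps, since
  \<open>coag_rate \<sigma> 1 e\<close> behaves like \<open>e powr (- \<sigma>)\<close> at 0 and
  like \<open>e powr (2/3 - \<sigma>)\<close> at infinity.\<close>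

definition split_powr :: "real \<Rightarrow> real \<Rightarrow> real \<Rightarrow> real" where
  "split_powr \<theta> \<beta> e = (if e \<le> 1 then e powr \<theta> else e powr \<beta>)"

lemma split_powr_nonneg[simp]: "0 \<le> split_powr \<theta> \<beta> e"
  by (simp add: split_powr_def)

lemma split_powr_measurable[measurable]: "split_powr \<theta> \<beta> \<in> borel_measurable borel"
  unfolding split_powr_def[abs_def] by measurable

lemma filterlim_powr_at_top:
  assumes "0 < c"
  shows "filterlim (\<lambda>x::real. x powr c) at_top at_top"
proof -
  have "filterlim (\<lambda>x::real. exp (c * ln x)) at_top at_top"
    by (intro filterlim_compose[OF exp_at_top] filterlim_tendsto_pos_mult_at_top[OF tendsto_const assms] ln_at_top)
  moreover have "\<forall>\<^sub>F x::real in at_top. exp (c * ln x) = x powr c"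
    using eventually_gt_at_top[of 0] by eventually_elim (simp add: powr_def)
  ultimately show ?thesis by (subst (asm) filterlim_cong[OF refl refl])
qed

locale coag_exponent =
  fixes \<sigma> :: real
  assumes \<sigma>_gt: "5/3 < \<sigma>" and \<sigma>_lt: "\<sigma> < 2"
begin

definition \<alpha> :: real where "\<alpha> = \<sigma> - 5/3"

lemma \<alpha>_pos[simp]: "0 < \<alpha>" and \<alpha>_nonneg[simp]: "0 \<le> \<alpha>" and \<alpha>_neq_0[simp]: "\<alpha> \<noteq> 0"
  and \<alpha>_lt: "\<alpha> < 1/3"
  using \<sigma>_gt \<sigma>_lt by (auto simp: \<alpha>_def)

text \<open>The thresholds are those of two power integrals: \<theta> - \<sigma> > -1 at 0 and
  \<beta> + 2/3 - \<sigma> < -1 at infinity. The 4 in the majorant is the square of 2, from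
  replacing both cube roots by the larger one.\<close>

lemma nn_integral_rate_split_powr:
  assumes "\<sigma> - 1 < \<theta>" "\<beta> < \<alpha>"
  shows "(\<integral>\<^sup>+e. ennreal (coag_rate \<sigma> 1 e * split_powr \<theta> \<beta> e) * indicator {0<..} e \<partial>lborel) < \<infinity>"
proof -
  have "(\<integral>\<^sup>+e. ennreal (coag_rate \<sigma> 1 e * split_powr \<theta> \<beta> e) * indicator {0<..} e \<partial>lborel)
      \<le> (\<integral>\<^sup>+e. ennreal 4 * (ennreal (e powr (\<theta> - \<sigma>)) * indicator {0..1} e) + ennreal 4 * (ennreal (e powr (\<beta> + 2/3 - \<sigma>)) * indicator {1..} e) \<partial>lborel)"
  proof (rule nn_integral_mono)
    fix e :: real
    consider "e \<le> 0" | "0 < e" "e \<le> 1" | "1 < e" by linarith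
    then show "ennreal (coag_rate \<sigma> 1 e * split_powr \<theta> \<beta> e) * indicator {0<..} e
      \<le> ennreal 4 * (ennreal (e powr (\<theta> - \<sigma>)) * indicator {0..1} e) + ennreal 4 * (ennreal (e powr (\<beta> + 2/3 - \<sigma>)) * indicator {1..} e)"
    proof cases
      case 2
      then have "e powr (1/3) \<le> 1" by (intro powr_le1) auto
      then have "(1 + e powr (1/3))\<^sup>2 \<le> 2\<^sup>2" by (intro power_mono) auto
      then have "(e powr (- \<sigma>) * e powr \<theta>) * (1 + e powr (1/3))\<^sup>2 \<le> (e powr (- \<sigma>) * e powr \<theta>) * 4"
        by (intro mult_left_mono) auto
      also have "e powr (- \<sigma>) * e powr \<theta> = e powr (\<theta> - \<sigma>)" by (simp flip: powr_add)
      finally have "coag_rate \<sigma> 1 e * split_powr \<theta> \<beta> e \<le> 4 * e powr (\<theta> - \<sigma>)"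
        using 2 by (simp add: coag_rate_def split_powr_def powr_diff powr_minus field_simps)
      then have "ennreal (coag_rate \<sigma> 1 e * split_powr \<theta> \<beta> e) \<le> ennreal 4 * ennreal (e powr (\<theta> - \<sigma>))"
        by (subst ennreal_mult[symmetric]) (auto intro: ennreal_leI)
      then show ?thesis using 2 by (auto intro: add_increasing2)
    next
      case 3
      then have "1 \<le> e powr (1/3)" by (intro ge_one_powr_ge_zero) auto
      then have "(1 + e powr (1/3))\<^sup>2 \<le> (2 * e powr (1/3))\<^sup>2" by (intro power_mono) auto
      also have "\<dots> = 4 * e powr (2/3)" using 3 by (simp add: power_mult_distrib power2_eq_square flip: powr_add)
      finally have "(e powr (- \<sigma>) * e powr \<beta>) * (1 + e powr (1/3))\<^sup>2 \<le> (e powr (- \<sigma>) * e powr \<beta>) * (4 * e powr (2/3))"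
        by (intro mult_left_mono) auto
      also have "\<dots> = 4 * (e powr (- \<sigma>) * e powr \<beta> * e powr (2/3))" by simp
      also have "e powr (- \<sigma>) * e powr \<beta> * e powr (2/3) = e powr (\<beta> + 2/3 - \<sigma>)" by (simp add: algebra_simps flip: powr_add)
      finally have "coag_rate \<sigma> 1 e * split_powr \<theta> \<beta> e \<le> 4 * e powr (\<beta> + 2/3 - \<sigma>)"
        using 3 by (simp add: coag_rate_def split_powr_def ac_simps)
      then have "ennreal (coag_rate \<sigma> 1 e * split_powr \<theta> \<beta> e) \<le> ennreal 4 * ennreal (e powr (\<beta> + 2/3 - \<sigma>))"
        by (subst ennreal_mult[symmetric]) (auto intro: ennreal_leI)
      then show ?thesis using 3 by simp
    qed simp
  qed
  also have "\<dots> = ennreal 4 * (\<integral>\<^sup>+e. ennreal (e powr (\<theta> - \<sigma>)) * indicator {0..1} e \<partial>lborel)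
      + ennreal 4 * (\<integral>\<^sup>+e. ennreal (e powr (\<beta> + 2/3 - \<sigma>)) * indicator {1..} e \<partial>lborel)"
    by (subst nn_integral_add) (auto simp: nn_integral_cmult)
  also have "(\<integral>\<^sup>+e. ennreal (e powr (\<theta> - \<sigma>)) * indicator {0..1} e \<partial>lborel) = ennreal (1 powr (\<theta> - \<sigma> + 1) / (\<theta> - \<sigma> + 1))"
    using assms by (intro nn_integral_has_integral_lebesgue' has_integral_powr_from_0) (auto simp: \<alpha>_def)
  also have "(\<integral>\<^sup>+e. ennreal (e powr (\<beta> + 2/3 - \<sigma>)) * indicator {1..} e \<partial>lborel)
      = ennreal (- (1 powr (\<beta> + 2/3 - \<sigma> + 1)) / (\<beta> + 2/3 - \<sigma> + 1))"
    using assms by (intro nn_integral_has_integral_lebesgue' has_integral_powr_to_inf) (auto simp: \<alpha>_def)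
  also have "ennreal 4 * ennreal (1 powr (\<theta> - \<sigma> + 1) / (\<theta> - \<sigma> + 1))
      + ennreal 4 * ennreal (- (1 powr (\<beta> + 2/3 - \<sigma> + 1)) / (\<beta> + 2/3 - \<sigma> + 1)) < \<infinity>"
    by (simp add: ennreal_mult_less_top)
  finally show ?thesis .
qed

text \<open>Here e is the jump size and v the point passed, both relative to x. The factor 1 / (1 +
  v) comes from writing h at x (1 + v) as f divided by x (1 + v), and \<alpha> is the reciprocal of
  \<mu>.\<close>

definition kernel_weight :: "real \<Rightarrow> real \<Rightarrow> real" where
  "kernel_weight e v = (if 0 < v \<and> v < e then \<alpha> * coag_rate \<sigma> 1 e / (1 + v) else 0)"

lemma kernel_weight_nonneg[simp]: "0 \<le> kernel_weight e v"
  using \<sigma>_gt by (simp add: kernel_weight_def)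

lemma kernel_weight_measurable[measurable]:
  "(\<lambda>z. kernel_weight (fst z) (snd z)) \<in> borel_measurable (lborel \<Otimes>\<^sub>M lborel)"
  "(\<lambda>z. kernel_weight (fst z) (snd z)) \<in> borel_measurable (borel \<Otimes>\<^sub>M borel)"
  unfolding kernel_weight_def by measurable

text \<open>A jump from \<open>x\<close> by more than \<open>x v\<close> is weighted by its rate; \<open>(1 + v)\<^sup>-\<^sup>\<alpha>\<close> is the factor by which
  \<open>y = x\<^sup>-\<^sup>\<alpha>\<close> changes when \<open>x\<close> moves to \<open>x (1 + v)\<close>.\<close>
definition kernel :: "real measure" where
  "kernel = distr (density (lborel \<Otimes>\<^sub>M lborel) (\<lambda>z. ennreal (kernel_weight (fst z) (snd z)))) borel
     (\<lambda>z. (1 + snd z) powr (- \<alpha>))"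

lemma sets_kernel[simp, measurable_cong]: "sets kernel = sets borel"
  by (simp add: kernel_def)

lemma nn_integral_kernel:
  assumes [measurable]: "f \<in> borel_measurable borel"
  shows "(\<integral>\<^sup>+r. f r \<partial>kernel) = (\<integral>\<^sup>+e. \<integral>\<^sup>+v. ennreal (kernel_weight e v) * f ((1 + v) powr (- \<alpha>)) \<partial>lborel \<partial>lborel)"
proof -
  have [measurable]: "(\<lambda>z. (1 + snd z) powr (- \<alpha>)) \<in> borel_measurable (lborel \<Otimes>\<^sub>M lborel)"
    by measurable
  have "(\<integral>\<^sup>+r. f r \<partial>kernel) = (\<integral>\<^sup>+z. ennreal (kernel_weight (fst z) (snd z)) * f ((1 + snd z) powr (- \<alpha>)) \<partial>(lborel \<Otimes>\<^sub>M lborel))"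
    unfolding kernel_def by (simp add: nn_integral_distr nn_integral_density)
  also have "\<dots> = (\<integral>\<^sup>+e. \<integral>\<^sup>+v. ennreal (kernel_weight (fst (e, v)) (snd (e, v))) * f ((1 + snd (e, v)) powr (- \<alpha>)) \<partial>lborel \<partial>lborel)"
    by (rule lborel.nn_integral_fst[symmetric]) measurable
  finally show ?thesis by simp
qed

lemma kernel_AE: "AE r in kernel. 0 < r \<and> r < 1"
proof -
  have "(1 + snd z) powr (- \<alpha>) < 1" if "0 < kernel_weight (fst z) (snd z)" for z
  proof -
    from that have "0 < snd z" by (auto simp: kernel_weight_def split: if_splits)
    then show ?thesis using powr_less_mono2_neg[of "- \<alpha>" 1 "1 + snd z"] by simp
  qed
  moreover have "0 < (1 + snd z) powr (- \<alpha>)" if "0 < kernel_weight (fst z) (snd z)" for z :: "real \<times> real"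
    using that by (auto simp: kernel_weight_def split: if_splits)
  ultimately have *: "AE z in density (lborel \<Otimes>\<^sub>M lborel) (\<lambda>z. ennreal (kernel_weight (fst z) (snd z))).
      0 < (1 + snd z) powr (- \<alpha>) \<and> (1 + snd z) powr (- \<alpha>) < 1"
    by (subst AE_density) (simp_all)
  have m: "(\<lambda>z. (1 + snd z) powr (- \<alpha>)) \<in> borel_measurable (density (lborel \<Otimes>\<^sub>M lborel) (\<lambda>z. ennreal (kernel_weight (fst z) (snd z))))"
    by measurable
  show ?thesis
    unfolding kernel_def by (subst AE_distr_iff[OF m]) (use * in simp_all)
qed

text \<open>At r = \<open>(1 + v) powr (- \<alpha>)\<close> the integrand is
  \<open>(1 + v) powr (\<alpha> * b)\<close>. Integrated against dv / (1 + v) up to e, it is of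
  order e for small e and of order \<open>e powr (\<alpha> * b)\<close> for large e, and \<alpha> b
  < \<alpha> is the integrability condition at infinity.\<close>

lemma nn_integral_kernel_neg_power:
  assumes "0 < b" "b < 1"
  shows "(\<integral>\<^sup>+r. ennreal (r powr (- b)) \<partial>kernel) < \<infinity>"
proof -
  let ?\<beta> = "\<alpha> * b"
  have \<beta>: "0 < ?\<beta>" "?\<beta> < \<alpha>" "?\<beta> < 1"
  proof -
    show 1: "0 < ?\<beta>" "?\<beta> < \<alpha>" using assms by auto
    show "?\<beta> < 1" by (rule less_trans[OF 1(2)]) (use \<alpha>_lt in simp)
  qed
  \<comment> \<open>The 1 serves jumps up to 1; the reciprocal comes from the power integral for
    larger ones.\<close>
  let ?C = "1 + 1 / ?\<beta>"
  have inner: "(\<integral>\<^sup>+v. ennreal (kernel_weight e v) * ennreal (((1 + v) powr (- \<alpha>)) powr (- b)) \<partial>lborel)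
      \<le> ennreal (\<alpha> * ?C) * (ennreal (coag_rate \<sigma> 1 e * split_powr 1 ?\<beta> e) * indicator {0<..} e)" for e
  proof (cases "0 < e")
    case False
    then have "kernel_weight e v = 0" for v by (simp add: kernel_weight_def)
    then show ?thesis by simp
  next
    case True
    have pt: "kernel_weight e v * ((1 + v) powr (- \<alpha>)) powr (- b) = \<alpha> * coag_rate \<sigma> 1 e * (indicator {0<..<e} v * (1 + v) powr (?\<beta> - 1))" for v
    proof (cases "0 < v \<and> v < e")
      case v: True
      have "((1 + v) powr (- \<alpha>)) powr (- b) = (1 + v) powr ?\<beta>" by (simp only: powr_powr minus_mult_minus)
      moreover have "(1 + v) powr (?\<beta> - 1) = (1 + v) powr ?\<beta> / (1 + v)"
        using v by (simp only: powr_diff) simp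
      ultimately show ?thesis using v by (simp add: kernel_weight_def)
    qed (auto simp: kernel_weight_def)
    have "(\<integral>\<^sup>+v. ennreal (indicator {0<..<e} v * (1 + v) powr (?\<beta> - 1)) \<partial>lborel) \<le> ennreal (?C * split_powr 1 ?\<beta> e)"
    proof (cases "e \<le> 1")
      case 1: True
      have "(\<integral>\<^sup>+v. ennreal (indicator {0<..<e} v * (1 + v) powr (?\<beta> - 1)) \<partial>lborel) \<le> (\<integral>\<^sup>+v. indicator {0<..<e} v \<partial>lborel)"
      proof (rule nn_integral_mono)
        fix v
        show "ennreal (indicator {0<..<e} v * (1 + v) powr (?\<beta> - 1)) \<le> indicator {0<..<e} v"
          using \<beta> powr_mono2'[of "?\<beta> - 1" 1 "1 + v"] by (auto simp: indicator_def)
      qed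
      also have "\<dots> = ennreal e" using True by simp
      also have "\<dots> \<le> ennreal (?C * split_powr 1 ?\<beta> e)"
        using True 1 \<beta> by (intro ennreal_leI) (auto simp: split_powr_def algebra_simps)
      finally show ?thesis .
    next
      case 2: False
      have "(\<integral>\<^sup>+v. ennreal (indicator {0<..<e} v * (1 + v) powr (?\<beta> - 1)) \<partial>lborel) \<le> (\<integral>\<^sup>+v. ennreal (v powr (?\<beta> - 1)) * indicator {0..e} v \<partial>lborel)"
      proof (rule nn_integral_mono)
        fix v
        show "ennreal (indicator {0<..<e} v * (1 + v) powr (?\<beta> - 1)) \<le> ennreal (v powr (?\<beta> - 1)) * indicator {0..e} v"
          using \<beta> powr_mono2'[of "?\<beta> - 1" v "1 + v"] by (auto simp: indicator_def intro!: ennreal_leI)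
      qed
      also have "\<dots> = ennreal (e powr (?\<beta> - 1 + 1) / (?\<beta> - 1 + 1))"
        using True \<beta> by (intro nn_integral_has_integral_lebesgue' has_integral_powr_from_0) auto
      also have "\<dots> \<le> ennreal (?C * split_powr 1 ?\<beta> e)"
        using 2 \<beta> by (intro ennreal_leI) (auto simp: split_powr_def algebra_simps)
      finally show ?thesis .
    qed
    then have "ennreal (\<alpha> * coag_rate \<sigma> 1 e) * (\<integral>\<^sup>+v. ennreal (indicator {0<..<e} v * (1 + v) powr (?\<beta> - 1)) \<partial>lborel)
        \<le> ennreal (\<alpha> * coag_rate \<sigma> 1 e) * ennreal (?C * split_powr 1 ?\<beta> e)"
      by (rule mult_left_mono) simp
    also have "\<dots> = ennreal (\<alpha> * ?C) * ennreal (coag_rate \<sigma> 1 e * split_powr 1 ?\<beta> e)"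
      using \<sigma>_gt \<beta> by (simp add: ac_simps flip: ennreal_mult')
    also have "ennreal (\<alpha> * coag_rate \<sigma> 1 e) * (\<integral>\<^sup>+v. ennreal (indicator {0<..<e} v * (1 + v) powr (?\<beta> - 1)) \<partial>lborel)
        = (\<integral>\<^sup>+v. ennreal (kernel_weight e v) * ennreal (((1 + v) powr (- \<alpha>)) powr (- b)) \<partial>lborel)"
    proof (subst nn_integral_cmult[symmetric])
      have "ennreal (kernel_weight e v) * ennreal (((1 + v) powr (- \<alpha>)) powr (- b))
          = ennreal (\<alpha> * coag_rate \<sigma> 1 e) * ennreal (indicator {0<..<e} v * (1 + v) powr (?\<beta> - 1))" for v
        by (subst (1 2) ennreal_mult'[symmetric]) (simp_all add: pt)
      then show "(\<integral>\<^sup>+v. ennreal (\<alpha> * coag_rate \<sigma> 1 e) * ennreal (indicator {0<..<e} v * (1 + v) powr (?\<beta> - 1)) \<partial>lborel)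
        = (\<integral>\<^sup>+v. ennreal (kernel_weight e v) * ennreal (((1 + v) powr (- \<alpha>)) powr (- b)) \<partial>lborel)"
        by simp
    qed measurable
    finally show ?thesis using True by simp
  qed
  have "(\<integral>\<^sup>+r. ennreal (r powr (- b)) \<partial>kernel)
      \<le> (\<integral>\<^sup>+e. ennreal (\<alpha> * ?C) * (ennreal (coag_rate \<sigma> 1 e * split_powr 1 ?\<beta> e) * indicator {0<..} e) \<partial>lborel)"
    by (subst nn_integral_kernel) (auto intro!: nn_integral_mono inner)
  also have "\<dots> = ennreal (\<alpha> * ?C) * (\<integral>\<^sup>+e. ennreal (coag_rate \<sigma> 1 e * split_powr 1 ?\<beta> e) * indicator {0<..} e \<partial>lborel)"
    by (rule nn_integral_cmult) measurable
  also have "\<dots> < \<infinity>"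
    using nn_integral_rate_split_powr[of 1 ?\<beta>] \<beta> \<sigma>_lt by (simp add: ennreal_mult_less_top)
  finally show ?thesis .
qed

lemma finite_kernel: "finite_measure kernel"
proof
  have "emeasure kernel (space kernel) = (\<integral>\<^sup>+r. 1 \<partial>kernel)" by simp
  also have "\<dots> \<le> (\<integral>\<^sup>+r. ennreal (r powr (- (1/2))) \<partial>kernel)"
  proof (rule nn_integral_mono_AE)
    show "AE r in kernel. 1 \<le> ennreal (r powr (- (1/2)))"
      using kernel_AE
    proof eventually_elim
      case (elim r)
      then show ?case using powr_mono2'[of "- (1/2)" r 1] by simp
    qed
  qed
  also have "\<dots> < \<infinity>" by (rule nn_integral_kernel_neg_power) auto
  finally show "emeasure kernel (space kernel) \<noteq> \<infinity>" by simp
qed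

text \<open>Only the rectangle with e in (1/(2n), 1/n) and v in (0, 1/(2n)) is kept: its area is
  1/(4 n^2), the rate on it is at least \<open>n powr \<sigma>\<close>, and \<open>r ^ n\<close>
  stays bounded below because v is at most of order 1/n.\<close>

lemma kernel_moment_ge:
  assumes n: "1 \<le> n"
  shows "\<alpha> * exp (-1) / 4 * (real n powr (\<sigma> - 1)) \<le> real n * (LINT r|kernel. r ^ n)"
proof -
  interpret finite_measure kernel by (rule finite_kernel)
  let ?c = "\<alpha> * real n powr \<sigma> * exp (-1)"
  let ?E = "{1 / (2 * real n)<..<1 / real n}" and ?V = "{0<..<1 / (2 * real n)}"
  have pt: "?c * indicator ?E e * indicator ?V v \<le> kernel_weight e v * ((1 + v) powr (- \<alpha>)) ^ n" for e v
  proof (cases "e \<in> ?E \<and> v \<in> ?V")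
    case True
    then have e: "0 < v" "v < e" "e < 1 / real n" "v < 1 / (2 * real n)" by auto
    have 1: "exp (-1) \<le> ((1 + v) powr (- \<alpha>)) ^ n / (1 + v)"
    proof -
      \<comment> \<open>The summand 1 accounts for the factor 1 / (1 + v) of the weight; the total
        exponent stays below 1, whence the constant \<open>exp (-1)\<close>.\<close>
      have "(\<alpha> * real n + 1) * ln (1 + v) \<le> (2 * real n) * v"
      proof (rule mult_mono)
        have "\<alpha> * real n \<le> 1 * real n" using \<alpha>_lt by (intro mult_right_mono) auto
        then show "\<alpha> * real n + 1 \<le> 2 * real n" using n by linarith
        show "ln (1 + v) \<le> v" using e ln_add_one_self_le_self by auto
      qed (use e n in auto)
      also have "\<dots> \<le> 1" using e n by (simp add: field_simps)
      finally have "exp (-1) \<le> exp (real n * (- \<alpha> * ln (1 + v)) - ln (1 + v))"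
        by (simp add: algebra_simps)
      also have "\<dots> = exp (- \<alpha> * ln (1 + v)) ^ n / (1 + v)"
        using e by (simp only: exp_diff exp_of_nat_mult) simp
      also have "exp (- \<alpha> * ln (1 + v)) = (1 + v) powr (- \<alpha>)"
        using e by (simp add: powr_def)
      finally show ?thesis .
    qed
    have "real n powr \<sigma> \<le> coag_rate \<sigma> 1 e"
    proof -
      have "real n powr \<sigma> = (1 / real n) powr (- \<sigma>)" using n by (simp add: powr_minus powr_divide)
      also have "\<dots> \<le> e powr (- \<sigma>)" using e n \<sigma>_gt by (intro powr_mono2') auto
      also have "\<dots> \<le> e powr (- \<sigma>) * (1 + e powr (1/3))\<^sup>2" by (simp add: mult_le_cancel_left1 one_le_power)
      finally show ?thesis by (simp add: coag_rate_def)
    qed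
    then have "\<alpha> * real n powr \<sigma> * exp (-1) \<le> (\<alpha> * coag_rate \<sigma> 1 e) * (((1 + v) powr (- \<alpha>)) ^ n / (1 + v))"
      by (intro mult_mono[OF mult_left_mono 1]) simp_all
    then show ?thesis using e True by (simp add: kernel_weight_def)
  next
    case False
    then have "?c * indicator ?E e * indicator ?V v = 0" by auto
    moreover have "0 \<le> kernel_weight e v * ((1 + v) powr (- \<alpha>)) ^ n"
      by (intro mult_nonneg_nonneg kernel_weight_nonneg zero_le_power powr_ge_zero)
    ultimately show ?thesis by linarith
  qed
  have int: "integrable kernel (\<lambda>r. r ^ n)"
  proof (rule integrable_const_bound[where B=1])
    show "AE r in kernel. norm (r ^ n) \<le> 1"
      using kernel_AE by eventually_elim (auto intro!: power_le_one)
  qed measurable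
  have T0: "0 \<le> (LINT r|kernel. r ^ n)"
  proof (rule integral_nonneg_AE)
    show "AE r in kernel. 0 \<le> r ^ n" using kernel_AE by eventually_elim simp
  qed
  have "ennreal (?c * (1 / (2 * real n)) * (1 / (2 * real n))) = ennreal ?c * ennreal (1 / (2 * real n)) * ennreal (1 / (2 * real n))"
    using \<sigma>_gt by (simp flip: ennreal_mult')
  also have "\<dots> = ennreal ?c * (\<integral>\<^sup>+e. indicator ?E e \<partial>lborel) * (\<integral>\<^sup>+v. indicator ?V v \<partial>lborel)"
    using n by (simp add: field_simps)
  also have "\<dots> = (\<integral>\<^sup>+e. \<integral>\<^sup>+v. ennreal ?c * indicator ?E e * indicator ?V v \<partial>lborel \<partial>lborel)"
    by (subst nn_integral_cmult, measurable, subst nn_integral_multc, measurable, subst nn_integral_cmult, measurable)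
  also have "\<dots> \<le> (\<integral>\<^sup>+e. \<integral>\<^sup>+v. ennreal (kernel_weight e v) * ennreal (((1 + v) powr (- \<alpha>)) ^ n) \<partial>lborel \<partial>lborel)"
  proof (intro nn_integral_mono)
    fix e v :: real
    show "ennreal ?c * indicator ?E e * indicator ?V v \<le> ennreal (kernel_weight e v) * ennreal (((1 + v) powr (- \<alpha>)) ^ n)"
      using ennreal_leI[OF pt[of e v]] \<sigma>_gt by (simp add: ennreal_mult' ennreal_indicator)
  qed
  also have "\<dots> = (\<integral>\<^sup>+r. ennreal (r ^ n) \<partial>kernel)" by (simp add: nn_integral_kernel)
  also have "\<dots> = ennreal (LINT r|kernel. r ^ n)"
  proof (rule nn_integral_eq_integral[OF int])
    show "AE r in kernel. 0 \<le> r ^ n" using kernel_AE by eventually_elim simp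
  qed
  finally have "?c * (1 / (2 * real n)) * (1 / (2 * real n)) \<le> (LINT r|kernel. r ^ n)"
    using T0 by (simp add: ennreal_le_iff)
  then have "real n * (?c * (1 / (2 * real n)) * (1 / (2 * real n))) \<le> real n * (LINT r|kernel. r ^ n)"
    by (rule mult_left_mono) simp
  also have "real n * (?c * (1 / (2 * real n)) * (1 / (2 * real n))) = \<alpha> * exp (-1) / 4 * (real n powr (\<sigma> - 1))"
    using n by (simp add: powr_diff field_simps)
  finally show ?thesis .
qed

lemma kernel_slow: "filterlim (\<lambda>n. real n * (LINT r|kernel. r ^ n)) at_top sequentially"
proof -
  have "filterlim (\<lambda>x. x powr (\<sigma> - 1)) at_top at_top"
    using \<sigma>_gt by (intro filterlim_powr_at_top) simp
  from filterlim_compose[OF this filterlim_real_sequentially]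
  have "filterlim (\<lambda>n. real n powr (\<sigma> - 1)) at_top sequentially" .
  then have "filterlim (\<lambda>n. \<alpha> * exp (-1) / 4 * (real n powr (\<sigma> - 1))) at_top sequentially"
    by (rule filterlim_tendsto_pos_mult_at_top[OF tendsto_const, rotated]) simp
  moreover have "\<forall>\<^sub>F n in sequentially. \<alpha> * exp (-1) / 4 * (real n powr (\<sigma> - 1)) \<le> real n * (LINT r|kernel. r ^ n)"
    by (rule eventually_sequentiallyI[of 1]) (rule kernel_moment_ge)
  ultimately show ?thesis by (rule filterlim_at_top_mono)
qed

sublocale mult_kernel kernel
  by (intro mult_kernel.intro sets_kernel finite_kernel kernel_AE kernel_slow)

section \<open>Decay of the oscillatory kernel moments\<close>

definition osc_factor :: "nat \<Rightarrow> real \<Rightarrow> real \<Rightarrow> complex" where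
  "osc_factor k s v = of_real (((1 + v) powr (- \<alpha>)) ^ k) * iexp (s * ln ((1 + v) powr (- \<alpha>)))"

lemma osc_factor_measurable[measurable]: "osc_factor k s \<in> borel_measurable borel"
  unfolding osc_factor_def[abs_def] by measurable

lemma cmod_osc_factor_le: "0 \<le> v \<Longrightarrow> cmod (osc_factor k s v) \<le> 1"
  unfolding osc_factor_def cmod_mult_iexp norm_of_real
  using powr_mono2'[of "- \<alpha>" 1 "1 + v"] by (simp add: power_le_one)

lemma emeasure_kernel_weight:
  "(\<integral>\<^sup>+z. ennreal (kernel_weight (fst z) (snd z)) \<partial>(lborel \<Otimes>\<^sub>M lborel)) < \<infinity>"
proof -
  have "(\<integral>\<^sup>+z. ennreal (kernel_weight (fst z) (snd z)) \<partial>(lborel \<Otimes>\<^sub>M lborel))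
      = (\<integral>\<^sup>+e. \<integral>\<^sup>+v. ennreal (kernel_weight (fst (e, v)) (snd (e, v))) \<partial>lborel \<partial>lborel)"
    by (rule lborel.nn_integral_fst[symmetric]) measurable
  also have "\<dots> = (\<integral>\<^sup>+r. 1 \<partial>kernel)"
    by (subst nn_integral_kernel) simp_all
  also have "\<dots> = emeasure kernel (space kernel)" by simp
  also have "\<dots> < \<infinity>" by (simp add: less_top[symmetric])
  finally show ?thesis .
qed

lemma integrable_osc: "integrable (lborel \<Otimes>\<^sub>M lborel) (\<lambda>(e, v). kernel_weight e v *\<^sub>R osc_factor k s v)"
proof (rule integrableI_bounded)
  have [measurable]: "(\<lambda>z. osc_factor k s (snd z)) \<in> borel_measurable (lborel \<Otimes>\<^sub>M lborel)"
    by measurable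
  show "(\<lambda>(e, v). kernel_weight e v *\<^sub>R osc_factor k s v) \<in> borel_measurable (lborel \<Otimes>\<^sub>M lborel)"
    unfolding split_beta' by measurable
  have "(\<integral>\<^sup>+z. norm (case z of (e, v) \<Rightarrow> kernel_weight e v *\<^sub>R osc_factor k s v) \<partial>(lborel \<Otimes>\<^sub>M lborel))
      \<le> (\<integral>\<^sup>+z. ennreal (kernel_weight (fst z) (snd z)) \<partial>(lborel \<Otimes>\<^sub>M lborel))"
  proof (intro nn_integral_mono ennreal_leI)
    fix z :: "real \<times> real"
    obtain e v where z: "z = (e, v)" by (cases z)
    have "norm (kernel_weight e v *\<^sub>R osc_factor k s v) \<le> kernel_weight e v"
    proof (cases "0 \<le> v")
      case True
      then show ?thesis using cmod_osc_factor_le[of v k s] by (simp add: mult_left_le)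
    qed (simp add: kernel_weight_def)
    then show "norm (case z of (e, v) \<Rightarrow> kernel_weight e v *\<^sub>R osc_factor k s v) \<le> kernel_weight (fst z) (snd z)"
      by (simp add: z)
  qed
  also note emeasure_kernel_weight
  finally show "(\<integral>\<^sup>+z. norm (case z of (e, v) \<Rightarrow> kernel_weight e v *\<^sub>R osc_factor k s v) \<partial>(lborel \<Otimes>\<^sub>M lborel)) < \<infinity>" .
qed

lemma kernel_osc_integral:
  "(CLINT r|kernel. of_real (r ^ k) * iexp (s * ln r)) = (CLINT e|lborel. CLINT v|lborel. kernel_weight e v *\<^sub>R osc_factor k s v)"
proof -
  have [measurable]: "(\<lambda>z. (1 + snd z) powr (- \<alpha>)) \<in> borel_measurable (lborel \<Otimes>\<^sub>M lborel)"
    "(\<lambda>z. osc_factor k s (snd z)) \<in> borel_measurable (lborel \<Otimes>\<^sub>M lborel)"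
    by measurable
  have "(CLINT r|kernel. of_real (r ^ k) * iexp (s * ln r))
      = (CLINT z|density (lborel \<Otimes>\<^sub>M lborel) (\<lambda>z. ennreal (kernel_weight (fst z) (snd z))). osc_factor k s (snd z))"
    unfolding kernel_def osc_factor_def by (subst integral_distr) simp_all
  also have "\<dots> = (CLINT z|lborel \<Otimes>\<^sub>M lborel. kernel_weight (fst z) (snd z) *\<^sub>R osc_factor k s (snd z))"
    by (rule integral_density) simp_all
  also have "\<dots> = (CLINT z|lborel \<Otimes>\<^sub>M lborel. (case z of (e, v) \<Rightarrow> kernel_weight e v *\<^sub>R osc_factor k s v))"
    by (simp add: split_beta)
  also have "\<dots> = (CLINT e|lborel. CLINT v|lborel. kernel_weight e v *\<^sub>R osc_factor k s v)"
    using lborel_pair.integral_fst'[OF integrable_osc[of k s]] by simp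
  finally show ?thesis .
qed

text \<open>With z = \<alpha> (k + \<i> s) the integrand is (1 + v)^(-z-1). Its primitive -(1 +
  v)^(-z) / z is bounded by 1 / |z| because Re z \<ge> 0, and |z| \<ge> \<alpha> |s|. The bound e,
  from integrating the modulus, is the better one on short intervals.\<close>

lemma osc_inner_bound:
  assumes e: "0 < e" and s: "s \<noteq> 0"
  shows "cmod (CLINT v|lborel. indicator {0..e} v *\<^sub>R (osc_factor k s v / of_real (1 + v))) \<le> min e (2 / (\<alpha> * \<bar>s\<bar>))"
proof -
  define z where "z = Complex (\<alpha> * real k) (\<alpha> * s)"
  have z: "z \<noteq> 0" "\<alpha> * \<bar>s\<bar> \<le> cmod z" "0 \<le> Re z"
    using s abs_Im_le_cmod[of z] by (auto simp: z_def complex_eq_iff abs_mult)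
  let ?f = "\<lambda>v. osc_factor k s v / of_real (1 + v)"
  have f_eq: "?f v = exp (- z * of_real (ln (1 + v))) / of_real (1 + v)" if "0 \<le> v" for v
  proof -
    have 1: "((1 + v) powr (- \<alpha>)) ^ k = exp (- (\<alpha> * real k) * ln (1 + v))"
      using that by (simp add: powr_def ac_simps flip: exp_of_nat_mult)
    have 2: "ln ((1 + v) powr (- \<alpha>)) = - \<alpha> * ln (1 + v)"
      using that by (simp add: ln_powr)
    have 3: "- z * of_real (ln (1 + v)) = of_real (- (\<alpha> * real k) * ln (1 + v)) + \<i> * of_real (s * (- \<alpha> * ln (1 + v)))"
      by (simp add: z_def complex_eq_iff)
    show ?thesis unfolding osc_factor_def 1 2 3 exp_add by (simp only: exp_of_real)
  qed
  let ?F = "\<lambda>v. - exp (- z * of_real (ln (1 + v))) / z"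
  have cont: "continuous_on {0..e} ?f"
  proof (subst continuous_on_cong[OF refl f_eq])
    show "continuous_on {0..e} (\<lambda>v. exp (- z * of_real (ln (1 + v))) / of_real (1 + v))"
      by (intro continuous_intros) (auto simp: add_eq_0_iff complex_eq_iff)
  qed simp
  have FTC: "(CLINT v|lborel. indicator {0..e} v *\<^sub>R ?f v) = ?F e - ?F 0"
  proof (rule integral_FTC_atLeastAtMost)
    fix v assume v: "0 \<le> v" "v \<le> e"
    have "((\<lambda>v. of_real (ln (1 + v)) :: complex) has_vector_derivative of_real (1 / (1 + v))) (at v within {0..e})"
      using v by (intro has_vector_derivative_of_real) (auto intro!: derivative_eq_intros simp flip: has_real_derivative_iff_has_vector_derivative)
    then have "((\<lambda>v. - z * of_real (ln (1 + v))) has_vector_derivative - z * of_real (1 / (1 + v))) (at v within {0..e})"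
      by (rule has_vector_derivative_mult_right)
    from field_vector_diff_chain_within[OF this, of exp "exp (- z * of_real (ln (1 + v)))"]
    have "((\<lambda>v. exp (- z * of_real (ln (1 + v)))) has_vector_derivative - z * of_real (1 / (1 + v)) * exp (- z * of_real (ln (1 + v)))) (at v within {0..e})"
      by (simp add: o_def DERIV_subset[OF DERIV_exp])
    then have "((\<lambda>v. exp (- z * of_real (ln (1 + v))) * (- 1 / z)) has_vector_derivative (- z * of_real (1 / (1 + v)) * exp (- z * of_real (ln (1 + v)))) * (- 1 / z)) (at v within {0..e})"
      by (rule has_vector_derivative_mult_left)
    then show "(?F has_vector_derivative ?f v) (at v within {0..e})"
      unfolding f_eq[OF v(1)] using z v by simp
  qed (use e cont in simp_all)
  have F_bound: "cmod (?F v) \<le> 1 / (\<alpha> * \<bar>s\<bar>)" if "0 \<le> v" for v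
  proof -
    have "cmod (exp (- z * of_real (ln (1 + v)))) \<le> 1"
      using z that by simp
    then have "cmod (?F v) \<le> 1 / cmod z" by (simp add: norm_divide divide_right_mono)
    also have "\<dots> \<le> 1 / (\<alpha> * \<bar>s\<bar>)" using z s by (intro frac_le) auto
    finally show ?thesis .
  qed
  have "cmod (CLINT v|lborel. indicator {0..e} v *\<^sub>R ?f v) \<le> 2 / (\<alpha> * \<bar>s\<bar>)"
    unfolding FTC using norm_triangle_ineq4[of "?F e" "?F 0"] F_bound[of e] F_bound[of 0] e by simp
  moreover have "cmod (CLINT v|lborel. indicator {0..e} v *\<^sub>R ?f v) \<le> e"
  proof -
    have "cmod (CLINT v|lborel. indicator {0..e} v *\<^sub>R ?f v) \<le> (LINT v|lborel. indicator {0..e} v)"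
    proof (rule Bochner_Integration.integral_norm_bound_integral)
      show "integrable lborel (\<lambda>v. indicator {0..e} v *\<^sub>R ?f v)"
        by (rule borel_integrable_compact) (use cont in auto)
      fix v
      show "norm (indicator {0..e} v *\<^sub>R ?f v) \<le> indicator {0..e} v"
      proof (cases "0 \<le> v")
        case True
        have "cmod (?f v) = cmod (osc_factor k s v) / (1 + v)"
          using True by (simp add: norm_divide del: of_real_add)
        also have "\<dots> \<le> 1 / 1"
          using cmod_osc_factor_le[OF True] True by (intro frac_le) auto
        finally show ?thesis by (simp add: indicator_def)
      qed simp
    qed (use e in \<open>simp add: integrable_indicator_iff\<close>)
    also have "\<dots> = e" using e by simp
    finally show ?thesis .
  qed
  ultimately show ?thesis by simp
qed

text \<open>Geometric interpolation: the minimum is at most \<open>e powr \<theta>\<close> times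
  \<open>(c / a) powr (1 - \<theta>)\<close>. This splits the gain between integrability in e near 0
  and decay in a; for e > 1 the bound c / a is kept and weakened to the same power of a.\<close>

lemma min_le_split_powr:
  assumes \<theta>: "0 < \<theta>" "\<theta> < 1" and "0 < e" "1 \<le> a" "0 < c"
  shows "min e (c / a) \<le> (c + c powr (1 - \<theta>)) * a powr (- (1 - \<theta>)) * split_powr \<theta> 0 e"
proof (cases "e \<le> 1")
  case True
  have 0: "0 < c / a" using assms by simp
  have "min e (c / a) = min e (c / a) powr \<theta> * min e (c / a) powr (1 - \<theta>)"
    using assms 0 by (simp flip: powr_add)
  also have "\<dots> \<le> e powr \<theta> * (c / a) powr (1 - \<theta>)"
    using assms 0 by (intro mult_mono powr_mono2) auto
  also have "\<dots> = c powr (1 - \<theta>) * a powr (- (1 - \<theta>)) * e powr \<theta>"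
    unfolding powr_minus[of a "1 - \<theta>"] using assms by (simp add: powr_divide field_simps)
  also have "\<dots> \<le> (c + c powr (1 - \<theta>)) * a powr (- (1 - \<theta>)) * e powr \<theta>"
    using assms by (intro mult_right_mono) auto
  finally show ?thesis using True by (simp add: split_powr_def)
next
  case False
  have "min e (c / a) \<le> c * a powr (-1)" using assms by (simp add: powr_minus divide_inverse)
  also have "\<dots> \<le> c * a powr (- (1 - \<theta>))"
    using assms by (intro mult_left_mono powr_mono) auto
  also have "\<dots> \<le> (c + c powr (1 - \<theta>)) * a powr (- (1 - \<theta>))"
    using assms by (intro mult_right_mono) auto
  finally show ?thesis using False by (simp add: split_powr_def)
qed

text \<open>The choice \<theta> = \<sigma> / 2 lies strictly between \<sigma> - 1 and 1 because
  \<sigma> < 2: above \<sigma> - 1 the small jumps are integrable, and below 1 a positive power 1 -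
  \<theta> of 1 / |s| remains.\<close>

lemma kernel_oscillation:
  "\<exists>C. \<forall>s. 1 \<le> \<bar>s\<bar> \<longrightarrow> cmod (CLINT r|kernel. of_real (r ^ k) * iexp (s * ln r)) \<le> C * \<bar>s\<bar> powr (- (1 - \<sigma> / 2))"
proof -
  let ?\<theta> = "\<sigma> / 2" and ?c = "2 / \<alpha>"
  let ?D = "\<alpha> * (?c + ?c powr (1 - ?\<theta>))"
  let ?w = "\<lambda>e. coag_rate \<sigma> 1 e * split_powr ?\<theta> 0 e * indicator {0<..} e"
  have w_int: "integrable lborel ?w"
  proof (rule integrableI_bounded)
    have "(\<integral>\<^sup>+e. norm (?w e) \<partial>lborel) = (\<integral>\<^sup>+e. ennreal (coag_rate \<sigma> 1 e * split_powr ?\<theta> 0 e) * indicator {0<..} e \<partial>lborel)"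
      by (intro nn_integral_cong) (auto simp: indicator_def)
    also have "\<dots> < \<infinity>" using \<sigma>_gt \<sigma>_lt by (intro nn_integral_rate_split_powr) auto
    finally show "(\<integral>\<^sup>+e. norm (?w e) \<partial>lborel) < \<infinity>" .
  qed measurable
  have "cmod (CLINT r|kernel. of_real (r ^ k) * iexp (s * ln r)) \<le> (?D * (LINT e|lborel. ?w e)) * \<bar>s\<bar> powr (- (1 - ?\<theta>))"
    if s: "1 \<le> \<bar>s\<bar>" for s
  proof -
    let ?I = "\<lambda>e. CLINT v|lborel. kernel_weight e v *\<^sub>R osc_factor k s v"
    have inner: "cmod (?I e) \<le> ?D * \<bar>s\<bar> powr (- (1 - ?\<theta>)) * ?w e" for e
    proof (cases "0 < e")
      case True
      have "?I e = (CLINT v|lborel. (\<alpha> * coag_rate \<sigma> 1 e) *\<^sub>R (indicator {0..e} v *\<^sub>R (osc_factor k s v / of_real (1 + v))))"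
      proof (rule integral_cong_AE)
        have "AE v in lborel. v \<noteq> 0 \<and> v \<noteq> e" by (intro AE_conjI AE_lborel_singleton)
        then show "AE v in lborel. kernel_weight e v *\<^sub>R osc_factor k s v = (\<alpha> * coag_rate \<sigma> 1 e) *\<^sub>R (indicator {0..e} v *\<^sub>R (osc_factor k s v / of_real (1 + v)))"
        proof eventually_elim
          case (elim v)
          then consider "v < 0" | "0 < v" "v < e" | "e < v" by linarith
          then show ?case
            by cases (use True in \<open>auto simp: kernel_weight_def scaleR_conv_of_real\<close>)
        qed
        have [measurable]: "kernel_weight e \<in> borel_measurable borel"
          unfolding kernel_weight_def[abs_def] by measurable
        show "(\<lambda>v. kernel_weight e v *\<^sub>R osc_factor k s v) \<in> borel_measurable lborel" by measurable
      qed measurable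
      also have "\<dots> = (\<alpha> * coag_rate \<sigma> 1 e) *\<^sub>R (CLINT v|lborel. indicator {0..e} v *\<^sub>R (osc_factor k s v / of_real (1 + v)))"
        by (rule integral_scaleR_right)
      finally have "cmod (?I e) = (\<alpha> * coag_rate \<sigma> 1 e) * cmod (CLINT v|lborel. indicator {0..e} v *\<^sub>R (osc_factor k s v / of_real (1 + v)))"
        by simp
      also have "\<dots> \<le> (\<alpha> * coag_rate \<sigma> 1 e) * min e (?c / \<bar>s\<bar>)"
        using osc_inner_bound[OF True, of s k] s by (intro mult_left_mono) auto
      also have "\<dots> \<le> (\<alpha> * coag_rate \<sigma> 1 e) * ((?c + ?c powr (1 - ?\<theta>)) * \<bar>s\<bar> powr (- (1 - ?\<theta>)) * split_powr ?\<theta> 0 e)"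
        using True s \<sigma>_gt \<sigma>_lt by (intro mult_left_mono min_le_split_powr) auto
      finally show ?thesis using True by (simp add: ac_simps)
    next
      case False
      then have "kernel_weight e v = 0" for v by (simp add: kernel_weight_def)
      then show ?thesis using False by simp
    qed
    have "cmod (CLINT e|lborel. ?I e) \<le> (LINT e|lborel. ?D * \<bar>s\<bar> powr (- (1 - ?\<theta>)) * ?w e)"
      using lborel_pair.integrable_fst'[OF integrable_osc[of k s]] w_int
      by (intro Bochner_Integration.integral_norm_bound_integral inner integrable_mult_right) simp_all
    also have "\<dots> = ?D * \<bar>s\<bar> powr (- (1 - ?\<theta>)) * (LINT e|lborel. ?w e)"
      by (rule integral_mult_right_zero)
    finally show ?thesis
      unfolding kernel_osc_integral by (simp only: mult.assoc mult.commute[of "\<bar>s\<bar> powr _"])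
  qed
  then show ?thesis by blast
qed

sublocale oscillating_kernel kernel "1 - \<sigma> / 2"
  using \<sigma>_lt by (intro oscillating_kernel.intro oscillating_kernel_axioms.intro kernel_oscillation mult_kernel_axioms) simp

end

section \<open>The flux identity\<close>

context coag_exponent begin

abbreviation cut_integral :: "(real \<Rightarrow> ennreal) \<Rightarrow> real \<Rightarrow> real \<Rightarrow> ennreal" where
  "cut_integral h x e \<equiv> (\<integral>\<^sup>+w. (if 0 < w \<and> w < e then h (x + w) else 0) \<partial>lborel)"

definition coag_flux :: "(real \<Rightarrow> ennreal) \<Rightarrow> real \<Rightarrow> ennreal" where
  "coag_flux h x = (\<integral>\<^sup>+e. ennreal (coag_rate \<sigma> x e) * indicator {0<..} e *
     cut_integral h x e \<partial>lborel)"

lemma coag_flux_measurable[measurable]: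
  assumes [measurable]: "h \<in> borel_measurable borel"
  shows "coag_flux h \<in> borel_measurable borel"
  unfolding coag_flux_def[abs_def] by measurable

text \<open>Substituting x e for the jump and x v for the position contributes x twice, and the rate
  contributes \<open>x powr (2/3 - \<sigma>)\<close>; together this is
  \<open>x powr (1 - \<alpha>)\<close>.\<close>

lemma coag_flux_scale:
  assumes [measurable]: "h \<in> borel_measurable borel" and x: "0 < x"
  shows "coag_flux h x = ennreal (x powr (1 - \<alpha>)) *
    (\<integral>\<^sup>+e. ennreal (coag_rate \<sigma> 1 e) * indicator {0<..} e *
      (\<integral>\<^sup>+v. (if 0 < v \<and> v < e then h (x * (1 + v)) else 0) \<partial>lborel) \<partial>lborel)"
proof -
  let ?J = "\<lambda>e. \<integral>\<^sup>+v. (if 0 < v \<and> v < e then h (x * (1 + v)) else 0) \<partial>lborel"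
  have inner: "cut_integral h x (x * e) = ennreal x * ?J e" for e
  proof -
    have "cut_integral h x (x * e)
        = ennreal \<bar>x\<bar> * (\<integral>\<^sup>+v. (if 0 < 0 + x * v \<and> 0 + x * v < x * e then h (x + (0 + x * v)) else 0) \<partial>lborel)"
      using x by (intro nn_integral_real_affine[where c=x and t=0 and f="\<lambda>w. if 0 < w \<and> w < x * e then h (x + w) else 0"]) simp_all
    also have "(\<lambda>v. if 0 < 0 + x * v \<and> 0 + x * v < x * e then h (x + (0 + x * v)) else 0) = (\<lambda>v. if 0 < v \<and> v < e then h (x * (1 + v)) else 0)"
      using x by (intro ext) (simp add: zero_less_mult_iff ring_distribs)
    finally show ?thesis using x by simp
  qed
  have "coag_flux h x = ennreal \<bar>x\<bar> * (\<integral>\<^sup>+e. ennreal (coag_rate \<sigma> x (0 + x * e)) * indicator {0<..} (0 + x * e) *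
     cut_integral h x (0 + x * e) \<partial>lborel)"
    unfolding coag_flux_def
  proof (rule nn_integral_real_affine[where c=x and t=0 and f="\<lambda>e. ennreal (coag_rate \<sigma> x e) * indicator {0<..} e *
     cut_integral h x e"])
    show "(\<lambda>e. ennreal (coag_rate \<sigma> x e) * indicator {0<..} e *
     cut_integral h x e) \<in> borel_measurable borel"
      by measurable
  qed (use x in simp)
  also have "(\<integral>\<^sup>+e. ennreal (coag_rate \<sigma> x (0 + x * e)) * indicator {0<..} (0 + x * e) *
     cut_integral h x (0 + x * e) \<partial>lborel)
    = (\<integral>\<^sup>+e. ennreal (x powr (5/3 - \<sigma>)) * (ennreal (coag_rate \<sigma> 1 e) * indicator {0<..} e * ?J e) \<partial>lborel)"
  proof (rule nn_integral_cong)
    fix e :: real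
    show "ennreal (coag_rate \<sigma> x (0 + x * e)) * indicator {0<..} (0 + x * e) *
      cut_integral h x (0 + x * e)
      = ennreal (x powr (5/3 - \<sigma>)) * (ennreal (coag_rate \<sigma> 1 e) * indicator {0<..} e * ?J e)"
    proof (cases "0 < e")
      case True
      have "x powr (5/3 - \<sigma>) = x powr (2/3 - \<sigma>) * x"
        using x powr_add[of x "2/3 - \<sigma>" 1] by simp
      then have "ennreal (coag_rate \<sigma> x (x * e)) * ennreal x = ennreal (x powr (5/3 - \<sigma>)) * ennreal (coag_rate \<sigma> 1 e)"
        unfolding coag_rate_scale[OF x True] using x by (simp add: ac_simps flip: ennreal_mult')
      then show ?thesis using True x unfolding add_0 inner
        by (simp add: zero_less_mult_iff mult.assoc[symmetric])
    next
      case False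
      then show ?thesis using x by (simp add: zero_less_mult_iff)
    qed
  qed
  also have "\<dots> = ennreal (x powr (5/3 - \<sigma>)) * (\<integral>\<^sup>+e. ennreal (coag_rate \<sigma> 1 e) * indicator {0<..} e * ?J e \<partial>lborel)"
    by (rule nn_integral_cmult) measurable
  also have "ennreal \<bar>x\<bar> * (ennreal (x powr (5/3 - \<sigma>)) * (\<integral>\<^sup>+e. ennreal (coag_rate \<sigma> 1 e) * indicator {0<..} e * ?J e \<partial>lborel))
    = ennreal (x powr (1 - \<alpha>)) * (\<integral>\<^sup>+e. ennreal (coag_rate \<sigma> 1 e) * indicator {0<..} e * ?J e \<partial>lborel)"
  proof -
    have "x powr (1 - \<alpha>) = x * x powr (5/3 - \<sigma>)"
      using x powr_add[of x 1 "5/3 - \<sigma>"] by (simp add: \<alpha>_def)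
    then show ?thesis using x by (simp add: ennreal_mult' mult.assoc)
  qed
  finally show ?thesis .
qed

text \<open>The spare factor x in \<open>x powr (1 - \<alpha>)\<close> turns h into f, and the
  remaining \<open>x powr (- \<alpha>)\<close> is the variable y, that is, the size-biasing weight
  of the smearing.\<close>

lemma coag_flux_eq_kernel:
  assumes h[measurable]: "h \<in> borel_measurable borel" and f[measurable]: "f \<in> borel_measurable borel"
    and hf: "\<And>x. 0 < x \<Longrightarrow> h x * ennreal x = f (x powr (- \<alpha>))" and x: "0 < x"
  shows "ennreal \<alpha> * coag_flux h x = ennreal (x powr (- \<alpha>)) * (\<integral>\<^sup>+r. f (x powr (- \<alpha>) * r) \<partial>kernel)"
proof -
  let ?g = "\<lambda>e v. (if 0 < v \<and> v < e then h (x * (1 + v)) else 0)"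
  have pt: "ennreal (kernel_weight e v) * f (x powr (- \<alpha>) * (1 + v) powr (- \<alpha>))
      = ennreal (\<alpha> * x) * (ennreal (coag_rate \<sigma> 1 e) * indicator {0<..} e * ?g e v)" for e v
  proof (cases "0 < v \<and> v < e")
    case True
    then have "x powr (- \<alpha>) * (1 + v) powr (- \<alpha>) = (x * (1 + v)) powr (- \<alpha>)"
      using x by (simp add: powr_mult)
    then have f: "f (x powr (- \<alpha>) * (1 + v) powr (- \<alpha>)) = h (x * (1 + v)) * ennreal (x * (1 + v))"
      using hf[of "x * (1 + v)"] x True by simp
    have "ennreal (kernel_weight e v) * ennreal (x * (1 + v)) = ennreal (\<alpha> * x) * ennreal (coag_rate \<sigma> 1 e)"
    proof (subst (1 2) ennreal_mult'[symmetric])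
      have "kernel_weight e v * (x * (1 + v)) = \<alpha> * x * coag_rate \<sigma> 1 e"
        using True by (simp add: kernel_weight_def)
      then show "ennreal (kernel_weight e v * (x * (1 + v))) = ennreal (\<alpha> * x * coag_rate \<sigma> 1 e)" by (simp only:)
    qed (use x in simp_all)
    then show ?thesis unfolding f using True
      by (simp add: mult.assoc[symmetric] mult.commute[of _ "h _"]) (simp add: mult.assoc)
  qed (auto simp: kernel_weight_def)
  have [measurable]: "?g e \<in> borel_measurable borel" for e by measurable
  have "(\<integral>\<^sup>+r. f (x powr (- \<alpha>) * r) \<partial>kernel)
      = (\<integral>\<^sup>+e. \<integral>\<^sup>+v. ennreal (kernel_weight e v) * f (x powr (- \<alpha>) * (1 + v) powr (- \<alpha>)) \<partial>lborel \<partial>lborel)"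
    by (rule nn_integral_kernel) measurable
  also have "\<dots> = (\<integral>\<^sup>+e. ennreal (\<alpha> * x) * (ennreal (coag_rate \<sigma> 1 e) * indicator {0<..} e * (\<integral>\<^sup>+v. ?g e v \<partial>lborel)) \<partial>lborel)"
    unfolding pt by (intro nn_integral_cong) (simp add: nn_integral_cmult mult.assoc)
  also have "\<dots> = ennreal (\<alpha> * x) * (\<integral>\<^sup>+e. ennreal (coag_rate \<sigma> 1 e) * indicator {0<..} e * (\<integral>\<^sup>+v. ?g e v \<partial>lborel) \<partial>lborel)"
    by (rule nn_integral_cmult) measurable
  finally have 1: "(\<integral>\<^sup>+r. f (x powr (- \<alpha>) * r) \<partial>kernel) = \<dots>" .
  have "x powr (1 - \<alpha>) = x powr (- \<alpha>) * x" using x powr_add[of x "- \<alpha>" 1] by simp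
  then have 2: "ennreal \<alpha> * ennreal (x powr (1 - \<alpha>)) = ennreal (x powr (- \<alpha>)) * ennreal (\<alpha> * x)"
    using x by (simp add: ac_simps flip: ennreal_mult')
  show ?thesis
    unfolding coag_flux_scale[OF h x] 1 mult.assoc[symmetric] 2 ..
qed

text \<open>Quantified over all Borel functions with values up to infinity, so that indicators and
  the singular function 1 / x may be inserted.\<close>

definition flux_identity :: "real measure \<Rightarrow> bool" where
  "flux_identity R \<longleftrightarrow> (\<forall>h\<in>borel_measurable borel.
     (\<integral>\<^sup>+x. h x * ennreal x \<partial>R) = ennreal \<alpha> * (\<integral>\<^sup>+x. coag_flux h x \<partial>R))"

lemma nn_integral_smear_distr_powr:
  assumes R: "real_distribution R" and pos: "AE x in R. 0 < x"
    and [measurable]: "h \<in> borel_measurable borel" "f \<in> borel_measurable borel"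
    and hf: "\<And>x. 0 < x \<Longrightarrow> h x * ennreal x = f (x powr (- \<alpha>))"
  shows "(\<integral>\<^sup>+y. f y \<partial>distr R borel (\<lambda>x. x powr (- \<alpha>))) = (\<integral>\<^sup>+x. h x * ennreal x \<partial>R)"
    and "(\<integral>\<^sup>+y. f y \<partial>mult_smear kernel (distr R borel (\<lambda>x. x powr (- \<alpha>)))) = ennreal \<alpha> * (\<integral>\<^sup>+x. coag_flux h x \<partial>R)"
proof -
  interpret R: real_distribution R by (rule R)
  have [measurable]: "(\<lambda>x. x powr (- \<alpha>)) \<in> borel_measurable R" by (rule R.measurable_finite_borel) measurable
  show "(\<integral>\<^sup>+y. f y \<partial>distr R borel (\<lambda>x. x powr (- \<alpha>))) = (\<integral>\<^sup>+x. h x * ennreal x \<partial>R)"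
  proof (subst nn_integral_distr)
    show "(\<integral>\<^sup>+x. f (x powr (- \<alpha>)) \<partial>R) = (\<integral>\<^sup>+x. h x * ennreal x \<partial>R)"
      by (rule nn_integral_cong_AE, rule eventually_mono[OF pos]) (simp add: hf)
  qed measurable
  let ?\<nu> = "distr R borel (\<lambda>x. x powr (- \<alpha>))"
  have "(\<integral>\<^sup>+y. f y \<partial>mult_smear kernel ?\<nu>) = (\<integral>\<^sup>+y. ennreal y * (\<integral>\<^sup>+r. f (y * r) \<partial>kernel) \<partial>?\<nu>)"
    by (rule nn_integral_mult_smear) simp_all
  also have "\<dots> = (\<integral>\<^sup>+x. ennreal (x powr (- \<alpha>)) * (\<integral>\<^sup>+r. f (x powr (- \<alpha>) * r) \<partial>kernel) \<partial>R)"
    by (rule nn_integral_distr) measurable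
  also have "\<dots> = (\<integral>\<^sup>+x. ennreal \<alpha> * coag_flux h x \<partial>R)"
    by (rule nn_integral_cong_AE, rule eventually_mono[OF pos], rule coag_flux_eq_kernel[symmetric]) (simp_all add: hf)
  also have "\<dots> = ennreal \<alpha> * (\<integral>\<^sup>+x. coag_flux h x \<partial>R)"
    by (rule nn_integral_cmult) (rule R.measurable_finite_borel, measurable)
  finally show "(\<integral>\<^sup>+y. f y \<partial>mult_smear kernel ?\<nu>) = ennreal \<alpha> * (\<integral>\<^sup>+x. coag_flux h x \<partial>R)" .
qed

text \<open>The relation h(x) x = f(y) at y = \<open>x powr (- \<alpha>)\<close> matches the two
  classes of test functions: an indicator f comes from h(x) = f(y) / x, and a given h yields f by
  inverting the power. The division by x is where strict positivity enters.\<close>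

lemma flux_identity_iff_fixed_point:
  assumes R: "real_distribution R" and pos: "AE x in R. 0 < x"
  shows "flux_identity R \<longleftrightarrow> mult_smear kernel (distr R borel (\<lambda>x. x powr (- \<alpha>))) = distr R borel (\<lambda>x. x powr (- \<alpha>))"
    (is "_ \<longleftrightarrow> mult_smear kernel ?\<nu> = ?\<nu>")
proof
  assume flux: "flux_identity R"
  show "mult_smear kernel ?\<nu> = ?\<nu>"
  proof (rule measure_eqI)
    fix A assume "A \<in> sets (mult_smear kernel ?\<nu>)"
    then have [measurable]: "A \<in> sets borel" by simp
    let ?f = "indicator A :: real \<Rightarrow> ennreal"
    let ?h = "\<lambda>x. ?f (x powr (- \<alpha>)) * ennreal (1 / x)"
    have [measurable]: "?h \<in> borel_measurable borel" by measurable
    have hf: "?h x * ennreal x = ?f (x powr (- \<alpha>))" if "0 < x" for x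
      using that by (simp add: mult.assoc flip: ennreal_mult')
    have "(\<integral>\<^sup>+y. ?f y \<partial>mult_smear kernel ?\<nu>) = (\<integral>\<^sup>+y. ?f y \<partial>?\<nu>)"
      using flux nn_integral_smear_distr_powr[OF R pos _ _ hf] unfolding flux_identity_def by simp
    then show "emeasure (mult_smear kernel ?\<nu>) A = emeasure ?\<nu> A" by simp
  qed simp
next
  assume fixed: "mult_smear kernel ?\<nu> = ?\<nu>"
  show "flux_identity R"
    unfolding flux_identity_def
  proof
    fix h :: "real \<Rightarrow> ennreal" assume [measurable]: "h \<in> borel_measurable borel"
    let ?f = "\<lambda>y. h (y powr (- (1 / \<alpha>))) * ennreal (y powr (- (1 / \<alpha>)))"
    have [measurable]: "?f \<in> borel_measurable borel" by measurable
    have hf: "h x * ennreal x = ?f (x powr (- \<alpha>))" if "0 < x" for x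
      using that by (simp add: powr_powr)
    show "(\<integral>\<^sup>+x. h x * ennreal x \<partial>R) = ennreal \<alpha> * (\<integral>\<^sup>+x. coag_flux h x \<partial>R)"
      using nn_integral_smear_distr_powr[OF R pos _ _ hf] fixed by simp
  qed
qed

end

section \<open>Bounded integrands with compact support\<close>

definition increment :: "(real \<Rightarrow> real) \<Rightarrow> real \<Rightarrow> real \<Rightarrow> real" where
  "increment h x e = (LINT w|lborel. (if 0 < w \<and> w < e then h (x + w) else 0))"

text \<open>What is kept of the derivative of a test function. No continuity is asked, so the class
  contains the positive and negative parts of its members and allows extension by 0 to the left of
  the origin.\<close>

locale cutoff_function =
  fixes h :: "real \<Rightarrow> real" and C M :: real
  assumes h_meas[measurable]: "h \<in> borel_measurable borel"
    and h_bound: "\<And>x. \<bar>h x\<bar> \<le> C" and M_pos: "0 < M" and h_cutoff: "\<And>x. M \<le> x \<Longrightarrow> h x = 0"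
begin

lemma C_nonneg: "0 \<le> C"
  using h_bound[of 0] by linarith

lemma increment_integrand_bound:
  assumes "0 \<le> x"
  shows "\<bar>if 0 < w \<and> w < e then h (x + w) else 0\<bar> \<le> C * indicator {0<..<min e M} w"
proof -
  have "h (x + w) = 0" if "M \<le> w" using that assms by (intro h_cutoff) simp
  then show ?thesis using h_bound[of "x + w"] C_nonneg by (auto simp: indicator_def not_less)
qed

lemma integrable_increment_bound: "integrable lborel (\<lambda>w. C * indicator {0<..<min e M} w)"
proof -
  have "emeasure lborel {0<..<b} < \<infinity>" for b :: real by (cases "0 \<le> b") auto
  then show ?thesis by (intro integrable_mult_right) (simp add: integrable_indicator_iff)
qed

lemma integrable_increment:
  assumes "0 \<le> x"
  shows "integrable lborel (\<lambda>w. if 0 < w \<and> w < e then h (x + w) else 0)"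
proof (rule Bochner_Integration.integrable_bound)
  show "integrable lborel (\<lambda>w. C * indicator {0<..<min e M} w)"
    by (rule integrable_increment_bound)
  show "AE w in lborel. norm (if 0 < w \<and> w < e then h (x + w) else 0) \<le> norm (C * indicator {0<..<min e M} w)"
    using increment_integrand_bound[OF assms] C_nonneg by (intro AE_I2) (simp add: abs_mult)
qed measurable

text \<open>The length e tames the singularity of the rate at small jumps; the cap M bounds the
  increment for large ones.\<close>

lemma abs_increment_le:
  assumes "0 \<le> x" "0 < e"
  shows "\<bar>increment h x e\<bar> \<le> C * min e M"
proof -
  have "\<bar>increment h x e\<bar> \<le> (LINT w|lborel. C * indicator {0<..<min e M} w)"
    unfolding increment_def
    using Bochner_Integration.integral_norm_bound_integral[OF integrable_increment[OF assms(1), of e] integrable_increment_bound[of e]]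
      increment_integrand_bound[OF assms(1)]
    by (simp only: real_norm_def)
  also have "\<dots> = C * min e M" using assms M_pos by simp
  finally show ?thesis .
qed

lemma increment_eq_0: "0 \<le> x \<Longrightarrow> M \<le> x \<Longrightarrow> increment h x e = 0"
proof -
  assume "M \<le> x"
  then have "(if 0 < w \<and> w < e then h (x + w) else 0) = 0" for w
    using h_cutoff[of "x + w"] by simp
  then show ?thesis unfolding increment_def by simp
qed

lemma increment_measurable[measurable]:
  "(\<lambda>z. increment h (fst z) (snd z)) \<in> borel_measurable (borel \<Otimes>\<^sub>M borel)"
  unfolding increment_def by measurable

end

context coag_exponent begin

definition rate_increment :: "(real \<Rightarrow> real) \<Rightarrow> real \<Rightarrow> real" where
  "rate_increment h x = (LINT e:{0<..}|lborel. coag_rate \<sigma> x e * increment h x e)"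

text \<open>Uniform in x because the increment vanishes once x \<ge> M, so
  \<open>x powr (1/3)\<close> may be replaced by its value at M. The exponents 1 and 0 for small and
  large jumps satisfy 1 > \<sigma> - 1 and 0 < \<alpha>.\<close>

lemma rate_increment_bound:
  assumes "cutoff_function h C M"
  obtains D where "0 \<le> D"
    "\<And>x. 0 \<le> x \<Longrightarrow> (\<integral>\<^sup>+e. ennreal (coag_rate \<sigma> x e * \<bar>increment h x e\<bar>) * indicator {0<..} e \<partial>lborel) \<le> ennreal D"
proof -
  interpret cutoff_function h C M by fact
  let ?K = "(1 + M powr (1/3))\<^sup>2 * (C * (1 + M))"
  let ?I = "\<integral>\<^sup>+e. ennreal (coag_rate \<sigma> 1 e * split_powr 1 0 e) * indicator {0<..} e \<partial>lborel"
  have K: "0 \<le> ?K" using C_nonneg M_pos by simp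
  have I: "?I < \<infinity>" using \<sigma>_lt by (intro nn_integral_rate_split_powr) auto
  have "(\<integral>\<^sup>+e. ennreal (coag_rate \<sigma> x e * \<bar>increment h x e\<bar>) * indicator {0<..} e \<partial>lborel) \<le> ennreal ?K * ?I"
    if x: "0 \<le> x" for x
  proof -
    have "(\<integral>\<^sup>+e. ennreal (coag_rate \<sigma> x e * \<bar>increment h x e\<bar>) * indicator {0<..} e \<partial>lborel)
      \<le> (\<integral>\<^sup>+e. ennreal ?K * (ennreal (coag_rate \<sigma> 1 e * split_powr 1 0 e) * indicator {0<..} e) \<partial>lborel)"
    proof (rule nn_integral_mono)
      fix e :: real
      show "ennreal (coag_rate \<sigma> x e * \<bar>increment h x e\<bar>) * indicator {0<..} e
        \<le> ennreal ?K * (ennreal (coag_rate \<sigma> 1 e * split_powr 1 0 e) * indicator {0<..} e)"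
      proof (cases "0 < e \<and> x \<le> M")
        case True
        have "coag_rate \<sigma> x e \<le> (1 + x powr (1/3))\<^sup>2 * coag_rate \<sigma> 1 e" by (rule coag_rate_le)
        also have "\<dots> \<le> (1 + M powr (1/3))\<^sup>2 * coag_rate \<sigma> 1 e"
          using True x by (intro mult_right_mono power_mono add_left_mono powr_mono2) auto
        finally have 1: "coag_rate \<sigma> x e \<le> (1 + M powr (1/3))\<^sup>2 * coag_rate \<sigma> 1 e" .
        have "min e M \<le> (1 + M) * split_powr 1 0 e"
        proof (cases "e \<le> 1")
          case e: True
          have "min e M \<le> e" by simp
          also have "\<dots> \<le> (1 + M) * e" using True M_pos by (simp add: algebra_simps)
          finally show ?thesis using e True by (simp add: split_powr_def)
        qed (use True M_pos in \<open>simp add: split_powr_def min_def\<close>)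
        then have "C * min e M \<le> C * ((1 + M) * split_powr 1 0 e)"
          using C_nonneg by (rule mult_left_mono)
        then have 2: "\<bar>increment h x e\<bar> \<le> C * (1 + M) * split_powr 1 0 e"
          using abs_increment_le[OF x, of e] True by simp
        have "coag_rate \<sigma> x e * \<bar>increment h x e\<bar>
            \<le> ((1 + M powr (1/3))\<^sup>2 * coag_rate \<sigma> 1 e) * (C * (1 + M) * split_powr 1 0 e)"
          by (rule mult_mono[OF 1 2]) simp_all
        also have "\<dots> = ?K * (coag_rate \<sigma> 1 e * split_powr 1 0 e)" by (simp only: ac_simps)
        finally have "ennreal (coag_rate \<sigma> x e * \<bar>increment h x e\<bar>) \<le> ennreal ?K * ennreal (coag_rate \<sigma> 1 e * split_powr 1 0 e)"
          by (subst ennreal_mult'[OF K, symmetric]) (rule ennreal_leI)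
        then show ?thesis using True by simp
      next
        case False
        then show ?thesis using increment_eq_0[OF x, of e] by auto
      qed
    qed
    also have "\<dots> = ennreal ?K * ?I" by (rule nn_integral_cmult) measurable
    finally show ?thesis .
  qed
  moreover have "ennreal ?K * ?I = ennreal (?K * enn2real ?I)"
    using I K by (simp add: ennreal_mult')
  ultimately show ?thesis using K by (intro that[of "?K * enn2real ?I"]) simp_all
qed

lemma set_integrable_rate_increment:
  assumes "cutoff_function h C M" and x: "0 \<le> x"
  shows "set_integrable lborel {0<..} (\<lambda>e. coag_rate \<sigma> x e * increment h x e)"
proof -
  interpret cutoff_function h C M by fact
  obtain D where D: "\<And>x. 0 \<le> x \<Longrightarrow> (\<integral>\<^sup>+e. ennreal (coag_rate \<sigma> x e * \<bar>increment h x e\<bar>) * indicator {0<..} e \<partial>lborel) \<le> ennreal D"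
    using rate_increment_bound[OF assms(1)] by blast
  have [measurable]: "increment h x \<in> borel_measurable borel"
    using measurable_compose[OF measurable_Pair1'[of x borel borel] increment_measurable] by simp
  show ?thesis
    unfolding set_integrable_def
  proof (rule integrableI_bounded)
    have "(\<integral>\<^sup>+e. norm (indicator {0<..} e *\<^sub>R (coag_rate \<sigma> x e * increment h x e)) \<partial>lborel)
      = (\<integral>\<^sup>+e. ennreal (coag_rate \<sigma> x e * \<bar>increment h x e\<bar>) * indicator {0<..} e \<partial>lborel)"
      by (intro nn_integral_cong) (auto simp: indicator_def abs_mult)
    also have "\<dots> \<le> ennreal D" by (rule D[OF x])
    also have "\<dots> < \<infinity>" by simp
    finally show "(\<integral>\<^sup>+e. norm (indicator {0<..} e *\<^sub>R (coag_rate \<sigma> x e * increment h x e)) \<partial>lborel) < \<infinity>" .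
  qed measurable
qed

lemma ennreal_rate_increment:
  assumes h: "cutoff_function h C M" and nonneg: "\<And>x. 0 \<le> h x" and x: "0 \<le> x"
  shows "0 \<le> rate_increment h x" "ennreal (rate_increment h x) = coag_flux (\<lambda>x. ennreal (h x)) x"
proof -
  interpret cutoff_function h C M by fact
  have inc_nonneg: "0 \<le> increment h x e" for e
    unfolding increment_def using nonneg by (intro integral_nonneg_AE AE_I2) simp
  show "0 \<le> rate_increment h x"
    unfolding rate_increment_def set_lebesgue_integral_def
    using inc_nonneg by (intro integral_nonneg_AE AE_I2) simp
  have inc: "ennreal (increment h x e) = cut_integral (\<lambda>x. ennreal (h x)) x e" for e
  proof -
    have "ennreal (increment h x e) = (\<integral>\<^sup>+w. ennreal (if 0 < w \<and> w < e then h (x + w) else 0) \<partial>lborel)"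
      unfolding increment_def using nonneg
      by (intro nn_integral_eq_integral[symmetric] integrable_increment x AE_I2) simp
    also have "\<dots> = cut_integral (\<lambda>x. ennreal (h x)) x e"
      by (intro nn_integral_cong) simp
    finally show ?thesis .
  qed
  have "ennreal (rate_increment h x) = (\<integral>\<^sup>+e. ennreal (indicator {0<..} e *\<^sub>R (coag_rate \<sigma> x e * increment h x e)) \<partial>lborel)"
    unfolding rate_increment_def set_lebesgue_integral_def
    using inc_nonneg set_integrable_rate_increment[OF h x] unfolding set_integrable_def
    by (intro nn_integral_eq_integral[symmetric] AE_I2) simp_all
  also have "\<dots> = coag_flux (\<lambda>x. ennreal (h x)) x"
    unfolding coag_flux_def inc[symmetric]
    by (intro nn_integral_cong) (simp add: indicator_def ennreal_mult')
  finally show "ennreal (rate_increment h x) = coag_flux (\<lambda>x. ennreal (h x)) x" .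
qed

lemma rate_increment_measurable:
  assumes "cutoff_function h C M"
  shows "rate_increment h \<in> borel_measurable borel"
proof -
  interpret cutoff_function h C M by fact
  have "(\<lambda>z. indicator {0<..} (snd z) *\<^sub>R (coag_rate \<sigma> (fst z) (snd z) * increment h (fst z) (snd z))) \<in> borel_measurable (borel \<Otimes>\<^sub>M lborel)"
    by measurable
  then have "(\<lambda>x. LINT e|lborel. indicator {0<..} (snd (x, e)) *\<^sub>R (coag_rate \<sigma> (fst (x, e)) (snd (x, e)) * increment h (fst (x, e)) (snd (x, e)))) \<in> borel_measurable borel"
    by (intro lborel.borel_measurable_lebesgue_integral) (simp add: split_beta')
  then show ?thesis by (simp add: rate_increment_def[abs_def] set_lebesgue_integral_def)
qed

context
  fixes R :: "real measure"
  assumes R: "real_distribution R" and R_nonneg: "AE x in R. 0 \<le> x"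
begin

lemma integrable_rate_increment_R:
  assumes h: "cutoff_function h C M" and nonneg: "\<And>x. 0 \<le> h x"
  shows "integrable R (rate_increment h)"
    "(\<integral>\<^sup>+x. coag_flux (\<lambda>x. ennreal (h x)) x \<partial>R) = ennreal (LINT x|R. rate_increment h x)"
proof -
  interpret R: real_distribution R by (rule R)
  interpret cutoff_function h C M by fact
  obtain D where D: "0 \<le> D" "\<And>x. 0 \<le> x \<Longrightarrow> (\<integral>\<^sup>+e. ennreal (coag_rate \<sigma> x e * \<bar>increment h x e\<bar>) * indicator {0<..} e \<partial>lborel) \<le> ennreal D"
    using rate_increment_bound[OF h] by blast
  have le: "rate_increment h x \<le> D" if "0 \<le> x" for x
  proof -
    have "ennreal (norm (rate_increment h x)) \<le> (\<integral>\<^sup>+e. norm (indicator {0<..} e *\<^sub>R (coag_rate \<sigma> x e * increment h x e)) \<partial>lborel)"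
      using set_integrable_rate_increment[OF h that]
      unfolding rate_increment_def set_lebesgue_integral_def set_integrable_def by (rule integral_norm_bound_ennreal)
    also have "\<dots> = (\<integral>\<^sup>+e. ennreal (coag_rate \<sigma> x e * \<bar>increment h x e\<bar>) * indicator {0<..} e \<partial>lborel)"
      by (intro nn_integral_cong) (auto simp: indicator_def abs_mult)
    also have "\<dots> \<le> ennreal D" by (rule D(2)[OF that])
    finally show ?thesis using D(1) by simp
  qed
  show int: "integrable R (rate_increment h)"
  proof (rule R.integrable_const_bound[where B=D])
    show "AE x in R. norm (rate_increment h x) \<le> D"
      using R_nonneg by eventually_elim (use le ennreal_rate_increment(1)[OF h nonneg] in simp)
    show "rate_increment h \<in> borel_measurable R"
      by (rule R.measurable_finite_borel[OF rate_increment_measurable[OF h]])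
  qed
  have "(\<integral>\<^sup>+x. coag_flux (\<lambda>x. ennreal (h x)) x \<partial>R) = (\<integral>\<^sup>+x. ennreal (rate_increment h x) \<partial>R)"
    by (rule nn_integral_cong_AE, rule eventually_mono[OF R_nonneg]) (simp add: ennreal_rate_increment(2)[OF h nonneg])
  also have "\<dots> = ennreal (LINT x|R. rate_increment h x)"
    by (rule nn_integral_eq_integral[OF int], rule eventually_mono[OF R_nonneg]) (rule ennreal_rate_increment(1)[OF h nonneg])
  finally show "(\<integral>\<^sup>+x. coag_flux (\<lambda>x. ennreal (h x)) x \<partial>R) = ennreal (LINT x|R. rate_increment h x)" .
qed

lemma integrable_times_id_R:
  assumes h: "cutoff_function h C M"
  shows "integrable R (\<lambda>x. h x * x)"
proof -
  interpret R: real_distribution R by (rule R)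
  interpret cutoff_function h C M by fact
  show ?thesis
  proof (rule R.integrable_const_bound[where B="C * M"])
    show "AE x in R. norm (h x * x) \<le> C * M"
      using R_nonneg
    proof eventually_elim
      case (elim x)
      show ?case
      proof (cases "x \<le> M")
        case True
        then show ?thesis using elim h_bound[of x] C_nonneg by (auto simp: abs_mult intro!: mult_mono)
      next
        case False
        then show ?thesis using h_cutoff[of x] C_nonneg M_pos by simp
      qed
    qed
    show "(\<lambda>x. h x * x) \<in> borel_measurable R" by (rule R.measurable_finite_borel) measurable
  qed
qed

lemma nn_integral_times_id_R:
  assumes h: "cutoff_function h C M" and nonneg: "\<And>x. 0 \<le> h x"
  shows "(\<integral>\<^sup>+x. ennreal (h x) * ennreal x \<partial>R) = ennreal (LINT x|R. h x * x)"
proof -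
  have "(\<integral>\<^sup>+x. ennreal (h x) * ennreal x \<partial>R) = (\<integral>\<^sup>+x. ennreal (h x * x) \<partial>R)"
    using nonneg by (simp add: ennreal_mult')
  also have "\<dots> = ennreal (LINT x|R. h x * x)"
    by (rule nn_integral_eq_integral[OF integrable_times_id_R[OF h]], rule eventually_mono[OF R_nonneg]) (simp add: nonneg)
  finally show ?thesis .
qed

text \<open>Both integrals are finite, so the extended-valued identity and the real one are
  interchangeable; this is the bridge between the weak equation and arguments about
  measures.\<close>

lemma flux_identity_iff_real:
  assumes h: "cutoff_function h C M" and nonneg: "\<And>x. 0 \<le> h x"
  shows "(\<integral>\<^sup>+x. ennreal (h x) * ennreal x \<partial>R) = ennreal \<alpha> * (\<integral>\<^sup>+x. coag_flux (\<lambda>x. ennreal (h x)) x \<partial>R)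
    \<longleftrightarrow> (LINT x|R. h x * x) = \<alpha> * (LINT x|R. rate_increment h x)"
proof -
  have "0 \<le> (LINT x|R. h x * x)"
    by (rule integral_nonneg_AE, rule eventually_mono[OF R_nonneg]) (simp add: nonneg)
  moreover have "0 \<le> (LINT x|R. rate_increment h x)"
    by (rule integral_nonneg_AE, rule eventually_mono[OF R_nonneg]) (rule ennreal_rate_increment(1)[OF h nonneg])
  ultimately show ?thesis
    unfolding integrable_rate_increment_R(2)[OF h nonneg] nn_integral_times_id_R[OF h nonneg]
    by (simp flip: ennreal_mult')
qed

text \<open>The flux identity speaks of nonnegative functions; the positive and negative parts of h
  are cutoff functions as well, and their finite integrals may be subtracted.\<close>

lemma flux_identity_signed:
  assumes flux: "flux_identity R" and h: "cutoff_function h C M"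
  shows "(LINT x|R. h x * x) = \<alpha> * (LINT x|R. rate_increment h x)"
proof -
  interpret cutoff_function h C M by fact
  let ?p = "\<lambda>x. max (h x) 0" and ?n = "\<lambda>x. max (- h x) 0"
  have p: "cutoff_function ?p C M" and n: "cutoff_function ?n C M"
    using h_bound h_cutoff M_pos by (unfold_locales; force simp: abs_le_iff max_def intro: C_nonneg)+
  have flux': "(LINT x|R. g x * x) = \<alpha> * (LINT x|R. rate_increment g x)"
    if "cutoff_function g C M" "\<And>x. 0 \<le> g x" for g
  proof -
    interpret g: cutoff_function g C M by fact
    show ?thesis
      using flux flux_identity_iff_real[OF that] unfolding flux_identity_def by simp
  qed
  have inc: "increment h x e = increment ?p x e - increment ?n x e" if "0 \<le> x" for x e
    unfolding increment_def
    by (subst Bochner_Integration.integral_diff[symmetric])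
      (auto intro!: Bochner_Integration.integral_cong cutoff_function.integrable_increment[OF p that] cutoff_function.integrable_increment[OF n that])
  have ri: "rate_increment h x = rate_increment ?p x - rate_increment ?n x" if "0 \<le> x" for x
    unfolding rate_increment_def inc[OF that] right_diff_distrib
    by (rule set_integral_diff(2)[OF set_integrable_rate_increment[OF p that] set_integrable_rate_increment[OF n that]])
  have "(LINT x|R. rate_increment h x) = (LINT x|R. rate_increment ?p x - rate_increment ?n x)"
  proof (rule integral_cong_AE)
    interpret R: real_distribution R by (rule R)
    show "rate_increment h \<in> borel_measurable R" "(\<lambda>x. rate_increment ?p x - rate_increment ?n x) \<in> borel_measurable R"
      by (rule R.measurable_finite_borel, intro borel_measurable_diff rate_increment_measurable[OF h] rate_increment_measurable[OF p] rate_increment_measurable[OF n])+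
    show "AE x in R. rate_increment h x = rate_increment ?p x - rate_increment ?n x"
      using R_nonneg by eventually_elim (rule ri)
  qed
  also have "\<dots> = (LINT x|R. rate_increment ?p x) - (LINT x|R. rate_increment ?n x)"
    by (intro Bochner_Integration.integral_diff integrable_rate_increment_R[OF p] integrable_rate_increment_R[OF n]) simp_all
  finally have 1: "(LINT x|R. rate_increment h x) = \<dots>" .
  have "(LINT x|R. h x * x) = (LINT x|R. ?p x * x - ?n x * x)"
    by (intro Bochner_Integration.integral_cong) (auto simp: max_def)
  also have "\<dots> = (LINT x|R. ?p x * x) - (LINT x|R. ?n x * x)"
    by (intro Bochner_Integration.integral_diff integrable_times_id_R[OF p] integrable_times_id_R[OF n])
  finally show ?thesis unfolding 1 using flux'[OF p] flux'[OF n] by (simp add: right_diff_distrib)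
qed

end

end

section \<open>Test functions\<close>

lemma at_within_atLeast_neq_bot: "(a::real) \<le> x \<Longrightarrow> at x within {a..} \<noteq> bot"
proof
  assume "a \<le> x" and bot: "at x within {a..} = bot"
  have "at_right x \<le> at x within {a..}" using \<open>a \<le> x\<close> by (intro at_le) auto
  then show False using bot trivial_limit_at_right_real[of x] by (simp add: bot_unique)
qed

text \<open>A single term of the series for \<open>exp (c * u)\<close> is bounded by the whole
  series.\<close>

lemma power_times_exp_bounded:
  fixes c :: real
  assumes "0 < c"
  shows "\<exists>K. \<forall>u\<ge>0. u ^ n * exp (- c * u) \<le> K"
proof -
  have "u ^ n * exp (- c * u) \<le> fact n / c ^ n" if "0 \<le> u" for u
  proof -
    have "(\<Sum>k\<in>{n}. (c * u) ^ k /\<^sub>R fact k) \<le> (\<Sum>k. (c * u) ^ k /\<^sub>R fact k)"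
      using assms that by (intro sum_le_suminf summable_exp_generic) auto
    then have "(c * u) ^ n / fact n \<le> exp (c * u)" by (simp add: exp_def divide_inverse mult.commute)
    then have "u ^ n \<le> fact n / c ^ n * exp (c * u)"
      using assms by (simp add: power_mult_distrib field_simps)
    then have "u ^ n * exp (- c * u) \<le> fact n / c ^ n * exp (c * u) * exp (- c * u)"
      by (rule mult_right_mono) simp
    also have "\<dots> = fact n / c ^ n" by (simp flip: exp_add)
    finally show ?thesis .
  qed
  then show ?thesis by blast
qed

lemma poly_times_exp_bounded:
  fixes c :: real
  assumes "0 < c"
  shows "\<exists>K. \<forall>u\<ge>0. \<bar>poly p u\<bar> * u ^ n * exp (- c * u) \<le> K"
proof (induction p arbitrary: n)
  case 0
  show ?case by (rule exI[of _ 0]) simp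
next
  case (pCons a p)
  obtain K where K: "\<And>u. 0 \<le> u \<Longrightarrow> \<bar>poly p u\<bar> * u ^ Suc n * exp (- c * u) \<le> K"
    using pCons.IH by blast
  obtain L where L: "\<And>u. 0 \<le> u \<Longrightarrow> u ^ n * exp (- c * u) \<le> L"
    using power_times_exp_bounded[OF assms] by blast
  have "\<bar>poly (pCons a p) u\<bar> * u ^ n * exp (- c * u) \<le> \<bar>a\<bar> * L + K" if u: "0 \<le> u" for u
  proof -
    have "\<bar>poly (pCons a p) u\<bar> \<le> \<bar>a\<bar> + u * \<bar>poly p u\<bar>"
      using abs_triangle_ineq[of a "u * poly p u"] u by (simp add: abs_mult)
    then have "\<bar>poly (pCons a p) u\<bar> * (u ^ n * exp (- c * u)) \<le> (\<bar>a\<bar> + u * \<bar>poly p u\<bar>) * (u ^ n * exp (- c * u))"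
      using u by (intro mult_right_mono) auto
    also have "\<dots> = \<bar>a\<bar> * (u ^ n * exp (- c * u)) + \<bar>poly p u\<bar> * u ^ Suc n * exp (- c * u)"
      by (simp add: algebra_simps)
    also have "\<dots> \<le> \<bar>a\<bar> * L + K" by (intro add_mono mult_left_mono L K u) simp
    finally show ?thesis by (simp add: mult.assoc)
  qed
  then show ?case by blast
qed

lemma has_real_derivative_0_of_quadratic_bound:
  fixes f :: "real \<Rightarrow> real"
  assumes "\<And>y. \<bar>f y\<bar> \<le> K * (y - b)\<^sup>2"
  shows "(f has_real_derivative 0) (at b)"
proof -
  have fb: "f b = 0" using assms[of b] by simp
  have "((\<lambda>k. (f (b + k) - f b) / k) \<longlongrightarrow> 0) (at 0)"
  proof (rule Lim_null_comparison)
    show "\<forall>\<^sub>F k in at 0. norm ((f (b + k) - f b) / k) \<le> K * \<bar>k\<bar>"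
    proof (rule eventually_mono)
      show "\<forall>\<^sub>F k::real in at 0. k \<noteq> 0" by (simp add: eventually_at_filter)
      fix k :: real assume "k \<noteq> 0"
      have "\<bar>f (b + k)\<bar> \<le> (K * \<bar>k\<bar>) * \<bar>k\<bar>"
        using assms[of "b + k"] by (simp add: power2_eq_square mult.assoc)
      then show "norm ((f (b + k) - f b) / k) \<le> K * \<bar>k\<bar>"
        using \<open>k \<noteq> 0\<close> by (simp add: fb pos_divide_le_eq)
    qed
    show "((\<lambda>k. K * \<bar>k\<bar>) \<longlongrightarrow> 0) (at 0)" by (auto intro!: tendsto_eq_intros)
  qed
  then show ?thesis by (simp add: DERIV_def)
qed

text \<open>As \<open>c\<close> decreases to \<open>0\<close>, \<open>bump_poly b c 1\<close> increases to the indicator of \<open>{..<b}\<close>; the other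
  polynomials are needed for the higher derivatives.\<close>
definition bump_poly :: "real \<Rightarrow> real \<Rightarrow> real poly \<Rightarrow> real \<Rightarrow> real" where
  "bump_poly b c p x = (if x < b then poly p (1 / (b - x)) * exp (- c * (1 / (b - x))) else 0)"

text \<open>With u = 1 / (b - x) one has du/dx = \<open>u\<^sup>2\<close>, whence the factor
  \<open>[:0, 0, 1:]\<close>, and the exponential turns p' into p' - c p. At x = b the exponential
  dominates every polynomial in u, so the function is of order \<open>(b - x)\<^sup>2\<close> and
  its derivative there is 0.\<close>

lemma bump_poly_deriv:
  assumes "0 < c"
  shows "(bump_poly b c p has_real_derivative bump_poly b c ([:0, 0, 1:] * (pderiv p - smult c p)) x) (at x)"
proof -
  consider "x < b" | "x = b" | "b < x" by linarith
  then show ?thesis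
  proof cases
    case 1
    have "((\<lambda>x. poly p (1 / (b - x)) * exp (- c * (1 / (b - x)))) has_real_derivative
        bump_poly b c ([:0, 0, 1:] * (pderiv p - smult c p)) x) (at x)"
    proof -
      have u: "((\<lambda>x. 1 / (b - x)) has_real_derivative (1 / (b - x))\<^sup>2) (at x)"
        using 1 by (auto intro!: derivative_eq_intros simp: power2_eq_square)
      have "((\<lambda>u. poly p u * exp (- c * u)) has_real_derivative (poly (pderiv p) u - c * poly p u) * exp (- c * u)) (at u)" for u
        by (auto intro!: derivative_eq_intros simp: algebra_simps)
      from DERIV_chain2[OF this u] show ?thesis
        using 1 by (simp add: bump_poly_def power2_eq_square algebra_simps)
    qed
    moreover have "\<forall>\<^sub>F y in nhds x. poly p (1 / (b - y)) * exp (- c * (1 / (b - y))) = bump_poly b c p y"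
      using eventually_nhds_in_open[of "{..<b}" x] 1 by (auto elim!: eventually_mono simp: bump_poly_def)
    ultimately show ?thesis by (rule DERIV_cong_ev[THEN iffD1, OF refl _ refl, rotated])
  next
    case 2
    obtain K where K: "\<And>u. 0 \<le> u \<Longrightarrow> \<bar>poly p u\<bar> * u ^ 2 * exp (- c * u) \<le> K"
      using poly_times_exp_bounded[OF assms] by blast
    have "0 \<le> K" using K[of 0] by simp
    have "(bump_poly b c p has_real_derivative 0) (at b)"
    proof (rule has_real_derivative_0_of_quadratic_bound)
      fix y
      show "\<bar>bump_poly b c p y\<bar> \<le> K * (y - b)\<^sup>2"
      proof (cases "y < b")
        case True
        then have "\<bar>bump_poly b c p y\<bar> * (1 / (b - y))\<^sup>2 \<le> K"
          using K[of "1 / (b - y)"] by (simp add: bump_poly_def abs_mult ac_simps)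
        moreover have "0 < (b - y)\<^sup>2" using True by simp
        ultimately have "\<bar>bump_poly b c p y\<bar> \<le> K * (b - y)\<^sup>2"
          by (simp add: power_divide field_simps)
        then show ?thesis by (simp add: power2_commute)
      qed (use \<open>0 \<le> K\<close> in \<open>simp add: bump_poly_def\<close>)
    qed
    then show ?thesis using 2 by (simp add: bump_poly_def)
  next
    case 3
    have "\<forall>\<^sub>F y in nhds x. 0 = bump_poly b c p y"
      using eventually_nhds_in_open[of "{b<..}" x] 3 by (auto elim!: eventually_mono simp: bump_poly_def)
    moreover have "((\<lambda>_. 0) has_real_derivative bump_poly b c ([:0, 0, 1:] * (pderiv p - smult c p)) x) (at x)"
      using 3 by (simp add: bump_poly_def)
    ultimately show ?thesis by (rule DERIV_cong_ev[THEN iffD1, OF refl _ refl])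
  qed
qed

lemma bump_poly_continuous: "0 < c \<Longrightarrow> continuous_on S (bump_poly b c p)"
  by (rule DERIV_continuous_on[OF has_field_derivative_at_within[OF bump_poly_deriv]])

locale bump_test =
  fixes b c :: real
  assumes b_pos: "0 < b" and c_pos: "0 < c"
begin

abbreviation bump :: "real \<Rightarrow> real" where "bump \<equiv> bump_poly b c 1"

text \<open>Starting the integral at -1 makes 0 an interior point, so that the derivative there is
  two-sided; the additive constant cancels in the weak equation.\<close>

definition bump_primitive :: "real \<Rightarrow> real" where
  "bump_primitive x = integral {-1..x} bump"

text \<open>Cutting at b before the conversion matters: \<open>enn2real \<infinity>\<close> is 0,
  whereas the value at infinity must be the one attained from b on.\<close>

definition test_fun :: "ennreal \<Rightarrow> real" where
  "test_fun \<xi> = bump_primitive (enn2real (min \<xi> (ennreal b)))"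

lemma bump_primitive_deriv:
  assumes "-1 < x"
  shows "(bump_primitive has_real_derivative bump x) (at x)"
proof -
  have "((\<lambda>x. integral {-1..x} bump) has_real_derivative bump x) (at x within {-1..x+1})"
    using assms by (intro integral_has_real_derivative bump_poly_continuous c_pos) auto
  moreover have "at x within {-1..x+1} = at x"
    using assms by (intro at_within_interior) simp
  ultimately show ?thesis by (simp add: bump_primitive_def[abs_def])
qed

lemma bump_primitive_const:
  assumes "b \<le> x"
  shows "bump_primitive x = bump_primitive b"
proof -
  have int: "bump integrable_on {-1..x}"
    by (rule integrable_continuous_real[OF bump_poly_continuous[OF c_pos]])
  have "integral {-1..b} bump + integral {b..x} bump = integral {-1..x} bump"
    by (rule Henstock_Kurzweil_Integration.integral_combine[OF _ assms int]) (use b_pos in simp)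
  moreover have "integral {b..x} bump = integral {b..x} (\<lambda>_. 0)"
    by (rule Henstock_Kurzweil_Integration.integral_cong) (simp add: bump_poly_def)
  ultimately show ?thesis by (simp add: bump_primitive_def)
qed

lemma finite_part_test_fun:
  assumes "0 \<le> x"
  shows "finite_part test_fun x = bump_primitive x"
proof (cases "x \<le> b")
  case True
  then have "min (ennreal x) (ennreal b) = ennreal x" by (intro min_absorb1 ennreal_leI)
  then show ?thesis using assms by (simp add: finite_part_def test_fun_def)
next
  case False
  then have "min (ennreal x) (ennreal b) = ennreal b" by (intro min_absorb2 ennreal_leI) simp
  moreover have "bump_primitive x = bump_primitive b" using False by (intro bump_primitive_const) simp
  ultimately show ?thesis using b_pos by (simp add: finite_part_def test_fun_def)
qed

lemma finite_part_test_fun_deriv: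
  assumes "0 \<le> x"
  shows "(finite_part test_fun has_real_derivative bump x) (at x within {0..})"
proof -
  have "-1 < x" using assms by simp
  note d = has_field_derivative_at_within[OF bump_primitive_deriv[OF this], of "{0..}"]
  show ?thesis
    unfolding has_field_derivative_def
  proof (rule has_derivative_transform)
    show "(bump_primitive has_derivative (*) (bump x)) (at x within {0..})"
      using d unfolding has_field_derivative_def .
    show "x \<in> {0..}" using assms by simp
    show "finite_part test_fun y = bump_primitive y" if "y \<in> {0..}" for y
      using that by (intro finite_part_test_fun) simp
  qed
qed

lemma test_fun_continuous: "continuous_on UNIV test_fun"
  unfolding continuous_on_def
proof
  fix \<xi> :: ennreal
  have "min \<xi> (ennreal b) \<le> ennreal b" by (rule min.cobounded2)
  then have "min \<xi> (ennreal b) \<noteq> \<infinity>" by (metis ennreal_neq_top infinity_ennreal_def top_unique)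
  then obtain x where x: "0 \<le> x" "min \<xi> (ennreal b) = ennreal x"
    by (cases "min \<xi> (ennreal b)") auto
  have "((\<lambda>z. min z (ennreal b)) \<longlongrightarrow> min \<xi> (ennreal b)) (at \<xi>)"
    by (intro tendsto_min tendsto_ident_at tendsto_const)
  then have "((\<lambda>z. enn2real (min z (ennreal b))) \<longlongrightarrow> x) (at \<xi>)"
    using x by (intro tendsto_enn2real) auto
  moreover have "isCont bump_primitive x"
    using bump_primitive_deriv[of x] x by (intro DERIV_isCont) simp
  ultimately have "((\<lambda>z. bump_primitive (enn2real (min z (ennreal b)))) \<longlongrightarrow> bump_primitive x) (at \<xi>)"
    by (rule isCont_tendsto_compose[rotated])
  then show "(test_fun \<longlongrightarrow> test_fun \<xi>) (at \<xi>)"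
    using x by (simp add: test_fun_def[abs_def])
qed

text \<open>The functions \<open>bump_poly b c p\<close>, together with the finite part of the test
  function, are closed under differentiation, and each is constant from b on; this gives smoothness
  as well as the limits of all derivatives.\<close>

lemma test_fun_mem: "test_fun \<in> C_inf_closed \<inter> X_space"
proof
  let ?\<F> = "insert (finite_part test_fun) (range (bump_poly b c))"
  have S: "at x within {0..} \<noteq> bot" if "x \<in> {0..}" for x :: real
    using that by (intro at_within_atLeast_neq_bot) simp
  have closed: "\<exists>f'\<in>?\<F>. \<forall>x\<in>{0..}. (f has_real_derivative f' x) (at x within {0..})" if "f \<in> ?\<F>" for f
    using that
  proof
    assume "f = finite_part test_fun"
    then show ?thesis using finite_part_test_fun_deriv by (intro bexI[of _ bump]) auto
  next
    assume "f \<in> range (bump_poly b c)"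
    then obtain p where f: "f = bump_poly b c p" by blast
    show ?thesis
      unfolding f
    proof (rule bexI[of _ "bump_poly b c ([:0, 0, 1:] * (pderiv p - smult c p))"], rule ballI)
      show "(bump_poly b c p has_real_derivative bump_poly b c ([:0, 0, 1:] * (pderiv p - smult c p)) x) (at x within {0..})" for x
        by (rule has_field_derivative_at_within[OF bump_poly_deriv[OF c_pos]])
    qed (intro insertI2 rangeI)
  qed
  have "\<exists>L. ((deriv_within {0..} ^^ k) (finite_part test_fun) \<longlongrightarrow> L) at_top" for k
  proof -
    have "\<exists>g\<in>?\<F>. \<forall>x\<in>{0..}. (deriv_within {0..} ^^ k) (finite_part test_fun) x = g x"
      by (rule iterated_deriv_within_mem[OF S closed insertI1])
    then obtain g where g: "g \<in> ?\<F>" "\<forall>x\<in>{0..}. (deriv_within {0..} ^^ k) (finite_part test_fun) x = g x" ..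
    have "\<exists>L. \<forall>x\<ge>b. g x = L"
      using g(1)
    proof
      assume "g = finite_part test_fun"
      then have "g x = bump_primitive b" if "b \<le> x" for x
        using that b_pos bump_primitive_const[OF that] by (simp add: finite_part_test_fun)
      then show ?thesis by blast
    qed (auto simp: bump_poly_def)
    then obtain L where L: "\<And>x. b \<le> x \<Longrightarrow> g x = L" by blast
    have "\<forall>\<^sub>F x in at_top. (deriv_within {0..} ^^ k) (finite_part test_fun) x = L"
    proof (intro eventually_mono[OF eventually_ge_at_top[of b]])
      fix x assume "b \<le> x"
      then have "x \<in> {0..}" using b_pos by simp
      then show "(deriv_within {0..} ^^ k) (finite_part test_fun) x = L"
        using g(2) L[OF \<open>b \<le> x\<close>] by metis
    qed
    then have "((deriv_within {0..} ^^ k) (finite_part test_fun) \<longlongrightarrow> L) at_top"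
      by (rule tendsto_eventually)
    then show ?thesis by blast
  qed
  then show "test_fun \<in> C_inf_closed"
    unfolding C_inf_closed_def
    using test_fun_continuous smooth_within_closed_family[OF S closed insertI1] by simp
  have "test_fun \<xi> = bump_primitive b" if "ennreal b \<le> \<xi>" for \<xi>
    using that b_pos by (simp add: test_fun_def min_absorb2)
  then have "test_fun \<in> X_const_from b"
    unfolding X_const_from_def using test_fun_continuous by blast
  then show "test_fun \<in> X_space"
    unfolding X_space_def using b_pos by blast
qed

lemma deriv_within_test_fun: "0 \<le> x \<Longrightarrow> deriv_within {0..} (finite_part test_fun) x = bump x"
  unfolding deriv_within_def
  using finite_part_test_fun_deriv[of x] at_within_atLeast_neq_bot[of 0 x]
  by (intro vector_derivative_within) (simp_all add: has_real_derivative_iff_has_vector_derivative)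

end

text \<open>Extension by 0 to the left of the origin gives a Borel function on the whole line for
  every admissible test function.\<close>

definition half_line_deriv :: "(ennreal \<Rightarrow> real) \<Rightarrow> real \<Rightarrow> real" where
  "half_line_deriv \<phi> x = indicator {0..} x *\<^sub>R deriv_within {0..} (finite_part \<phi>) x"

lemma test_function_deriv:
  assumes "\<phi> \<in> C_inf_closed" "0 \<le> x"
  shows "(finite_part \<phi> has_real_derivative half_line_deriv \<phi> x) (at x within {0..})"
proof -
  have "finite_part \<phi> differentiable at x within {0..}"
    using assms unfolding C_inf_closed_def smooth_within_def differentiable_on_def
    by (metis (mono_tags, lifting) atLeast_iff funpow_0 mem_Collect_eq)
  then show ?thesis
    using assms by (simp add: vector_derivative_works has_real_derivative_iff_has_vector_derivative half_line_deriv_def deriv_within_def)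
qed

lemma continuous_on_half_line_deriv:
  assumes "\<phi> \<in> C_inf_closed"
  shows "continuous_on {0..} (deriv_within {0..} (finite_part \<phi>))"
proof -
  have "(deriv_within {0..} ^^ 1) (finite_part \<phi>) differentiable_on {0..}"
    using assms unfolding C_inf_closed_def smooth_within_def by blast
  then show ?thesis by (simp add: differentiable_imp_continuous_on)
qed

lemma half_line_deriv_cutoff:
  assumes "\<phi> \<in> C_inf_closed \<inter> X_space"
  obtains C M where "cutoff_function (half_line_deriv \<phi>) C M"
proof -
  from assms obtain M k where M: "0 < M" and const: "\<And>\<xi>. ennreal M \<le> \<xi> \<Longrightarrow> \<phi> \<xi> = k"
    unfolding X_space_def X_const_from_def by blast
  have smooth: "\<phi> \<in> C_inf_closed" using assms by blast
  note cont = continuous_on_half_line_deriv[OF smooth]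
  \<comment> \<open>From M + 1 on, \<phi> is constant on a full neighbourhood of the point, so the
    derivative is that of a constant.\<close>
  have zero: "half_line_deriv \<phi> x = 0" if "M + 1 \<le> x" for x
  proof -
    have "(finite_part \<phi> has_real_derivative half_line_deriv \<phi> x) (at x)"
      using test_function_deriv[OF smooth, of x] that M at_within_interior[of x "{0..}"] by (simp add: interior_real_atLeast)
    moreover have "\<forall>\<^sub>F y in nhds x. finite_part \<phi> y = k"
      using eventually_nhds_in_open[of "{M<..}" x] that
      by (auto elim!: eventually_mono simp: finite_part_def intro!: const ennreal_leI)
    then have "(finite_part \<phi> has_real_derivative 0) (at x)"
      by (rule DERIV_cong_ev[OF refl _ refl, THEN iffD2]) (rule DERIV_const)
    ultimately show ?thesis by (rule DERIV_unique)
  qed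
  have "compact (deriv_within {0..} (finite_part \<phi>) ` {0..M+1})"
    by (intro compact_continuous_image continuous_on_subset[OF cont]) auto
  then obtain C where C: "\<And>x. x \<in> {0..M+1} \<Longrightarrow> \<bar>deriv_within {0..} (finite_part \<phi>) x\<bar> \<le> C"
    by (metis (no_types, lifting) bounded_iff compact_imp_bounded image_eqI real_norm_def)
  have "0 \<le> C" using C[of 0] M by force
  have "cutoff_function (half_line_deriv \<phi>) C (M + 1)"
  proof
    show "half_line_deriv \<phi> \<in> borel_measurable borel"
      unfolding half_line_deriv_def[abs_def]
      by (rule borel_measurable_continuous_on_indicator[OF _ cont]) simp
    show "\<bar>half_line_deriv \<phi> x\<bar> \<le> C" for x
    proof (cases "x \<in> {0..M+1}")
      case True
      then show ?thesis using C[OF True] by (simp add: half_line_deriv_def)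
    next
      case False
      then have "half_line_deriv \<phi> x = 0" using zero[of x] by (auto simp: half_line_deriv_def)
      then show ?thesis using \<open>0 \<le> C\<close> by simp
    qed
  qed (use M zero in auto)
  then show ?thesis by (rule that)
qed

lemma test_function_increment:
  assumes "\<phi> \<in> C_inf_closed" and x: "0 \<le> x" and e: "0 < e"
  shows "\<phi> (ennreal x + ennreal e) - \<phi> (ennreal x) = increment (half_line_deriv \<phi>) x e"
proof -
  let ?h = "half_line_deriv \<phi>"
  have "(LINT w|lborel. indicator {0..e} w *\<^sub>R ?h (x + w)) = finite_part \<phi> (x + e) - finite_part \<phi> (x + 0)"
  proof (rule integral_FTC_atLeastAtMost)
    fix w assume w: "0 \<le> w" "w \<le> e"
    have "(finite_part \<phi> has_vector_derivative ?h (x + w)) (at (x + w) within (\<lambda>w. x + w) ` {0..e})"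
      using test_function_deriv[OF assms(1), of "x + w"] x w
      by (auto simp: has_real_derivative_iff_has_vector_derivative intro: has_vector_derivative_within_subset)
    moreover have "((\<lambda>w. x + w) has_vector_derivative 1) (at w within {0..e})"
      by (auto intro!: derivative_eq_intros)
    ultimately show "((\<lambda>w. finite_part \<phi> (x + w)) has_vector_derivative ?h (x + w)) (at w within {0..e})"
      using vector_diff_chain_within[of "\<lambda>w. x + w" 1 w "{0..e}" "finite_part \<phi>" "?h (x + w)"] by (simp add: o_def)
  next
    have "continuous_on {0..e} (\<lambda>w. deriv_within {0..} (finite_part \<phi>) (x + w))"
      using x by (intro continuous_on_compose2[OF continuous_on_half_line_deriv[OF assms(1)]] continuous_intros) auto
    then show "continuous_on {0..e} (\<lambda>w. ?h (x + w))"
      by (rule continuous_on_eq) (use x in \<open>simp add: half_line_deriv_def\<close>)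
  qed (use e in simp)
  also have "(LINT w|lborel. indicator {0..e} w *\<^sub>R ?h (x + w)) = increment ?h x e"
    unfolding increment_def
  proof (rule integral_cong_AE)
    have [measurable]: "?h \<in> borel_measurable borel"
      unfolding half_line_deriv_def[abs_def]
      by (rule borel_measurable_continuous_on_indicator[OF _ continuous_on_half_line_deriv[OF assms(1)]]) simp
    show "(\<lambda>w. indicator {0..e} w *\<^sub>R ?h (x + w)) \<in> borel_measurable lborel"
      "(\<lambda>w. if 0 < w \<and> w < e then ?h (x + w) else 0) \<in> borel_measurable lborel" by measurable
    have "AE w in lborel. w \<noteq> 0 \<and> w \<noteq> e" by (intro AE_conjI AE_lborel_singleton)
    then show "AE w in lborel. indicator {0..e} w *\<^sub>R ?h (x + w) = (if 0 < w \<and> w < e then ?h (x + w) else 0)"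
      by eventually_elim (auto simp: indicator_def)
  qed
  finally show ?thesis using x e by (simp add: finite_part_def ennreal_plus)
qed

context coag_exponent begin

text \<open>Moves both sides of the weak equation from \<open>ennreal\<close> to the real line,
  where the difference of \<phi> is the integral of its derivative.\<close>

lemma profile_terms:
  assumes R: "real_distribution R" and nonneg: "AE x in R. 0 \<le> x" and \<phi>: "\<phi> \<in> C_inf_closed \<inter> X_space"
  shows "(LINT \<xi>|distr R borel ennreal. deriv_within {0..} (finite_part \<phi>) (enn2real \<xi>) * enn2real \<xi>) = (LINT x|R. half_line_deriv \<phi> x * x)"
    and "(LINT \<xi>|distr R borel ennreal. (LINT \<eta>:{0<..}|lborel.
        \<eta> powr (-\<sigma>) * (enn2real \<xi> powr (1/3) + \<eta> powr (1/3))\<^sup>2 * (\<phi> (\<xi> + ennreal \<eta>) - \<phi> \<xi>)))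
      = (LINT x|R. rate_increment (half_line_deriv \<phi>) x)"
proof -
  interpret R: real_distribution R by (rule R)
  let ?h = "half_line_deriv \<phi>"
  obtain C M where h: "cutoff_function ?h C M" using half_line_deriv_cutoff[OF \<phi>] .
  interpret cutoff_function ?h C M by (rule h)
  have [measurable]: "ennreal \<in> borel_measurable R" by (rule R.measurable_finite_borel) measurable
  have [measurable]: "\<phi> \<in> borel_measurable borel"
    using \<phi> by (intro borel_measurable_continuous_onI) (auto simp: C_inf_closed_def)
  have "(LINT \<xi>|distr R borel ennreal. deriv_within {0..} (finite_part \<phi>) (enn2real \<xi>) * enn2real \<xi>)
      = (LINT \<xi>|distr R borel ennreal. ?h (enn2real \<xi>) * enn2real \<xi>)"
    by (simp add: half_line_deriv_def)
  also have "\<dots> = (LINT x|R. ?h (enn2real (ennreal x)) * enn2real (ennreal x))"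
    by (rule integral_distr) measurable
  also have "\<dots> = (LINT x|R. ?h x * x)"
  proof (rule integral_cong_AE)
    show "AE x in R. ?h (enn2real (ennreal x)) * enn2real (ennreal x) = ?h x * x"
      using nonneg by eventually_elim simp
  qed (rule R.measurable_finite_borel, measurable)+
  finally show "(LINT \<xi>|distr R borel ennreal. deriv_within {0..} (finite_part \<phi>) (enn2real \<xi>) * enn2real \<xi>) = (LINT x|R. ?h x * x)" .
  let ?G = "\<lambda>\<xi>. LINT \<eta>:{0<..}|lborel. \<eta> powr (-\<sigma>) * (enn2real \<xi> powr (1/3) + \<eta> powr (1/3))\<^sup>2 * (\<phi> (\<xi> + ennreal \<eta>) - \<phi> \<xi>)"
  have "(\<lambda>z. indicator {0<..} (snd z) *\<^sub>R (snd z powr (-\<sigma>) * (enn2real (fst z) powr (1/3) + snd z powr (1/3))\<^sup>2 * (\<phi> (fst z + ennreal (snd z)) - \<phi> (fst z))))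
      \<in> borel_measurable (borel \<Otimes>\<^sub>M lborel)"
    by measurable
  then have G[measurable]: "?G \<in> borel_measurable borel"
    unfolding set_lebesgue_integral_def
    by (intro lborel.borel_measurable_lebesgue_integral) (simp add: split_beta')
  have "(LINT \<xi>|distr R borel ennreal. ?G \<xi>) = (LINT x|R. ?G (ennreal x))"
    by (rule integral_distr) measurable
  also have "\<dots> = (LINT x|R. rate_increment ?h x)"
  proof (rule integral_cong_AE)
    show "AE x in R. ?G (ennreal x) = rate_increment ?h x"
      using nonneg
    proof eventually_elim
      case (elim x)
      have inc: "\<phi> (ennreal x + ennreal \<eta>) - \<phi> (ennreal x) = increment ?h x \<eta>" if "0 < \<eta>" for \<eta>
        using test_function_increment[OF _ elim that] \<phi> by blast
      show ?case
        unfolding rate_increment_def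
        by (rule set_lebesgue_integral_cong) (use elim inc in \<open>auto simp: coag_rate_def\<close>)
    qed
    show "(\<lambda>x. ?G (ennreal x)) \<in> borel_measurable R" by (rule R.measurable_finite_borel) measurable
    show "rate_increment ?h \<in> borel_measurable R"
      by (rule R.measurable_finite_borel[OF rate_increment_measurable[OF h]])
  qed
  finally show "(LINT \<xi>|distr R borel ennreal. ?G \<xi>) = (LINT x|R. rate_increment ?h x)" .
qed

lemma sim_exponent_eq: "sim_exponent \<sigma> = inverse \<alpha>"
  by (simp add: sim_exponent_def \<alpha>_def)

lemma weak_profile_equation_iff:
  assumes R: "real_distribution R" and nonneg: "AE x in R. 0 \<le> x"
  shows "weak_profile_equation \<sigma> (distr R borel ennreal) \<longleftrightarrow>
    (\<forall>\<phi> \<in> C_inf_closed \<inter> X_space. (LINT x|R. half_line_deriv \<phi> x * x) = \<alpha> * (LINT x|R. rate_increment (half_line_deriv \<phi>) x))"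
proof -
  have "inverse \<alpha> * A = B \<longleftrightarrow> A = \<alpha> * B" for A B :: real by (auto simp: field_simps)
  then show ?thesis
    unfolding weak_profile_equation_def by (simp add: profile_terms[OF R nonneg] sim_exponent_eq)
qed

lemma flux_identity_imp_weak:
  assumes R: "real_distribution R" and nonneg: "AE x in R. 0 \<le> x" and flux: "flux_identity R"
  shows "weak_profile_equation \<sigma> (distr R borel ennreal)"
  unfolding weak_profile_equation_iff[OF R nonneg]
proof
  fix \<phi> assume "\<phi> \<in> C_inf_closed \<inter> X_space"
  then obtain C M where "cutoff_function (half_line_deriv \<phi>) C M" using half_line_deriv_cutoff by blast
  then show "(LINT x|R. half_line_deriv \<phi> x * x) = \<alpha> * (LINT x|R. rate_increment (half_line_deriv \<phi>) x)"
    by (rule flux_identity_signed[OF R nonneg flux])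
qed

end

section \<open>The weak equation implies the flux identity\<close>

lemma nn_integral_inverse_near_0:
  assumes "0 < e"
  shows "(\<integral>\<^sup>+w. (if 0 < w \<and> w < e then ennreal (1 / w) else 0) \<partial>lborel) = \<infinity>"
proof -
  have "of_nat n \<le> (\<integral>\<^sup>+w. (if 0 < w \<and> w < e then ennreal (1 / w) else 0) \<partial>lborel)" for n :: nat
  proof -
    \<comment> \<open>Chosen so that the logarithm gains exactly n between the end points.\<close>
    let ?a = "e / 2 * exp (- real n)" and ?b = "e / 2"
    have a: "0 < ?a" "?a \<le> ?b" using assms by auto
    have "(\<integral>\<^sup>+w. ennreal (1 / w) * indicator {?a..?b} w \<partial>lborel) = ennreal (ln ?b - ln ?a)"
    proof (rule nn_integral_FTC_Icc[where F=ln and f="\<lambda>w. 1 / w"])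
      show "(ln has_real_derivative 1 / w) (at w)" if "w \<in> {?a..?b}" for w
        using that a(1) unfolding atLeastAtMost_iff by (intro DERIV_ln_divide) linarith
      show "0 \<le> 1 / w" if "w \<in> {?a..?b}" for w using that a(1) unfolding atLeastAtMost_iff by simp
    qed (use a in auto)
    also have "ln ?b - ln ?a = real n" using assms ln_mult_pos[of "e / 2" "exp (- real n)"] by simp
    finally have "ennreal (real n) = (\<integral>\<^sup>+w. ennreal (1 / w) * indicator {?a..?b} w \<partial>lborel)" ..
    also have "\<dots> \<le> (\<integral>\<^sup>+w. (if 0 < w \<and> w < e then ennreal (1 / w) else 0) \<partial>lborel)"
    proof (rule nn_integral_mono)
      fix w
      show "ennreal (1 / w) * indicator {?a..?b} w \<le> (if 0 < w \<and> w < e then ennreal (1 / w) else 0)"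
      proof (cases "w \<in> {?a..?b}")
        case True
        then have "0 < w" "w < e" using a(1) assms unfolding atLeastAtMost_iff by linarith+
        then show ?thesis by (simp add: indicator_def)
      qed simp
    qed
    finally show ?thesis by (simp add: ennreal_of_nat_eq_real_of_nat)
  qed
  then show ?thesis
    by (metis ennreal_Ex_less_of_nat infinity_ennreal_def less_top linorder_not_less)
qed

context coag_exponent begin

text \<open>As a functional of h the integrated flux is the integral against one measure, the image
  of the rate-weighted triples (x, e, w) with 0 < w < e under x + w. Measures can then be compared
  on a generator.\<close>

lemma flux_measure:
  assumes R: "real_distribution R"
  obtains B :: "real measure" where "sets B = sets borel"
    "\<And>h. h \<in> borel_measurable borel \<Longrightarrow> (\<integral>\<^sup>+x. coag_flux h x \<partial>R) = (\<integral>\<^sup>+x. h x \<partial>B)"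
proof -
  interpret R: real_distribution R by (rule R)
  let ?L = "lborel \<Otimes>\<^sub>M lborel :: (real \<times> real) measure"
  have L: "sigma_finite_measure ?L"
    unfolding lborel_prod by (rule lborel.sigma_finite_measure_axioms)
  have sets_R[measurable_cong]: "sets R = sets borel" by simp
  define g where "g z = ennreal (coag_rate \<sigma> (fst z) (fst (snd z))) *
    (if 0 < snd (snd z) \<and> snd (snd z) < fst (snd z) then 1 else 0)" for z :: "real \<times> real \<times> real"
  have g_meas[measurable]: "g \<in> borel_measurable (R \<Otimes>\<^sub>M ?L)"
    unfolding g_def by measurable
  let ?s = "\<lambda>z::real \<times> real \<times> real. fst z + snd (snd z)"
  have s_meas[measurable]: "?s \<in> borel_measurable (R \<Otimes>\<^sub>M ?L)" by measurable
  define B where "B = distr (density (R \<Otimes>\<^sub>M ?L) g) borel ?s"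
  have "(\<integral>\<^sup>+x. coag_flux h x \<partial>R) = (\<integral>\<^sup>+x. h x \<partial>B)" if h[measurable]: "h \<in> borel_measurable borel" for h
  proof -
    have "(\<integral>\<^sup>+x. h x \<partial>B) = (\<integral>\<^sup>+z. g z * h (?s z) \<partial>(R \<Otimes>\<^sub>M ?L))"
      unfolding B_def by (simp add: nn_integral_distr nn_integral_density)
    also have "\<dots> = (\<integral>\<^sup>+x. \<integral>\<^sup>+p. g (x, p) * h (?s (x, p)) \<partial>?L \<partial>R)"
      by (rule sigma_finite_measure.nn_integral_fst[OF L, symmetric]) measurable
    also have "\<dots> = (\<integral>\<^sup>+x. coag_flux h x \<partial>R)"
    proof (rule nn_integral_cong)
      fix x
      have [measurable]: "(\<lambda>p. g (x, p)) \<in> borel_measurable ?L"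
        unfolding g_def fst_conv snd_conv by measurable
      have "(\<integral>\<^sup>+p. g (x, p) * h (?s (x, p)) \<partial>?L) = (\<integral>\<^sup>+e. \<integral>\<^sup>+w. g (x, (e, w)) * h (?s (x, (e, w))) \<partial>lborel \<partial>lborel)"
        by (rule lborel.nn_integral_fst[symmetric]) measurable
      also have "\<dots> = coag_flux h x"
        unfolding coag_flux_def
      proof (rule nn_integral_cong)
        fix e :: real
        have "(\<integral>\<^sup>+w. g (x, (e, w)) * h (?s (x, (e, w))) \<partial>lborel)
            = (\<integral>\<^sup>+w. ennreal (coag_rate \<sigma> x e) * indicator {0<..} e * (if 0 < w \<and> w < e then h (x + w) else 0) \<partial>lborel)"
          by (rule nn_integral_cong) (auto simp: g_def indicator_def)
        also have "\<dots> = ennreal (coag_rate \<sigma> x e) * indicator {0<..} e * cut_integral h x e"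
          by (rule nn_integral_cmult) measurable
        finally show "(\<integral>\<^sup>+w. g (x, (e, w)) * h (?s (x, (e, w))) \<partial>lborel) = \<dots>" .
      qed
      finally show "(\<integral>\<^sup>+p. g (x, p) * h (?s (x, p)) \<partial>?L) = coag_flux h x" .
    qed
    finally show ?thesis ..
  qed
  then show ?thesis by (intro that[of B]) (simp_all add: B_def)
qed

text \<open>Both sides of the flux identity are measures evaluated at h, so agreement on the rays
  \<open>{..<b}\<close> suffices. These are reached from the smooth test functions by monotone
  convergence of the bumps as c decreases to 0.\<close>

lemma weak_imp_flux_identity:
  assumes R: "real_distribution R" and nonneg: "AE x in R. 0 \<le> x"
    and weak: "weak_profile_equation \<sigma> (distr R borel ennreal)"
  shows "flux_identity R"
proof -
  interpret R: real_distribution R by (rule R)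
  obtain B :: "real measure" where B_sets[measurable_cong]: "sets B = sets borel"
    and B: "\<And>h. h \<in> borel_measurable borel \<Longrightarrow> (\<integral>\<^sup>+x. coag_flux h x \<partial>R) = (\<integral>\<^sup>+x. h x \<partial>B)"
    using flux_measure[OF R] by blast
  have sets_R[measurable_cong]: "sets R = sets borel" by simp
  define A where "A = density R ennreal"
  define B' where "B' = density B (\<lambda>_. ennreal \<alpha>)"
  have A: "(\<integral>\<^sup>+x. h x \<partial>A) = (\<integral>\<^sup>+x. h x * ennreal x \<partial>R)" if [measurable]: "h \<in> borel_measurable borel" for h
    unfolding A_def by (subst nn_integral_density) (simp_all add: mult.commute)
  have B': "(\<integral>\<^sup>+x. h x \<partial>B') = ennreal \<alpha> * (\<integral>\<^sup>+x. coag_flux h x \<partial>R)" if [measurable]: "h \<in> borel_measurable borel" for h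
    unfolding B'_def by (subst nn_integral_density) (simp_all add: B nn_integral_cmult)
  have ivl: "(\<integral>\<^sup>+x. indicator {0..<b} x \<partial>A) = (\<integral>\<^sup>+x. indicator {0..<b} x \<partial>B')" if b: "0 < b" for b
  proof -
    define c :: "nat \<Rightarrow> real" where "c n = inverse (real (Suc n))" for n
    define f where "f n x = ennreal (indicator {0..} x *\<^sub>R bump_poly b (c n) 1 x)" for n x
    have c: "0 < c n" for n by (simp add: c_def)
    have f_meas[measurable]: "f n \<in> borel_measurable borel" for n
    proof -
      have [measurable]: "bump_poly b (c n) 1 \<in> borel_measurable borel"
        by (rule borel_measurable_continuous_onI[OF bump_poly_continuous[OF c]])
      show ?thesis unfolding f_def[abs_def] by measurable
    qed
    have eq: "(\<integral>\<^sup>+x. f n x \<partial>A) = (\<integral>\<^sup>+x. f n x \<partial>B')" for n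
    proof -
      interpret bump_test b "c n" by unfold_locales (rule b, rule c)
      let ?h = "half_line_deriv test_fun"
      have h_eq: "?h x = indicator {0..} x *\<^sub>R bump x" for x
        using deriv_within_test_fun[of x] by (simp add: half_line_deriv_def indicator_def)
      obtain C M where h: "cutoff_function ?h C M" using half_line_deriv_cutoff[OF test_fun_mem] .
      have h0: "0 \<le> ?h x" for x by (simp add: h_eq bump_poly_def)
      have "(LINT x|R. ?h x * x) = \<alpha> * (LINT x|R. rate_increment ?h x)"
        using weak test_fun_mem unfolding weak_profile_equation_iff[OF R nonneg] by blast
      then have "(\<integral>\<^sup>+x. ennreal (?h x) * ennreal x \<partial>R) = ennreal \<alpha> * (\<integral>\<^sup>+x. coag_flux (\<lambda>x. ennreal (?h x)) x \<partial>R)"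
        by (rule flux_identity_iff_real[OF R nonneg h h0, THEN iffD2])
      moreover have "(\<lambda>x. ennreal (?h x)) = f n" by (simp add: f_def[abs_def] h_eq)
      ultimately show ?thesis
        unfolding A[OF f_meas] B'[OF f_meas] by (simp add: fun_eq_iff)
    qed
    have inc: "incseq f"
    proof (rule incseq_SucI, rule le_funI)
      fix n x
      have "c (Suc n) \<le> c n" unfolding c_def by (rule le_imp_inverse_le) auto
      then show "f n x \<le> f (Suc n) x"
        unfolding f_def by (intro ennreal_leI) (auto simp: bump_poly_def indicator_def divide_right_mono)
    qed
    have lim: "(\<lambda>n. f n x) \<longlonglongrightarrow> indicator {0..<b} x" for x
    proof (cases "0 \<le> x \<and> x < b")
      case True
      have "(\<lambda>n. exp (- c n * (1 / (b - x)))) \<longlonglongrightarrow> exp (- 0 * (1 / (b - x)))"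
        unfolding c_def by (intro tendsto_intros LIMSEQ_inverse_real_of_nat)
      then have "(\<lambda>n. ennreal (exp (- c n * (1 / (b - x))))) \<longlonglongrightarrow> ennreal (exp (- 0 * (1 / (b - x))))"
        by (rule tendsto_ennrealI)
      then show ?thesis using True by (simp add: f_def bump_poly_def)
    next
      case False
      then have "f n x = indicator {0..<b} x" for n by (auto simp: f_def bump_poly_def indicator_def)
      then show ?thesis by simp
    qed
    have "(\<lambda>n. \<integral>\<^sup>+x. f n x \<partial>A) \<longlonglongrightarrow> (\<integral>\<^sup>+x. indicator {0..<b} x \<partial>A)"
      by (rule nn_integral_LIMSEQ[OF inc _ lim]) (simp add: A_def)
    moreover have "(\<lambda>n. \<integral>\<^sup>+x. f n x \<partial>B') \<longlonglongrightarrow> (\<integral>\<^sup>+x. indicator {0..<b} x \<partial>B')"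
      by (rule nn_integral_LIMSEQ[OF inc _ lim]) (simp add: B'_def)
    ultimately show ?thesis unfolding eq by (rule LIMSEQ_unique)
  qed
  have sets_A: "sets A = sets borel" and sets_B': "sets B' = sets borel"
    by (simp_all add: A_def B'_def B_sets)
  have A_half: "emeasure A {..<b} = emeasure A {0..<b}" for b
  proof -
    have "(\<integral>\<^sup>+x. indicator {..<b} x \<partial>A) = (\<integral>\<^sup>+x. indicator {0..<b} x \<partial>A)"
      unfolding A[OF borel_measurable_indicator[OF lessThan_borel]] A[OF borel_measurable_indicator[OF atLeastLessThan_borel]]
      by (rule nn_integral_cong_AE, rule eventually_mono[OF nonneg]) (simp add: indicator_def)
    then show ?thesis using sets_A by simp
  qed
  have B_half: "emeasure B' {..<b} = emeasure B' {0..<b}" for b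
  proof -
    have "coag_flux (indicator {..<b}) x = coag_flux (indicator {0..<b}) x" if "0 \<le> x" for x
      unfolding coag_flux_def
      by (intro nn_integral_cong arg_cong2[where f="(*)"] refl) (use that in \<open>auto simp: indicator_def\<close>)
    then have "(\<integral>\<^sup>+x. indicator {..<b} x \<partial>B') = (\<integral>\<^sup>+x. indicator {0..<b} x \<partial>B')"
      unfolding B'[OF borel_measurable_indicator[OF lessThan_borel]] B'[OF borel_measurable_indicator[OF atLeastLessThan_borel]]
      by (intro arg_cong2[where f="(*)"] refl nn_integral_cong_AE eventually_mono[OF nonneg])
    then show ?thesis using sets_B' by simp
  qed
  have eq: "emeasure A {..<b} = emeasure B' {..<b}" for b
  proof (cases "0 < b")
    case True
    then show ?thesis using ivl[OF True] sets_A sets_B' by (simp add: A_half B_half)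
  next
    case False
    then show ?thesis by (simp add: A_half B_half)
  qed
  have "A = B'"
  proof (rule measure_eqI_generator_eq[where \<Omega>=UNIV and E="range lessThan" and A="\<lambda>i::nat. {..<real i}"])
    show "Int_stable (range (lessThan :: real \<Rightarrow> real set))"
    proof (rule Int_stableI)
      fix S T :: "real set" assume "S \<in> range lessThan" "T \<in> range lessThan"
      then obtain a b where "S = {..<a}" "T = {..<b}" by auto
      then have "S \<inter> T = {..<min a b}" by auto
      then show "S \<inter> T \<in> range lessThan" by blast
    qed
    show "sets A = sigma_sets UNIV (range lessThan)" "sets B' = sigma_sets UNIV (range lessThan)"
      unfolding sets_A sets_B' borel_Iio by auto
    show "(\<Union>i::nat. {..<real i}) = UNIV" using reals_Archimedean2 by auto
    \<comment> \<open>The density x of A with respect to R is at most i on this ray, and R has mass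
      1.\<close>
    show "emeasure A {..<real i} \<noteq> \<infinity>" for i :: nat
    proof -
      have "emeasure A {..<real i} = (\<integral>\<^sup>+x. indicator {..<real i} x * ennreal x \<partial>R)"
        using A[of "indicator {..<real i}"] sets_A by simp
      also have "\<dots> \<le> (\<integral>\<^sup>+x. ennreal (real i) \<partial>R)"
        by (intro nn_integral_mono) (auto simp: indicator_def intro: ennreal_leI)
      also have "\<dots> = ennreal (real i)" using R.emeasure_space_1 by simp
      finally show ?thesis by (auto simp: top_unique)
    qed
  qed (use eq in auto)
  then show ?thesis
    unfolding flux_identity_def using A B' by metis
qed

text \<open>Mass at the origin would produce the divergent flux \<open>\<integral> dw / w\<close> against \<open>h(x) = 1 / x\<close>.\<close>
lemma flux_identity_no_mass_at_0:
  assumes R: "real_distribution R" and nonneg: "AE x in R. 0 \<le> x" and flux: "flux_identity R"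
  shows "AE x in R. 0 < x"
proof -
  interpret R: real_distribution R by (rule R)
  have sets_R[measurable_cong]: "sets R = sets borel" by simp
  \<comment> \<open>For this h the left-hand side of the identity is at most the total mass 1, so a
    point with infinite flux cannot carry mass.\<close>
  let ?h = "\<lambda>x::real. if 0 < x then ennreal (1 / x) else 0"
  have h[measurable]: "?h \<in> borel_measurable borel" by measurable
  have flux0: "coag_flux ?h 0 = \<infinity>"
  proof -
    have inf: "cut_integral ?h 0 e = \<infinity>" if "0 < e" for e
      unfolding nn_integral_inverse_near_0[OF that, symmetric] by (rule nn_integral_cong) simp
    have "coag_flux ?h 0 = (\<integral>\<^sup>+e. \<infinity> * indicator {0::real<..} e \<partial>lborel)"
      unfolding coag_flux_def
    proof (rule nn_integral_cong)
      fix e :: real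
      show "ennreal (coag_rate \<sigma> 0 e) * indicator {0<..} e * cut_integral ?h 0 e
        = \<infinity> * indicator {0<..} e"
      proof (cases "0 < e")
        case True
        have "0 < coag_rate \<sigma> 0 e" using True by (simp add: coag_rate_def)
        then show ?thesis unfolding inf[OF True] using True by (simp add: ennreal_mult_top)
      qed simp
    qed
    also have "\<dots> = \<infinity> * emeasure lborel {0::real<..}"
      by (rule nn_integral_cmult_indicator) simp
    also have "emeasure lborel {0::real<..} \<noteq> 0"
    proof -
      have "emeasure lborel {0<..<1::real} \<le> emeasure lborel {0::real<..}" by (rule emeasure_mono) auto
      then show ?thesis by auto
    qed
    then have "\<infinity> * emeasure lborel {0::real<..} = \<infinity>" by (simp add: ennreal_top_mult)
    finally show ?thesis .
  qed
  have "ennreal \<alpha> * (\<infinity> * emeasure R {0}) \<le> ennreal \<alpha> * (\<integral>\<^sup>+x. coag_flux ?h x \<partial>R)"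
  proof (rule mult_left_mono)
    have "\<infinity> * emeasure R {0} = (\<integral>\<^sup>+x. \<infinity> * indicator {0} x \<partial>R)"
      by (rule nn_integral_cmult_indicator[symmetric]) simp
    also have "\<dots> \<le> (\<integral>\<^sup>+x. coag_flux ?h x \<partial>R)"
      by (rule nn_integral_mono) (auto simp: indicator_def flux0)
    finally show "\<infinity> * emeasure R {0} \<le> (\<integral>\<^sup>+x. coag_flux ?h x \<partial>R)" .
  qed simp
  also have "\<dots> = (\<integral>\<^sup>+x. ?h x * ennreal x \<partial>R)"
    using flux h unfolding flux_identity_def by metis
  also have "\<dots> \<le> (\<integral>\<^sup>+x. 1 \<partial>R)"
    by (rule nn_integral_mono) (auto simp flip: ennreal_mult' ennreal_1)
  also have "\<dots> = 1" using R.emeasure_space_1 by simp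
  finally have "emeasure R {0} = 0"
    by (rule contrapos_pp) (simp add: ennreal_top_mult ennreal_mult_top top_unique)
  then have "AE x in R. x \<noteq> 0" by (intro AE_I[where N="{0}"]) auto
  with nonneg show ?thesis by eventually_elim simp
qed

end

section \<open>Self-similar profiles\<close>

lemma ennreal_continuous_bounded:
  fixes \<psi> :: "ennreal \<Rightarrow> real"
  assumes "continuous_on UNIV \<psi>"
  obtains B where "\<And>x. \<bar>\<psi> x\<bar> \<le> B"
proof -
  have "compact (range \<psi>)" using assms by (intro compact_continuous_image compact_UNIV)
  then have "bounded (range \<psi>)" by (rule compact_imp_bounded)
  then show ?thesis using that by (auto simp: bounded_iff)
qed

context coag_exponent begin

text \<open>Testing with the constant 1 gives total mass 1. The scaling fixes infinity, so an atom
  there survives in the ansatz at every t > 0; testing with min(x, 1), which is 1 at infinity and 0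
  at 0, excludes it.\<close>

lemma dirac_start_imp_real_distribution:
  assumes F: "F \<in> radon_measures" and dirac: "starts_from_dirac \<sigma> F"
  obtains R where "real_distribution R" "AE x in R. 0 \<le> x" "F = distr R borel ennreal"
proof -
  have sets_F[measurable_cong]: "sets F = sets borel" and fin: "finite_measure F"
    using F by (auto simp: radon_measures_def)
  interpret finite_measure F by (rule fin)
  have space_F: "space F = UNIV" using sets_eq_imp_space_eq[OF sets_F] by simp
  let ?m = "\<lambda>t \<xi>. ennreal (t powr sim_exponent \<sigma>) * \<xi>"
  have [measurable]: "?m t \<in> F \<rightarrow>\<^sub>M borel" for t by measurable
  have ansatz: "(LINT V|self_similar_ansatz \<sigma> F t. \<psi> V) = (LINT \<xi>|F. \<psi> (?m t \<xi>))"
    if "continuous_on UNIV \<psi>" for \<psi> :: "ennreal \<Rightarrow> real" and t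
    unfolding self_similar_ansatz_def
    using that by (intro integral_distr borel_measurable_continuous_onI) measurable
  have mass: "measure F UNIV = 1"
  proof -
    have "((\<lambda>t. LINT V|self_similar_ansatz \<sigma> F t. (\<lambda>_. 1 :: real) V) \<longlongrightarrow> 1) (at_right 0)"
      using dirac[unfolded starts_from_dirac_def, rule_format, of "\<lambda>_. 1"] by simp
    then have "((\<lambda>t::real. measure F UNIV) \<longlongrightarrow> 1) (at_right 0)"
      unfolding ansatz[OF continuous_on_const] by (simp add: space_F)
    then show ?thesis by (simp add: tendsto_const_iff)
  qed
  have no_inf: "measure F {\<infinity>} = 0"
  proof -
    define \<psi> :: "ennreal \<Rightarrow> real" where "\<psi> x = enn2real (min x 1)" for x
    have lt: "min x 1 \<noteq> (\<infinity> :: ennreal)" for x by (metis ennreal_one_neq_top infinity_ennreal_def min.cobounded2 top_unique)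
    have cont: "continuous_on UNIV \<psi>"
      unfolding continuous_on_def
    proof
      fix x :: ennreal
      obtain y where y: "0 \<le> y" "min x 1 = ennreal y"
        using lt[of x] by (cases "min x 1") auto
      have "((\<lambda>z. min z 1) \<longlongrightarrow> min x 1) (at x)" by (intro tendsto_intros)
      then have "((\<lambda>z. enn2real (min z 1)) \<longlongrightarrow> y) (at x)"
        using y by (intro tendsto_enn2real) auto
      then show "(\<psi> \<longlongrightarrow> \<psi> x) (at x)" using y by (simp add: \<psi>_def[abs_def])
    qed
    then have [measurable]: "\<psi> \<in> borel_measurable borel" by (rule borel_measurable_continuous_onI)
    have \<psi>01: "0 \<le> \<psi> x" "\<psi> x \<le> 1" for x
    proof -
      have "enn2real (min x 1) \<le> enn2real 1" by (rule enn2real_mono) simp_all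
      then show "0 \<le> \<psi> x" "\<psi> x \<le> 1" by (simp_all add: \<psi>_def)
    qed
    have "measure F {\<infinity>} \<le> (LINT V|self_similar_ansatz \<sigma> F t. \<psi> V)" if "0 < t" for t
    proof -
      have "measure F {\<infinity>} = (LINT \<xi>|F. indicator {\<infinity>} \<xi>)" by (simp add: space_F)
      also have "\<dots> \<le> (LINT \<xi>|F. \<psi> (?m t \<xi>))"
      proof (rule integral_mono)
        show "integrable F (\<lambda>\<xi>. indicator {\<infinity>} \<xi> :: real)"
          by (rule integrable_const_bound[where B=1]) (auto simp: indicator_def)
        show "integrable F (\<lambda>\<xi>. \<psi> (?m t \<xi>))"
          by (rule integrable_const_bound[where B=1]) (use \<psi>01 in auto)
        fix \<xi>
        have "\<psi> (?m t \<infinity>) = 1" using that by (simp add: \<psi>_def ennreal_mult_top min_absorb2)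
        then show "indicator {\<infinity>} \<xi> \<le> \<psi> (?m t \<xi>)" using \<psi>01 by (auto simp: indicator_def)
      qed
      finally show ?thesis by (simp add: ansatz[OF cont])
    qed
    then have "\<forall>\<^sub>F t in at_right 0. measure F {\<infinity>} \<le> (LINT V|self_similar_ansatz \<sigma> F t. \<psi> V)"
      by (auto simp: eventually_at_right_field intro: exI[of _ 1])
    moreover have "((\<lambda>t. LINT V|self_similar_ansatz \<sigma> F t. \<psi> V) \<longlongrightarrow> \<psi> 0) (at_right 0)"
      using dirac cont unfolding starts_from_dirac_def by blast
    ultimately have "measure F {\<infinity>} \<le> \<psi> 0"
      by (intro tendsto_lowerbound[where F="at_right (0::real)"]) simp_all
    then show ?thesis by (simp add: \<psi>_def measure_le_0_iff)
  qed
  have AE_fin: "AE \<xi> in F. \<xi> \<noteq> \<infinity>"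
  proof (rule AE_I[where N="{\<infinity>}"])
    show "emeasure F {\<infinity>} = 0" using no_inf by (simp add: emeasure_eq_measure)
  qed (auto simp: sets_F)
  have prob: "prob_space F"
    by (intro prob_spaceI) (simp add: space_F emeasure_eq_measure mass)
  define R where "R = distr F borel enn2real"
  have "real_distribution R"
    unfolding R_def by (rule prob_space.real_distribution_distr[OF prob]) measurable
  moreover have "AE x in R. 0 \<le> x"
    unfolding R_def by (subst AE_distr_iff) simp_all
  moreover have "F = distr R borel ennreal"
  proof -
    have "distr R borel ennreal = distr F borel (ennreal \<circ> enn2real)"
      unfolding R_def by (rule distr_distr) measurable
    also have "\<dots> = distr F F (\<lambda>\<xi>. \<xi>)"
    proof (rule distr_cong_AE)
      show "AE \<xi> in F. (ennreal \<circ> enn2real) \<xi> = \<xi>"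
        using AE_fin by eventually_elim (simp add: less_top)
    qed (simp_all add: sets_F)
    also have "\<dots> = F" by (rule distr_id)
    finally show ?thesis ..
  qed
  ultimately show ?thesis by (rule that)
qed

text \<open>For each finite x the point \<open>t powr sim_exponent \<sigma> * x\<close> tends to 0
  with t, and \<psi> is bounded by compactness of [0, oo], so dominated convergence applies.\<close>

lemma real_distribution_starts_from_dirac:
  assumes R: "real_distribution R" and nonneg: "AE x in R. 0 \<le> x"
  shows "distr R borel ennreal \<in> radon_measures" "starts_from_dirac \<sigma> (distr R borel ennreal)"
proof -
  interpret R: real_distribution R by (rule R)
  have [measurable]: "ennreal \<in> borel_measurable R" by (rule R.measurable_finite_borel) measurable
  have "prob_space (distr R borel ennreal)" by (rule R.prob_space_distr) measurable
  then show "distr R borel ennreal \<in> radon_measures"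
    by (simp add: radon_measures_def prob_space.finite_measure)
  have \<mu>: "0 < sim_exponent \<sigma>" by (simp add: sim_exponent_eq)
  show "starts_from_dirac \<sigma> (distr R borel ennreal)"
    unfolding starts_from_dirac_def
  proof (intro allI impI)
    fix \<psi> :: "ennreal \<Rightarrow> real" assume cont: "continuous_on UNIV \<psi>"
    then have \<psi>[measurable]: "\<psi> \<in> borel_measurable borel" by (rule borel_measurable_continuous_onI)
    obtain B where B: "\<And>x. \<bar>\<psi> x\<bar> \<le> B" using ennreal_continuous_bounded[OF cont] by blast
    let ?u = "\<lambda>t x. \<psi> (ennreal (t powr sim_exponent \<sigma>) * ennreal x)"
    have u_meas[measurable]: "?u t \<in> borel_measurable R" for t by (rule R.measurable_finite_borel) measurable
    have eq: "(LINT V|self_similar_ansatz \<sigma> (distr R borel ennreal) t. \<psi> V) = (LINT x|R. ?u t x)" for t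
    proof -
      have "self_similar_ansatz \<sigma> (distr R borel ennreal) t = distr R borel ((\<lambda>\<xi>. ennreal (t powr sim_exponent \<sigma>) * \<xi>) \<circ> ennreal)"
        unfolding self_similar_ansatz_def by (rule distr_distr) measurable
      then have "(LINT V|self_similar_ansatz \<sigma> (distr R borel ennreal) t. \<psi> V)
          = (LINT V|distr R borel (\<lambda>x. ennreal (t powr sim_exponent \<sigma>) * ennreal x). \<psi> V)"
        by (simp add: o_def)
      also have "\<dots> = (LINT x|R. ?u t x)" by (rule integral_distr) measurable
      finally show ?thesis .
    qed
    have "(\<lambda>n. LINT x|R. ?u (X n) x) \<longlonglongrightarrow> \<psi> 0" if X: "\<And>n. 0 < X n" "X \<longlonglongrightarrow> 0" for X
    proof -
      have "(\<lambda>n. LINT x|R. ?u (X n) x) \<longlonglongrightarrow> (LINT x|R. \<psi> 0)"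
      proof (rule integral_dominated_convergence[where w="\<lambda>_. B"])
        show "AE x in R. (\<lambda>n. ?u (X n) x) \<longlonglongrightarrow> \<psi> 0"
          using nonneg
        proof eventually_elim
          case (elim x)
          have "(\<lambda>n. X n powr sim_exponent \<sigma>) \<longlonglongrightarrow> 0 powr sim_exponent \<sigma>"
            using X \<mu> by (intro tendsto_powr' tendsto_const) (auto simp: less_imp_le)
          then have "(\<lambda>n. X n powr sim_exponent \<sigma> * x) \<longlonglongrightarrow> 0 * x" by (intro tendsto_intros) simp
          then have "(\<lambda>n. ennreal (X n powr sim_exponent \<sigma> * x)) \<longlonglongrightarrow> ennreal 0"
            by (intro tendsto_ennrealI) simp
          moreover have "isCont \<psi> 0" using cont by (simp add: continuous_on_eq_continuous_at)
          ultimately have "(\<lambda>n. \<psi> (ennreal (X n powr sim_exponent \<sigma> * x))) \<longlonglongrightarrow> \<psi> 0"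
            by (intro isCont_tendsto_compose[of 0 \<psi>]) simp_all
          then show ?case using elim by (simp add: ennreal_mult')
        qed
        show "AE x in R. norm (?u (X n) x) \<le> B" for n using B by simp
      qed measurable
      then show ?thesis using R.prob_space by simp
    qed
    then have "((\<lambda>t. LINT x|R. ?u t x) \<longlongrightarrow> \<psi> 0) (at_right 0)"
      unfolding tendsto_at_iff_sequentially o_def by auto
    then show "((\<lambda>t. LINT V|self_similar_ansatz \<sigma> (distr R borel ennreal) t. \<psi> V) \<longlongrightarrow> \<psi> 0) (at_right 0)"
      by (simp add: eq)
  qed
qed

abbreviation profile_of :: "real measure \<Rightarrow> ennreal measure" where
  "profile_of \<nu> \<equiv> distr (distr \<nu> borel (\<lambda>y. y powr (- (1 / \<alpha>)))) borel ennreal"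

text \<open>Strict positivity makes the powers -\<alpha> and -1/\<alpha> mutually inverse almost
  everywhere, so existence and uniqueness of profiles reduce to those of fixed points.\<close>

lemma self_similar_profile_iff:
  "self_similar_profile \<sigma> F \<longleftrightarrow> (\<exists>\<nu>. real_distribution \<nu> \<and> (AE y in \<nu>. 0 < y) \<and> mult_smear kernel \<nu> = \<nu> \<and>
     F = profile_of \<nu>)"
proof
  assume "self_similar_profile \<sigma> F"
  then have F: "F \<in> radon_measures" "starts_from_dirac \<sigma> F" "weak_profile_equation \<sigma> F"
    by (auto simp: self_similar_profile_def)
  obtain R where R: "real_distribution R" "AE x in R. 0 \<le> x" "F = distr R borel ennreal"
    using dirac_start_imp_real_distribution[OF F(1,2)] .
  interpret R: real_distribution R by (rule R)
  have flux: "flux_identity R" using F(3) unfolding R(3) by (rule weak_imp_flux_identity[OF R(1,2)])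
  have pos: "AE x in R. 0 < x" by (rule flux_identity_no_mass_at_0[OF R(1,2) flux])
  let ?\<nu> = "distr R borel (\<lambda>x. x powr (- \<alpha>))"
  have m[measurable]: "(\<lambda>x. x powr (- \<alpha>)) \<in> borel_measurable R" by (rule R.measurable_finite_borel) measurable
  have dist: "real_distribution ?\<nu>" by (rule R.real_distribution_distr[OF m])
  have pos': "AE y in ?\<nu>. 0 < y"
  proof (subst AE_distr_iff[OF m])
    show "AE x in R. 0 < x powr (- \<alpha>)" using pos by eventually_elim simp
  qed simp
  have fixed: "mult_smear kernel ?\<nu> = ?\<nu>"
    using flux flux_identity_iff_fixed_point[OF R(1) pos] by blast
  have "R = distr ?\<nu> borel (\<lambda>y. y powr (- (1 / \<alpha>)))"
  proof -
    have "distr ?\<nu> borel (\<lambda>y. y powr (- (1 / \<alpha>))) = distr R borel ((\<lambda>y. y powr (- (1 / \<alpha>))) \<circ> (\<lambda>x. x powr (- \<alpha>)))"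
      by (rule distr_distr) measurable
    also have "\<dots> = distr R R (\<lambda>x. x)"
    proof (rule distr_cong_AE)
      show "AE x in R. ((\<lambda>y. y powr (- (1 / \<alpha>))) \<circ> (\<lambda>x. x powr (- \<alpha>))) x = x"
        using pos by eventually_elim (simp add: powr_powr)
    qed (simp_all add: R.measurable_finite_borel)
    also have "\<dots> = R" by (rule distr_id)
    finally show ?thesis ..
  qed
  from trans[OF R(3) arg_cong[where f="\<lambda>M. distr M borel ennreal", OF this]]
  show "\<exists>\<nu>. real_distribution \<nu> \<and> (AE y in \<nu>. 0 < y) \<and> mult_smear kernel \<nu> = \<nu> \<and>
     F = profile_of \<nu>"
    by (intro exI[of _ ?\<nu>] conjI dist pos' fixed)
next
  assume "\<exists>\<nu>. real_distribution \<nu> \<and> (AE y in \<nu>. 0 < y) \<and> mult_smear kernel \<nu> = \<nu> \<and>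
     F = profile_of \<nu>"
  then obtain \<nu> where nu: "real_distribution \<nu>" "AE y in \<nu>. 0 < y" "mult_smear kernel \<nu> = \<nu>"
    and F: "F = profile_of \<nu>" by blast
  interpret nu: real_distribution \<nu> by (rule nu)
  let ?R = "distr \<nu> borel (\<lambda>y. y powr (- (1 / \<alpha>)))"
  have m[measurable]: "(\<lambda>y. y powr (- (1 / \<alpha>))) \<in> borel_measurable \<nu>" by (rule nu.measurable_finite_borel) measurable
  have R: "real_distribution ?R" by (rule nu.real_distribution_distr[OF m])
  have pos: "AE x in ?R. 0 < x"
  proof (subst AE_distr_iff[OF m])
    show "AE y in \<nu>. 0 < y powr (- (1 / \<alpha>))" using nu(2) by eventually_elim simp
  qed simp
  then have nonneg: "AE x in ?R. 0 \<le> x" by (rule eventually_mono) simp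
  have inv: "distr ?R borel (\<lambda>x. x powr (- \<alpha>)) = \<nu>"
  proof -
    have "distr ?R borel (\<lambda>x. x powr (- \<alpha>)) = distr \<nu> borel ((\<lambda>x. x powr (- \<alpha>)) \<circ> (\<lambda>y. y powr (- (1 / \<alpha>))))"
      by (rule distr_distr) measurable
    also have "\<dots> = distr \<nu> \<nu> (\<lambda>y. y)"
    proof (rule distr_cong_AE)
      show "AE y in \<nu>. ((\<lambda>x. x powr (- \<alpha>)) \<circ> (\<lambda>y. y powr (- (1 / \<alpha>)))) y = y"
        using nu(2) by eventually_elim (simp add: powr_powr)
    qed (simp_all add: nu.measurable_finite_borel)
    also have "\<dots> = \<nu>" by (rule distr_id)
    finally show ?thesis .
  qed
  have "flux_identity ?R"
    by (rule flux_identity_iff_fixed_point[OF R pos, unfolded inv, THEN iffD2, OF nu(3)])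
  then show "self_similar_profile \<sigma> F"
    unfolding self_similar_profile_def F
    using real_distribution_starts_from_dirac[OF R nonneg] flux_identity_imp_weak[OF R nonneg] by blast
qed

section \<open>Regularity, moments and mass of the profile\<close>

context
  fixes \<nu> :: "real measure"
  assumes nu: "real_distribution \<nu>" and nu_pos: "AE y in \<nu>. 0 < y" and nu_fixed: "mult_smear kernel \<nu> = \<nu>"
begin

text \<open>The profile variable is exp(-(1/\<alpha>) ln Y), the exponential of a variable whose
  characteristic function decays rapidly.\<close>

lemma profile_smooth_density:
  "has_smooth_density (profile_of \<nu>)"
proof -
  interpret nu: real_distribution \<nu> by (rule nu)
  let ?Q = "distr \<nu> borel (\<lambda>y. (- (1 / \<alpha>)) * ln y)"
  interpret Q: rapid_char ?Q
    by (rule rapid_char_log[OF nu nu_pos nu_fixed]) simp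
  have "distr \<nu> borel (\<lambda>y. y powr (- (1 / \<alpha>))) = distr ?Q borel exp"
  proof -
    have "distr ?Q borel exp = distr \<nu> borel (exp \<circ> (\<lambda>y. (- (1 / \<alpha>)) * ln y))"
    proof (rule distr_distr)
      show "(\<lambda>y. (- (1 / \<alpha>)) * ln y) \<in> borel_measurable \<nu>" by (rule nu.measurable_finite_borel) measurable
    qed measurable
    also have "\<dots> = distr \<nu> borel (\<lambda>y. y powr (- (1 / \<alpha>)))"
    proof (rule distr_cong_AE)
      show "AE y in \<nu>. (exp \<circ> (\<lambda>y. (- (1 / \<alpha>)) * ln y)) y = y powr (- (1 / \<alpha>))"
        using nu_pos by eventually_elim (simp add: powr_def)
    qed (rule refl | rule nu.measurable_finite_borel, measurable)+
    finally show ?thesis ..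
  qed
  then show ?thesis
    unfolding has_smooth_density_def Q.distr_exp_eq_density
    using Q.exp_density_smooth Q.exp_density_nonneg Q.distr_exp_eq_density by auto
qed

text \<open>Real exponents are dominated by integer ones, for which the moments are
  explicit.\<close>

lemma fixed_point_power_finite:
  assumes "0 \<le> p"
  shows "(\<integral>\<^sup>+y. ennreal (y powr p) \<partial>\<nu>) < \<infinity>"
proof -
  interpret nu: real_distribution \<nu> by (rule nu)
  have nonneg: "AE y in \<nu>. 0 \<le> y" using nu_pos by (rule eventually_mono) simp
  obtain n :: nat where n: "p \<le> real n" using real_arch_simple by blast
  have "(\<integral>\<^sup>+y. ennreal (y powr p) \<partial>\<nu>) \<le> (\<integral>\<^sup>+y. 1 + ennreal (y ^ n) \<partial>\<nu>)"
  proof (rule nn_integral_mono_AE)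
    show "AE y in \<nu>. ennreal (y powr p) \<le> 1 + ennreal (y ^ n)"
      using nu_pos
    proof eventually_elim
      case (elim y)
      have "y powr p \<le> 1 + y ^ n"
      proof (cases "y \<le> 1")
        case True
        then have "y powr p \<le> 1" using elim assms by (intro powr_le1) auto
        then show ?thesis using elim by (simp add: add_increasing2)
      next
        case False
        then have "y powr p \<le> y powr real n" using n by (intro powr_mono) auto
        then show ?thesis using elim by (simp add: powr_realpow)
      qed
      then have "ennreal (y powr p) \<le> ennreal (1 + y ^ n)" by (rule ennreal_leI)
      then show ?case using elim by (simp add: ennreal_plus)
    qed
  qed
  also have "\<dots> = (\<integral>\<^sup>+y. 1 \<partial>\<nu>) + (\<integral>\<^sup>+y. ennreal (y ^ n) \<partial>\<nu>)"
    by (rule nn_integral_add) (rule nu.measurable_finite_borel, measurable)+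
  also have "\<dots> < \<infinity>"
    unfolding fixed_point_moments[OF nu nonneg nu_fixed] using nu.emeasure_space_1 by simp
  finally show ?thesis .
qed

text \<open>Inserting \<open>y powr (- b)\<close> into the fixed-point equation gains one factor y:
  the exponent becomes 1 - b > 0, where the moment is finite, and the other factor is the kernel
  moment of order -b, finite for b < 1.\<close>

lemma fixed_point_neg_power_finite:
  assumes b: "0 < b" "b < 1"
  shows "(\<integral>\<^sup>+y. ennreal (y powr (- b)) \<partial>\<nu>) < \<infinity>"
proof -
  interpret nu: real_distribution \<nu> by (rule nu)
  let ?T = "\<integral>\<^sup>+r. ennreal (r powr (- b)) \<partial>kernel"
  have "(\<integral>\<^sup>+y. ennreal (y powr (- b)) \<partial>\<nu>) = (\<integral>\<^sup>+y. ennreal y * (\<integral>\<^sup>+r. ennreal ((y * r) powr (- b)) \<partial>kernel) \<partial>\<nu>)"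
    using nn_integral_mult_smear[OF nu.events_eq_borel, of "\<lambda>y. ennreal (y powr (- b))"] by (simp add: nu_fixed)
  also have "\<dots> = (\<integral>\<^sup>+y. ennreal (y powr (1 - b)) * ?T \<partial>\<nu>)"
  proof (rule nn_integral_cong_AE)
    show "AE y in \<nu>. ennreal y * (\<integral>\<^sup>+r. ennreal ((y * r) powr (- b)) \<partial>kernel) = ennreal (y powr (1 - b)) * ?T"
      using nu_pos
    proof eventually_elim
      case (elim y)
      have "(\<integral>\<^sup>+r. ennreal ((y * r) powr (- b)) \<partial>kernel) = (\<integral>\<^sup>+r. ennreal (y powr (- b)) * ennreal (r powr (- b)) \<partial>kernel)"
      proof (rule nn_integral_cong_AE)
        show "AE r in kernel. ennreal ((y * r) powr (- b)) = ennreal (y powr (- b)) * ennreal (r powr (- b))"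
          using kernel_AE by eventually_elim (use elim in \<open>simp add: powr_mult flip: ennreal_mult'\<close>)
      qed
      also have "\<dots> = ennreal (y powr (- b)) * ?T" by (rule nn_integral_cmult) measurable
      finally have "ennreal y * (\<integral>\<^sup>+r. ennreal ((y * r) powr (- b)) \<partial>kernel) = ennreal (y * y powr (- b)) * ?T"
        using elim by (simp add: ennreal_mult' mult.assoc)
      also have "y * y powr (- b) = y powr (1 - b)" using elim powr_add[of y 1 "- b"] by simp
      finally show ?case .
    qed
  qed
  also have "\<dots> = (\<integral>\<^sup>+y. ennreal (y powr (1 - b)) \<partial>\<nu>) * ?T"
    by (rule nn_integral_multc) (rule nu.measurable_finite_borel, measurable)
  also have "\<dots> < \<infinity>"
    using fixed_point_power_finite[of "1 - b"] nn_integral_kernel_neg_power[OF b] b by (simp add: ennreal_mult_less_top)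
  finally show ?thesis .
qed

text \<open>In terms of y the powers \<beta> and -\<gamma> become -\<beta>/\<alpha> and
  \<gamma>/\<alpha>; the condition \<beta> < \<alpha> says that the first of these is above
  -1.\<close>

lemma profile_moments:
  assumes "0 < \<gamma>" "0 < \<beta>" "\<beta> < \<alpha>"
  shows "(\<integral>\<^sup>+\<xi>\<in>{0<..<\<infinity>}. ennreal (enn2real \<xi> powr \<beta> + enn2real \<xi> powr (-\<gamma>))
    \<partial>profile_of \<nu>) < \<infinity>"
proof -
  interpret nu: real_distribution \<nu> by (rule nu)
  have m[measurable]: "(\<lambda>y. y powr (- (1 / \<alpha>))) \<in> borel_measurable \<nu>" by (rule nu.measurable_finite_borel) measurable
  have "profile_of \<nu> = distr \<nu> borel (ennreal \<circ> (\<lambda>y. y powr (- (1 / \<alpha>))))"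
    by (rule distr_distr) measurable
  then have "(\<integral>\<^sup>+\<xi>\<in>{0<..<\<infinity>}. ennreal (enn2real \<xi> powr \<beta> + enn2real \<xi> powr (-\<gamma>))
      \<partial>profile_of \<nu>)
    = (\<integral>\<^sup>+\<xi>\<in>{0<..<\<infinity>}. ennreal (enn2real \<xi> powr \<beta> + enn2real \<xi> powr (-\<gamma>)) \<partial>distr \<nu> borel (\<lambda>y. ennreal (y powr (- (1 / \<alpha>)))))"
    by (simp add: o_def)
  also have "\<dots> \<le> (\<integral>\<^sup>+\<xi>. ennreal (enn2real \<xi> powr \<beta> + enn2real \<xi> powr (-\<gamma>)) \<partial>distr \<nu> borel (\<lambda>y. ennreal (y powr (- (1 / \<alpha>)))))"
    by (rule nn_integral_mono) (simp add: indicator_def)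
  also have "\<dots> = (\<integral>\<^sup>+y. ennreal (enn2real (ennreal (y powr (- (1 / \<alpha>)))) powr \<beta> + enn2real (ennreal (y powr (- (1 / \<alpha>)))) powr (-\<gamma>)) \<partial>\<nu>)"
    by (rule nn_integral_distr) measurable
  also have "\<dots> = (\<integral>\<^sup>+y. ennreal (y powr (- (\<beta> / \<alpha>))) + ennreal (y powr (\<gamma> / \<alpha>)) \<partial>\<nu>)"
    by (intro nn_integral_cong) (simp add: powr_powr ennreal_plus)
  also have "\<dots> = (\<integral>\<^sup>+y. ennreal (y powr (- (\<beta> / \<alpha>))) \<partial>\<nu>) + (\<integral>\<^sup>+y. ennreal (y powr (\<gamma> / \<alpha>)) \<partial>\<nu>)"
    by (rule nn_integral_add) (rule nu.measurable_finite_borel, measurable)+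
  also have "\<dots> < \<infinity>"
    using fixed_point_neg_power_finite[of "\<beta> / \<alpha>"] fixed_point_power_finite[of "\<gamma> / \<alpha>"] assms
    by (simp add: pos_divide_less_eq)
  finally show ?thesis .
qed

lemma profile_mass:
  "(LINT \<xi>|profile_of \<nu>. 1) = (1 :: real)"
proof -
  interpret nu: real_distribution \<nu> by (rule nu)
  interpret R: prob_space "distr \<nu> borel (\<lambda>y. y powr (- (1 / \<alpha>)))"
    by (rule nu.prob_space_distr, rule nu.measurable_finite_borel) measurable
  interpret F: prob_space "profile_of \<nu>"
    by (rule R.prob_space_distr) measurable
  show ?thesis using F.prob_space by simp
qed

end

end

theorem theorem2p4:
  fixes \<sigma> :: real
  assumes "5/3 < \<sigma>" and "\<sigma> < 2"
  shows "(\<exists>!F. self_similar_profile \<sigma> F) \<and>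
    (\<forall>F. self_similar_profile \<sigma> F \<longrightarrow>
       has_smooth_density F \<and>
       (\<forall>\<gamma> \<beta>. 0 < \<gamma> \<and> 0 < \<beta> \<and> \<beta> < \<sigma> - 5/3 \<longrightarrow>
          (\<integral>\<^sup>+\<xi>\<in>{0<..<\<infinity>}. ennreal (enn2real \<xi> powr \<beta> + enn2real \<xi> powr (-\<gamma>)) \<partial>F) < \<infinity>) \<and>
       (LINT \<xi>|F. 1) = (1 :: real))"
proof -
  interpret coag_exponent \<sigma> using assms by unfold_locales
  obtain \<nu> where nu: "real_distribution \<nu>" "AE y in \<nu>. 0 < y" "mult_smear kernel \<nu> = \<nu>"
    by (rule fixed_point_exists)
  let ?F = "profile_of \<nu>"
  have "self_similar_profile \<sigma> F \<longleftrightarrow> F = ?F" for F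
  proof
    assume "self_similar_profile \<sigma> F"
    then obtain \<nu>' where nu': "real_distribution \<nu>'" "AE y in \<nu>'. 0 < y" "mult_smear kernel \<nu>' = \<nu>'"
      and F: "F = profile_of \<nu>'"
      unfolding self_similar_profile_iff by blast
    have "\<nu>' = \<nu>"
      by (rule fixed_point_unique[OF nu'(1) _ nu'(3) nu(1) _ nu(3)])
        (rule eventually_mono[OF nu'(2)] eventually_mono[OF nu(2)], simp)+
    then show "F = ?F" using F by simp
  qed (use nu in \<open>auto simp: self_similar_profile_iff\<close>)
  then show ?thesis
    using profile_smooth_density[OF nu] profile_moments[OF nu] profile_mass[OF nu]
    by (auto simp: \<alpha>_def)
qed

end
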